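(* Let $n\ge 2$ and let $K$ be a convex body in $\mathbb{R}^n$ whose Santal\'o point is the origin, such that $\partial K$ is of class $C^3$ and has strictly positive Gaussian curvature everywhere. Let $\beta>\frac{n+1}{2}$ and for $t>0$ let $$S_{\beta}(K,t)=\Big\{x\in K:\ \int_{K^0}\frac{dy}{(1-\langle x,y\rangle)^{\beta}}\le t\Big\}.$$ Then $$\lim_{t\to\infty}\Big(\frac{t}{c_{n,\beta}}\Big)^{\frac{1}{\beta-\frac{n+1}{2}}}\big(|K|-|S_{\beta}(K,t)|\big)=\int_{S^{n-1}}\frac{f_{K^0}(u)^{\frac{1}{2\beta-(n+1)}}}{h_{K^0}(u)^{\,n-\frac{n+1}{2\beta-(n+1)}}}\,d\sigma(u),$$ where $c_{n,\beta}=2^{\frac{n-1}{2}}v_{n-1}\,B\big(\tfrac{n+1}{2},\beta-\tfrac{n+1}{2}\big)$.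
   Context: For a convex body $K$ and $x$ in its interior, $K^x=\{y\in\mathbb{R}^n:\langle y,z-x\rangle\le 1 \text{ for all } z\in K\}$. The Santal\'o point of $K$ is the unique interior point $x$ minimizing $|K^x|$; when it is the origin, $K^0$ denotes the polar body $\{y:\langle y,z\rangle\le1\ \forall z\in K\}$, and $0$ is then the centroid of $K^0$. $|\cdot|$ denotes $n$-dimensional volume, $v_{m}$ is the volume of the $m$-dimensional Euclidean unit ball, $B(x,y)=\int_0^1 s^{x-1}(1-s)^{y-1}ds$ is the Beta function, $\sigma$ is the spherical Lebesgue measure on $S^{n-1}$, $h_L$ is the support function of a convex body $L$, and $f_L(u)$ is the curvature function of $L$, i.e. the reciprocal of the Gauss curvature of $\partial L$ at the boundary point with outer normal $u$. *)

theory Defs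
  imports "HOL-Analysis.Analysis"
begin

type_synonym 'n vec = "real ^ 'n"

definition convex_body :: "('n::finite) vec set \<Rightarrow> bool" where
  "convex_body K \<longleftrightarrow> compact K \<and> convex K \<and> interior K \<noteq> {}"

definition polar_at :: "('n::finite) vec set \<Rightarrow> 'n vec \<Rightarrow> 'n vec set" where
  "polar_at K x = {y. \<forall>z\<in>K. y \<bullet> (z - x) \<le> 1}"

definition polar :: "('n::finite) vec set \<Rightarrow> 'n vec set" where
  "polar K = {y. \<forall>z\<in>K. y \<bullet> z \<le> 1}"

definition vol :: "('n::finite) vec set \<Rightarrow> real" where
  "vol A = measure lebesgue A"

text \<open>x is the Santalo point of K: the interior point minimizing vol (K^x)
  (the minimizer is unique, a classical fact).\<close>
definition is_santalo_point :: "('n::finite) vec set \<Rightarrow> 'n vec \<Rightarrow> bool" where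
  "is_santalo_point K x \<longleftrightarrow> x \<in> interior K \<and>
     (\<forall>z\<in>interior K. vol (polar_at K x) \<le> vol (polar_at K z))"

definition support_fun :: "('n::finite) vec set \<Rightarrow> 'n vec \<Rightarrow> real" where
  "support_fun L u = Sup ((\<lambda>x. u \<bullet> x) ` L)"

definition C2_on :: "('n::finite) vec set \<Rightarrow> ('n vec \<Rightarrow> real) \<Rightarrow> bool" where
  "C2_on U f \<longleftrightarrow> (\<exists>(D1 :: 'n vec \<Rightarrow> ('n vec \<Rightarrow>\<^sub>L real))
       (D2 :: 'n vec \<Rightarrow> ('n vec \<Rightarrow>\<^sub>L ('n vec \<Rightarrow>\<^sub>L real))).
     (\<forall>y\<in>U. (f has_derivative blinfun_apply (D1 y)) (at y)) \<and>
     (\<forall>y\<in>U. (D1 has_derivative blinfun_apply (D2 y)) (at y)) \<and>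
     continuous_on U D2)"

definition C3_on :: "('n::finite) vec set \<Rightarrow> ('n vec \<Rightarrow> real) \<Rightarrow> bool" where
  "C3_on U f \<longleftrightarrow> (\<exists>(D1 :: 'n vec \<Rightarrow> ('n vec \<Rightarrow>\<^sub>L real))
       (D2 :: 'n vec \<Rightarrow> ('n vec \<Rightarrow>\<^sub>L ('n vec \<Rightarrow>\<^sub>L real)))
       (D3 :: 'n vec \<Rightarrow> ('n vec \<Rightarrow>\<^sub>L ('n vec \<Rightarrow>\<^sub>L ('n vec \<Rightarrow>\<^sub>L real)))).
     (\<forall>y\<in>U. (f has_derivative blinfun_apply (D1 y)) (at y)) \<and>
     (\<forall>y\<in>U. (D1 has_derivative blinfun_apply (D2 y)) (at y)) \<and>
     (\<forall>y\<in>U. (D2 has_derivative blinfun_apply (D3 y)) (at y)) \<and>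
     continuous_on U D3)"

definition grad :: "(('n::finite) vec \<Rightarrow> real) \<Rightarrow> 'n vec \<Rightarrow> 'n vec" where
  "grad f y = (\<chi> i. frechet_derivative f (at y) (axis i 1))"

definition local_defining_fun :: "('n::finite) vec set \<Rightarrow> 'n vec \<Rightarrow> 'n vec set \<Rightarrow> ('n vec \<Rightarrow> real) \<Rightarrow> bool" where
  "local_defining_fun K x U \<rho> \<longleftrightarrow> open U \<and> x \<in> U \<and> K \<inter> U = {y\<in>U. \<rho> y \<le> 0} \<and>
     (\<forall>y\<in>U. (\<rho> differentiable (at y)) \<and> grad \<rho> y \<noteq> 0)"

definition C3_boundary :: "('n::finite) vec set \<Rightarrow> bool" where
  "C3_boundary K \<longleftrightarrow> (\<forall>x\<in>frontier K. \<exists>U \<rho>. local_defining_fun K x U \<rho> \<and> C3_on U \<rho>)"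

text \<open>Gauss curvature of the boundary of K at a boundary point x (boundary of class C^2
  near x): with the outer unit normal field N = grad rho / |grad rho| of a C^2 local defining
  function rho, the Gauss curvature is the determinant of the Weingarten map dN_x restricted to
  the tangent space N(x)^\<bottom>; here written as the determinant of the map that is dN_x on the
  tangent space and the identity on the normal line.\<close>
definition gauss_curvature :: "('n::finite) vec set \<Rightarrow> 'n vec \<Rightarrow> real" where
  "gauss_curvature K x =
     (let \<rho> = (SOME \<rho>. \<exists>U. local_defining_fun K x U \<rho> \<and> C2_on U \<rho>);
          N = (\<lambda>y. (1 / norm (grad \<rho> y)) *\<^sub>R grad \<rho> y);
          dN = frechet_derivative N (at x)
      in det (matrix (\<lambda>v. dN (v - (N x \<bullet> v) *\<^sub>R N x) + (N x \<bullet> v) *\<^sub>R N x)))"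

definition curvature_fun :: "('n::finite) vec set \<Rightarrow> 'n vec \<Rightarrow> real" where
  "curvature_fun L u =
     1 / gauss_curvature L (THE x. x \<in> frontier L \<and> u \<bullet> x = support_fun L u)"

text \<open>Spherical Lebesgue measure on S^{n-1}: sigma(A) = n * vol {r u : 0 < r <= 1, u \<in> A},
  realised as n times the push-forward of Lebesgue measure on the punctured unit ball
  under x \<mapsto> x / |x|.\<close>
definition sphere_measure :: "('n::finite) vec measure" where
  "sphere_measure = density
     (distr (restrict_space lebesgue (ball 0 1 - {0})) borel (\<lambda>x. x /\<^sub>R norm x))
     (\<lambda>_. ennreal (real CARD('n)))"

definition S_beta :: "real \<Rightarrow> ('n::finite) vec set \<Rightarrow> real \<Rightarrow> 'n vec set" where
  "S_beta \<beta> K t = {x\<in>K. (\<integral>\<^sup>+ y. indicator (polar K) y * ennreal ((1 - x \<bullet> y) powr (-\<beta>)) \<partial>lebesgue)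
                          \<le> ennreal t}"

definition c_const :: "nat \<Rightarrow> real \<Rightarrow> real" where
  "c_const n \<beta> = 2 powr ((real n - 1) / 2) * unit_ball_vol (real n - 1)
                 * Beta ((real n + 1) / 2) (\<beta> - (real n + 1) / 2)"

end

(*
  Write L for the polar body, h for its support function, alpha = beta - (n+1)/2, and
  J(x) for the integral of (1 - <x,y>)^(-beta) over L.  Let x0 be a boundary point of K and
  y0 the point of L with <x0,y0> = 1.  Substituting y = y0 + B D z, where D scales the normal
  direction by eps and the tangential directions by sqrt eps, and where the columns of B are
  orthonormal for the second fundamental form of L at y0, turns eps^alpha J((1 - eps) x0) into an
  integral over a set converging to a paraboloid; its limit is
  c_(n,beta) f_L(u)^(1/2) h(u)^((n+1)/2) for the direction u of x0.  Balls of a fixed radius roll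
  freely inside K, so L lies in balls of a fixed radius touching it at y0; this
  gives a dominating function and the bound J((1 - eps) x0) <= M eps^(-alpha) uniformly in x0.
  In polar coordinates the part of K outside S_beta(K,t) on the ray through x0 is given by
  J((1 - eps) x0) > t; with eps = t^(-1/alpha) tau a second dominated convergence yields the theorem.
  The polar body is C^2 because its gauge is the support function of K, whose gradient is the inverse Gauss
  map of K; the latter is C^1 by the inverse function theorem.
*)
theory Submission
  imports Defs
begin

section \<open>Linear substitutions and the integral over a paraboloid\<close>

text \<open>The exponent \<alpha> balances two powers of eps: the integrand contributes
  eps^(-\<beta>), the Jacobian of the parabolic scaling eps^((n+1)/2). The Weingarten matrix A of L
  at \<open>y0\<close> is never diagonalised; any B with B^T A B = 1 has |det B| = (det A)^(-1/2),
  and this is the origin of the square root of the curvature function.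
  \<open>gauss_curvature\<close> rests on an arbitrary choice of defining function, so the local
  statements are proved for every C^2 defining function. The curvature of L is not computed from
  that of K either: the tangent balls inside K already force A to be positive definite, make the
  dual point unique and supply the dominating functions. The curvature of K enters where the Gauss
  map has to be inverted. The exponent of h in the result has two sources: h^(-n) is the radial
  Jacobian, and the boundary point in direction u has norm 1/h(u), so the pointwise limit raised to
  the power 1/\<alpha> contributes h^((n+1)/(2 \<alpha>)), where 2 \<alpha> = 2 \<beta> - (n+1).
  Integrals stay in \<open>ennreal\<close> until the very end, so finiteness is settled
  once.\<close>

lemma borel_measurable_vec_nth [measurable]:
  "(\<lambda>x::real^'n. x $ i) \<in> borel_measurable borel"
  by (intro borel_measurable_continuous_onI continuous_intros)

lemma borel_measurable_vec_lambda:
  fixes f :: "'a \<Rightarrow> 'n::finite \<Rightarrow> real"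
  assumes "\<And>i. (\<lambda>x. f x i) \<in> borel_measurable M"
  shows "(\<lambda>x. \<chi> i. f x i) \<in> borel_measurable M"
  using assms by (subst borel_measurable_euclidean_space) (auto simp: Basis_vec_def inner_axis)

text \<open>Gives access to Fubini for finite product measures. Both measures assign to a box the
  product of its edge lengths, and boxes determine Lebesgue measure.\<close>

lemma lborel_vec_eq:
  "(lborel :: (real^'n) measure) = distr (Pi\<^sub>M UNIV (\<lambda>_. lborel)) borel vec_lambda"
proof (rule lborel_eqI)
  interpret product_sigma_finite "\<lambda>_::'n. lborel :: real measure" by standard
  have m [measurable]: "vec_lambda \<in> Pi\<^sub>M UNIV (\<lambda>_::'n. lborel :: real measure) \<rightarrow>\<^sub>M borel"
    by (rule borel_measurable_vec_lambda) (simp_all add: measurable_component_singleton)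
  fix l u :: "real^'n" assume le: "\<And>b. b \<in> Basis \<Longrightarrow> l \<bullet> b \<le> u \<bullet> b"
  have le': "l $ i \<le> u $ i" for i
    using le[of "axis i 1"] by (simp add: inner_axis)
  have eq: "vec_lambda -` box l u \<inter> space (Pi\<^sub>M UNIV (\<lambda>_::'n. lborel)) = Pi\<^sub>E UNIV (\<lambda>i. {l$i<..<u$i})"
    by (auto simp: space_PiM mem_box_cart PiE_def Pi_def)
  have "(\<Prod>b\<in>Basis. (u - l) \<bullet> b) = (\<Prod>i\<in>(UNIV::'n set). u $ i - l $ i)"
    using le' le by (cases "box l u = {}")
      (simp_all add: Basis_vec_def UNION_singleton_eq_range prod.reindex axis_eq_axis inner_axis inj_on_def)
  then show "emeasure (distr (Pi\<^sub>M UNIV (\<lambda>_. lborel)) borel vec_lambda) (box l u) = (\<Prod>b\<in>Basis. (u - l) \<bullet> b)"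
    using le' by (simp add: emeasure_distr eq emeasure_PiM prod_ennreal)
qed simp

text \<open>Singles out one coordinate. The first order of integration serves shears and null sets,
  where the inner integral runs along a line; the second cuts a solid into slices of constant
  height.\<close>

lemma nn_integral_vec_split:
  fixes g :: "real^'n \<Rightarrow> ennreal"
  assumes [measurable]: "g \<in> borel_measurable borel"
  shows "(\<integral>\<^sup>+x. g x \<partial>lborel) =
     (\<integral>\<^sup>+w. (\<integral>\<^sup>+s. g (\<chi> j. if j = i then s else w j) \<partial>lborel) \<partial>Pi\<^sub>M (UNIV - {i}) (\<lambda>_. lborel))"
    and "(\<integral>\<^sup>+x. g x \<partial>lborel) =
     (\<integral>\<^sup>+s. (\<integral>\<^sup>+w. g (\<chi> j. if j = i then s else w j) \<partial>Pi\<^sub>M (UNIV - {i}) (\<lambda>_. lborel)) \<partial>lborel)"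
proof -
  interpret product_sigma_finite "\<lambda>_::'n. lborel :: real measure" by standard
  have m [measurable]: "vec_lambda \<in> Pi\<^sub>M UNIV (\<lambda>_::'n. lborel :: real measure) \<rightarrow>\<^sub>M borel"
    by (rule borel_measurable_vec_lambda) (simp_all add: measurable_component_singleton)
  have U: "insert i (UNIV - {i}) = (UNIV :: 'n set)" by auto
  have mi: "vec_lambda \<in> Pi\<^sub>M (insert i (UNIV - {i})) (\<lambda>_::'n. lborel :: real measure) \<rightarrow>\<^sub>M borel"
    unfolding U by (rule m)
  have 0: "(\<integral>\<^sup>+x. g x \<partial>lborel) = (\<integral>\<^sup>+x. g (vec_lambda x) \<partial>Pi\<^sub>M (insert i (UNIV - {i})) (\<lambda>_. lborel))"
    unfolding U by (subst lborel_vec_eq) (simp add: nn_integral_distr)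
  have mg: "(\<lambda>x. g (vec_lambda x)) \<in> borel_measurable (Pi\<^sub>M (insert i (UNIV - {i})) (\<lambda>_. lborel))"
    using mi by measurable
  have e: "(\<chi> j. (w(i := s)) j) = (\<chi> j. if j = i then s else w j)" for w :: "'n \<Rightarrow> real" and s
    by (simp add: vec_eq_iff)
  show "(\<integral>\<^sup>+x. g x \<partial>lborel) =
     (\<integral>\<^sup>+w. (\<integral>\<^sup>+s. g (\<chi> j. if j = i then s else w j) \<partial>lborel) \<partial>Pi\<^sub>M (UNIV - {i}) (\<lambda>_. lborel))"
    unfolding 0 by (subst product_nn_integral_insert[OF _ _ mg]) (simp_all only: e, simp_all)
  show "(\<integral>\<^sup>+x. g x \<partial>lborel) =
     (\<integral>\<^sup>+s. (\<integral>\<^sup>+w. g (\<chi> j. if j = i then s else w j) \<partial>Pi\<^sub>M (UNIV - {i}) (\<lambda>_. lborel)) \<partial>lborel)"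
    unfolding 0 by (subst product_nn_integral_insert_rev[OF _ _ mg]) (simp_all only: e, simp_all)
qed

section \<open>Change of variables for elementary matrices\<close>

lemma borel_measurable_matrix_vector_mult [measurable]:
  "(\<lambda>x. (A :: real^'n^'m) *v x) \<in> borel_measurable borel"
  by (intro borel_measurable_continuous_onI matrix_vector_mult_linear_continuous_on)

text \<open>On a line parallel to axis \<open>m\<close> the coordinate \<open>k\<close> is constant
  because \<open>m \<noteq> k\<close>, so the shear acts there as a translation.\<close>

lemma nn_integral_shear:
  fixes f :: "real^'n \<Rightarrow> ennreal"
  assumes [measurable]: "f \<in> borel_measurable borel" and "m \<noteq> k"
  shows "(\<integral>\<^sup>+x. f ((\<chi> i j. if i = m \<and> j = k then c else of_bool (i = j)) *v x) \<partial>lborel) = (\<integral>\<^sup>+x. f x \<partial>lborel)"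
proof -
  let ?A = "(\<chi> i j. if i = m \<and> j = k then c else of_bool (i = j)) :: real^'n^'n"
  have eq: "?A *v (\<chi> j. if j = m then s else w j) = (\<chi> j. if j = m then c * w k + 1 * s else w j)" for s w
  proof -
    have "(\<Sum>j\<in>UNIV. (if i = m \<and> j = k then c else of_bool (i = j)) * (if j = m then s else w j))
        = (if i = m then c * w k + s else w i)" for i
    proof -
      have "(\<Sum>j\<in>UNIV. (if i = m \<and> j = k then c else of_bool (i = j)) * (if j = m then s else w j))
        = (\<Sum>j\<in>UNIV. (if j = k then (if i = m then c * w k else 0) else 0) + (if j = i then (if i = m then s else w i) else 0))"
        using \<open>m \<noteq> k\<close> by (intro sum.cong) auto
      then show ?thesis by (simp add: sum.distrib)
    qed
    then show ?thesis by (simp add: matrix_vector_mult_def vec_eq_iff)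
  qed
  have "(\<integral>\<^sup>+s. f (?A *v (\<chi> j. if j = m then s else w j)) \<partial>lborel)
      = (\<integral>\<^sup>+s. f (\<chi> j. if j = m then s else w j) \<partial>lborel)" for w
  proof -
    have [measurable]: "(\<lambda>s. \<chi> j. if j = m then s else w j) \<in> borel_measurable borel"
      by (rule borel_measurable_vec_lambda) (simp_all add: measurable_component_singleton)
    have "(\<lambda>s. f (\<chi> j. if j = m then s else w j)) \<in> borel_measurable borel"
      by simp
    from nn_integral_real_affine[OF this, of 1 "c * w k"] show ?thesis
      unfolding eq by simp
  qed
  then show ?thesis
    by (subst (1 2) nn_integral_vec_split(1)[where i = m]) simp_all
qed

lemma nn_integral_swap:
  fixes f :: "real^'n \<Rightarrow> ennreal"
  assumes [measurable]: "f \<in> borel_measurable borel"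
  shows "(\<integral>\<^sup>+x. f (\<chi> i. x $ Transposition.transpose m k i) \<partial>lborel) = (\<integral>\<^sup>+x. f x \<partial>lborel)"
proof -
  let ?T = "Transposition.transpose m k"
  have [measurable]: "(\<lambda>x::real^'n. \<chi> i. x $ ?T i) \<in> borel_measurable borel"
    by (intro borel_measurable_continuous_onI continuous_intros)
  have "lborel = distr lborel borel (\<lambda>x::real^'n. \<chi> i. x $ ?T i)"
  proof (rule lborel_eqI)
    fix l u :: "real^'n" assume le: "\<And>b. b \<in> Basis \<Longrightarrow> l \<bullet> b \<le> u \<bullet> b"
    have le': "l $ i \<le> u $ i" for i
      using le[of "axis i 1"] by (simp add: inner_axis)
    have b: "(\<Prod>b\<in>Basis. (u - l) \<bullet> b) = (\<Prod>i\<in>(UNIV::'n set). u $ i - l $ i)" for u l :: "real^'n"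
      by (simp_all add: Basis_vec_def UNION_singleton_eq_range prod.reindex axis_eq_axis inner_axis inj_on_def)
    have eq: "(\<lambda>x::real^'n. \<chi> i. x $ ?T i) -` box l u = box (\<chi> i. l $ ?T i) (\<chi> i. u $ ?T i)"
      by (auto simp: mem_box_cart) (metis transpose_involutory)+
    have le'': "(\<chi> i. l $ ?T i) \<bullet> b \<le> (\<chi> i. u $ ?T i) \<bullet> b" if "b \<in> Basis" for b
      using that le' by (auto simp: Basis_vec_def inner_axis)
    have "(\<Prod>i\<in>(UNIV::'n set). u $ ?T i - l $ ?T i) = (\<Prod>i\<in>(UNIV::'n set). u $ i - l $ i)"
      by (rule prod.reindex_bij_betw) simp
    then show "emeasure (distr lborel borel (\<lambda>x::real^'n. \<chi> i. x $ ?T i)) (box l u) = (\<Prod>b\<in>Basis. (u - l) \<bullet> b)"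
      using le'' by (simp add: emeasure_distr eq emeasure_lborel_box_eq b)
  qed simp
  from arg_cong[OF this, of "\<lambda>M. nn_integral M f"] show ?thesis
    by (simp add: nn_integral_distr)
qed

lemma nn_integral_diagonal:
  fixes f :: "real^'n \<Rightarrow> ennreal"
  assumes [measurable]: "f \<in> borel_measurable borel" and c: "\<And>i. c i \<noteq> 0"
  shows "ennreal (\<Prod>i\<in>UNIV. \<bar>c i\<bar>) * (\<integral>\<^sup>+x. f (\<chi> i. c i * x $ i) \<partial>lborel) = (\<integral>\<^sup>+x. f x \<partial>lborel)"
proof -
  define c' where "c' = (\<lambda>b::real^'n. c (THE i. b = axis i 1))"
  have c'_axis: "c' (axis i 1) = c i" for i
    unfolding c'_def by (metis (mono_tags, lifting) axis_eq_axis the_equality zero_neq_one)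
  have T: "(0 + (\<Sum>j\<in>Basis. (c' j * (x \<bullet> j)) *\<^sub>R j)) = (\<chi> i. c i * x $ i)" for x
  proof -
    have "(\<Sum>j\<in>Basis. (c' j * (x \<bullet> j)) *\<^sub>R j) = (\<Sum>i\<in>UNIV. (c i * x $ i) *\<^sub>R axis i 1)"
      by (simp_all add: Basis_vec_def UNION_singleton_eq_range sum.reindex axis_eq_axis inner_axis inj_on_def c'_axis)
    also have "\<dots> = (\<chi> i. c i * x $ i)"
      by (simp add: vec_eq_iff axis_def if_distrib cong: if_cong)
    finally show ?thesis by simp
  qed
  have p: "(\<Prod>j\<in>Basis. \<bar>c' j\<bar>) = (\<Prod>i\<in>UNIV. \<bar>c i\<bar>)"
    by (simp_all add: Basis_vec_def UNION_singleton_eq_range prod.reindex axis_eq_axis inj_on_def c'_axis)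
  have "\<And>j. j \<in> Basis \<Longrightarrow> c' j \<noteq> 0"
    using c c'_axis by (auto simp: Basis_vec_def)
  from lborel_affine_euclidean[of c' 0, OF this]
  have D: "lborel = density (distr lborel borel (\<lambda>x. \<chi> i. c i * x $ i)) (\<lambda>_. ennreal (\<Prod>i\<in>UNIV. \<bar>c i\<bar>))"
    unfolding T p by simp
  have [measurable]: "(\<lambda>x::real^'n. \<chi> i. c i * x $ i) \<in> borel_measurable borel"
    by (intro borel_measurable_continuous_onI continuous_intros)
  show ?thesis
    by (subst (2) D) (simp add: nn_integral_density nn_integral_distr nn_integral_cmult)
qed

text \<open>The change of variables theorems of HOL-Analysis require a wellordered index type.\<close>

lemma nn_integral_matrix:
  fixes A :: "real^'n^'n" and f :: "real^'n \<Rightarrow> ennreal"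
  assumes "f \<in> borel_measurable borel" and "det A \<noteq> 0"
  shows "ennreal \<bar>det A\<bar> * (\<integral>\<^sup>+x. f (A *v x) \<partial>lborel) = (\<integral>\<^sup>+x. f x \<partial>lborel)"
proof -
  define P where "P = (\<lambda>A :: real^'n^'n. det A \<noteq> 0 \<longrightarrow> (\<forall>f \<in> borel_measurable borel.
     ennreal \<bar>det A\<bar> * (\<integral>\<^sup>+x. f (A *v x) \<partial>lborel) = (\<integral>\<^sup>+x. f x \<partial>lborel)))"
  have "P A"
  proof (rule induct_matrix_elementary)
    fix A B :: "real^'n^'n" assume AB: "P A" "P B"
    show "P (A ** B)"
      unfolding P_def
    proof (intro impI ballI)
      assume "det (A ** B) \<noteq> 0"
      then have d: "det A \<noteq> 0" "det B \<noteq> 0" by (auto simp: det_mul)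
      fix f :: "real^'n \<Rightarrow> ennreal" assume f: "f \<in> borel_measurable borel"
      have fA: "(\<lambda>x. f (A *v x)) \<in> borel_measurable borel"
        using f by measurable
      have "ennreal \<bar>det (A ** B)\<bar> * (\<integral>\<^sup>+x. f (A ** B *v x) \<partial>lborel)
        = ennreal \<bar>det A\<bar> * (ennreal \<bar>det B\<bar> * (\<integral>\<^sup>+x. f (A *v (B *v x)) \<partial>lborel))"
        by (simp add: det_mul abs_mult ennreal_mult matrix_vector_mul_assoc mult.assoc)
      also have "\<dots> = (\<integral>\<^sup>+x. f x \<partial>lborel)"
      proof -
        have "ennreal \<bar>det B\<bar> * (\<integral>\<^sup>+x. f (A *v (B *v x)) \<partial>lborel) = (\<integral>\<^sup>+x. f (A *v x) \<partial>lborel)"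
          using bspec[OF mp[OF AB(2)[unfolded P_def] d(2)] fA] .
        then show ?thesis using bspec[OF mp[OF AB(1)[unfolded P_def] d(1)] f] by argo
      qed
      finally show "ennreal \<bar>det (A ** B)\<bar> * (\<integral>\<^sup>+x. f (A ** B *v x) \<partial>lborel) = (\<integral>\<^sup>+x. f x \<partial>lborel)" .
    qed
  next
    \<comment> \<open>A zero row makes the determinant vanish, so the guarded statement
      \<open>P A\<close> holds vacuously.\<close>
    fix A :: "real^'n^'n" and i assume "row i A = 0"
    then show "P A" by (auto simp: P_def det_zero_row)
  next
    fix A :: "real^'n^'n" assume 0: "\<And>i j. i \<noteq> j \<Longrightarrow> A$i$j = 0"
    have d: "det A = (\<Prod>i\<in>UNIV. A$i$i)" using det_diagonal[of A] 0 by auto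
    have m: "A *v x = (\<chi> i. A$i$i * x$i)" for x
    proof -
      have "(\<Sum>j\<in>UNIV. A$i$j * x$j) = A$i$i * x$i" for i
        by (subst sum.remove[of _ i]) (auto intro!: sum.neutral simp: 0)
      then show ?thesis by (simp add: matrix_vector_mult_def)
    qed
    show "P A"
      unfolding P_def m d
      by (auto simp: abs_prod intro!: nn_integral_diagonal)
  next
    fix m k :: 'n assume "m \<noteq> k"
    let ?A = "(\<chi> i j. mat 1 $ i $ Transposition.transpose m k j) :: real^'n^'n"
    have mv: "?A *v x = (\<chi> i. x $ Transposition.transpose m k i)" for x
    proof -
      have "(\<Sum>j\<in>UNIV. (if i = Transposition.transpose m k j then 1 else 0) * x $ j)
         = x $ Transposition.transpose m k i" for i
      proof -
        have "(\<Sum>j\<in>UNIV. (if i = Transposition.transpose m k j then 1 else 0) * x $ j)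
          = (\<Sum>j\<in>UNIV. if j = Transposition.transpose m k i then x $ j else 0)"
          by (intro sum.cong) (auto simp: transpose_involutory)
        then show ?thesis by simp
      qed
      then show ?thesis by (simp add: matrix_vector_mult_def mat_def vec_eq_iff)
    qed
    \<comment> \<open>A transposition is an involution, so its determinant squares to 1; only the
      absolute value enters the formula.\<close>
    have "?A ** ?A = mat 1"
      by (simp add: matrix_eq flip: matrix_vector_mul_assoc) (simp add: mv vec_eq_iff)
    then have "det ?A * det ?A = 1" by (metis det_I det_mul)
    then have "(det ?A)\<^sup>2 = 1" by (simp only: power2_eq_square)
    then have "\<bar>det ?A\<bar> = 1" by (simp only: abs_square_eq_1)
    then show "P ?A"
      unfolding P_def mv using nn_integral_swap by (metis ennreal_1 mult_1)
  next
    fix m k :: 'n and c assume mk: "m \<noteq> k"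
    let ?A = "(\<chi> i j. if i = m \<and> j = k then c else of_bool (i = j)) :: real^'n^'n"
    have "?A = (\<chi> i. if i = m then row m (mat 1) + c *s row k (mat 1) else row i (mat 1))"
      using mk by (auto simp: vec_eq_iff row_def mat_def)
    then have "det ?A = 1" using det_row_operation[OF mk, of "mat 1" c] by simp
    then show "P ?A"
      unfolding P_def by (simp add: nn_integral_shear[OF _ mk])
  qed
  then show ?thesis using assms(1) by (simp only: P_def assms(2) simp_thms Ball_def)
qed


section \<open>Beta integrals and the volume of a weighted paraboloid\<close>

lemma nn_integral_Gamma_scaled:
  fixes s k :: real
  assumes "s > 0" "k > 0"
  shows "(\<integral>\<^sup>+t. indicator {0..} t * ennreal (t powr (s - 1) * exp (- (k * t))) \<partial>lborel) = ennreal (Gamma s * k powr (-s))"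
proof -
  have "ennreal (Gamma s) = (\<integral>\<^sup>+t. ennreal (indicator {0..} t * t powr (s - 1) / exp t) \<partial>lborel)"
    using Gamma_conv_nn_integral_real[OF assms(1)] by simp
  also have "\<dots> = ennreal k * (\<integral>\<^sup>+t. ennreal (indicator {0..} (k * t) * (k * t) powr (s - 1) / exp (k * t)) \<partial>lborel)"
    using nn_integral_real_affine[of "\<lambda>t. ennreal (indicator {0..} t * t powr (s - 1) / exp t)" k 0] assms by simp
  also have "\<dots> = ennreal k * (\<integral>\<^sup>+t. ennreal (k powr (s - 1)) * (indicator {0..} t * ennreal (t powr (s - 1) * exp (- (k * t)))) \<partial>lborel)"
    using assms by (intro arg_cong2[where f="(*)"] nn_integral_cong)
      (auto simp: indicator_def zero_le_mult_iff powr_mult exp_minus field_simps simp flip: ennreal_mult)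
  also have "\<dots> = ennreal (k powr s) * (\<integral>\<^sup>+t. (indicator {0..} t * ennreal (t powr (s - 1) * exp (- (k * t)))) \<partial>lborel)"
    using assms by (subst nn_integral_cmult) (auto simp: powr_diff simp flip: ennreal_mult mult.assoc)
  finally have eq: "ennreal (Gamma s) = ennreal (k powr s) * (\<integral>\<^sup>+t. (indicator {0..} t * ennreal (t powr (s - 1) * exp (- (k * t)))) \<partial>lborel)" .
  have "ennreal (Gamma s * k powr (-s)) = ennreal (k powr (-s)) * ennreal (Gamma s)"
    using assms by (simp add: Gamma_real_nonneg mult.commute flip: ennreal_mult)
  also have "\<dots> = ennreal (k powr (-s) * k powr s) * (\<integral>\<^sup>+t. (indicator {0..} t * ennreal (t powr (s - 1) * exp (- (k * t)))) \<partial>lborel)"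
    unfolding eq by (simp add: ennreal_mult mult.assoc)
  also have "k powr (-s) * k powr s = 1"
    using assms by (simp flip: powr_add)
  finally show ?thesis by simp
qed

text \<open>The power (1 + a s)^(-\<beta>) is written as a Gamma integral in a new variable t. After
  exchanging the integrals, the one over s is a Gamma integral with rate a t, and what remains in t
  is a Gamma integral of parameter \<beta> - p. The quotient of Gamma values is the Beta
  function.\<close>

lemma nn_integral_beta_prime:
  fixes p a \<beta> :: real
  assumes p: "p > 0" and a: "a > 0" and \<beta>: "\<beta> > p"
  shows "(\<integral>\<^sup>+s. indicator {0..} s * ennreal (s powr (p - 1) * (1 + a * s) powr (-\<beta>)) \<partial>lborel)
    = ennreal (a powr (-p) * Beta p (\<beta> - p))"
proof -
  let ?I = "(\<integral>\<^sup>+s. indicator {0..} s * ennreal (s powr (p - 1) * (1 + a * s) powr (-\<beta>)) \<partial>lborel)"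
  have b: "\<beta> > 0" using p \<beta> by simp
  have G: "Gamma \<beta> > 0" "Gamma p > 0" "Gamma (\<beta> - p) > 0" using p \<beta> b by (auto intro: Gamma_real_pos)
  have "ennreal (Gamma \<beta>) * ?I
    = (\<integral>\<^sup>+s. indicator {0..} s * (ennreal (s powr (p - 1)) * ennreal (Gamma \<beta> * (1 + a * s) powr (-\<beta>))) \<partial>lborel)"
    using G by (subst nn_integral_cmult[symmetric]) (auto intro!: nn_integral_cong simp: mult_ac simp flip: ennreal_mult split: split_indicator)
  also have "\<dots> = (\<integral>\<^sup>+s. indicator {0..} s * (ennreal (s powr (p - 1)) *
      (\<integral>\<^sup>+t. indicator {0..} t * ennreal (t powr (\<beta> - 1) * exp (- ((1 + a * s) * t))) \<partial>lborel)) \<partial>lborel)"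
  proof (intro nn_integral_cong)
    fix s :: real
    show "indicator {0..} s * (ennreal (s powr (p - 1)) * ennreal (Gamma \<beta> * (1 + a * s) powr (-\<beta>)))
      = indicator {0..} s * (ennreal (s powr (p - 1)) *
      (\<integral>\<^sup>+t. indicator {0..} t * ennreal (t powr (\<beta> - 1) * exp (- ((1 + a * s) * t))) \<partial>lborel))"
    proof (cases "s \<ge> 0")
      case True
      then have "1 + a * s > 0" using a by (simp add: add_pos_nonneg)
      from nn_integral_Gamma_scaled[OF b this] show ?thesis by simp
    qed simp
  qed
  also have "\<dots> = (\<integral>\<^sup>+s. \<integral>\<^sup>+t. indicator {0..} s * indicator {0..} t * ennreal (s powr (p - 1) * t powr (\<beta> - 1) * exp (- ((1 + a * s) * t))) \<partial>lborel \<partial>lborel)"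
    by (subst nn_integral_cmult[symmetric], simp, subst nn_integral_cmult[symmetric], simp)
      (auto intro!: nn_integral_cong simp: mult_ac simp flip: ennreal_mult split: split_indicator)
  also have "\<dots> = (\<integral>\<^sup>+t. \<integral>\<^sup>+s. indicator {0..} s * indicator {0..} t * ennreal (s powr (p - 1) * t powr (\<beta> - 1) * exp (- ((1 + a * s) * t))) \<partial>lborel \<partial>lborel)"
    by (rule lborel_pair.Fubini') measurable
  also have "\<dots> = (\<integral>\<^sup>+t. indicator {0..} t * ennreal (t powr (\<beta> - 1) * exp (-t)) *
     (\<integral>\<^sup>+s. indicator {0..} s * ennreal (s powr (p - 1) * exp (- ((a * t) * s))) \<partial>lborel) \<partial>lborel)"
    by (subst nn_integral_cmult[symmetric], simp)
      (auto intro!: nn_integral_cong simp: algebra_simps exp_add[symmetric] simp flip: ennreal_mult split: split_indicator)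
  also have "\<dots> = (\<integral>\<^sup>+t. ennreal (Gamma p * a powr (-p)) * (indicator {0..} t * ennreal (t powr (\<beta> - p - 1) * exp (-(1 * t)))) \<partial>lborel)"
  \<comment> \<open>The scaled Gamma integral needs a positive rate \<open>a * t\<close>, hence the
    exclusion of t = 0.\<close>
  proof (intro nn_integral_cong_AE, use AE_lborel_singleton[of "0::real"] in eventually_elim)
    fix t :: real assume "t \<noteq> 0"
    show "indicator {0..} t * ennreal (t powr (\<beta> - 1) * exp (-t)) *
     (\<integral>\<^sup>+s. indicator {0..} s * ennreal (s powr (p - 1) * exp (- ((a * t) * s))) \<partial>lborel)
      = ennreal (Gamma p * a powr (-p)) * (indicator {0..} t * ennreal (t powr (\<beta> - p - 1) * exp (-(1 * t))))"
    proof (cases "t > 0")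
      case True
      then have at: "a * t > 0" using a by simp
      have "t powr (\<beta> - 1) * t powr (-p) = t powr (\<beta> - p - 1)"
        by (simp flip: powr_add add: algebra_simps)
      then have "t powr (\<beta> - 1) * exp (-t) * (Gamma p * (a * t) powr (-p)) = Gamma p * a powr (-p) * (t powr (\<beta> - p - 1) * exp (-(1 * t)))"
        using a True by (simp add: powr_mult mult_ac)
      then show ?thesis unfolding nn_integral_Gamma_scaled[OF p at]
        using True G by (simp flip: ennreal_mult)
    qed (use \<open>t \<noteq> 0\<close> in simp)
  qed
  also have "\<dots> = ennreal (Gamma p * a powr (-p)) * ennreal (Gamma (\<beta> - p) * 1 powr (-(\<beta> - p)))"
    using \<beta> nn_integral_Gamma_scaled[of "\<beta> - p" 1] by (subst nn_integral_cmult) auto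
  finally have eq: "ennreal (Gamma \<beta>) * ?I = ennreal (Gamma p * a powr (-p)) * ennreal (Gamma (\<beta> - p) * 1 powr (-(\<beta> - p)))" .
  have "?I = ennreal (1 / Gamma \<beta> * Gamma \<beta>) * ?I" using G by simp
  also have "\<dots> = ennreal (1 / Gamma \<beta>) * (ennreal (Gamma \<beta>) * ?I)"
    using G by (subst ennreal_mult) (simp_all add: mult.assoc)
  also have "\<dots> = ennreal (a powr (-p) * Beta p (\<beta> - p))"
    unfolding eq using G by (simp add: Beta_def flip: ennreal_mult)
  finally show ?thesis .
qed

text \<open>The slice at height s is a ball of radius sqrt (c s) in dimension n - 1. Its volume
  contributes s^((n-1)/2), which leaves a beta prime integral with p = (n+1)/2. With c = 2 this
  produces \<open>c_const\<close>; other values of c occur in the dominating functions.\<close>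

lemma nn_integral_paraboloid:
  fixes i :: "'n::finite" and c a \<beta> :: real
  defines "n \<equiv> CARD('n)"
  assumes c: "c > 0" and a: "a > 0" and \<beta>: "\<beta> > (real n + 1) / 2"
  shows "(\<integral>\<^sup>+z. indicator {z. (\<Sum>j\<in>UNIV-{i}. (z$j)\<^sup>2) \<le> c * z$i} z * ennreal ((1 + a * z$i) powr (-\<beta>)) \<partial>lborel)
    = ennreal (unit_ball_vol (real n - 1) * c powr ((real n - 1) / 2) * a powr (-((real n + 1) / 2))
         * Beta ((real n + 1) / 2) (\<beta> - (real n + 1) / 2))"
proof -
  define v where "v = unit_ball_vol (real n - 1)"
  define p where "p = (real n + 1) / 2"
  have n1: "n \<ge> 1" unfolding n_def using finite_UNIV_card_ge_0 by (simp add: Suc_leI)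
  then have v: "v > 0" unfolding v_def by simp
  have p: "p > 0" unfolding p_def by simp
  have cardA: "card (UNIV - {i}) = n - 1" by (simp add: n_def card_Diff_singleton)
  let ?M = "Pi\<^sub>M (UNIV - {i}) (\<lambda>_. lborel :: real measure)"
  have [measurable]: "{z::real^'n. (\<Sum>j\<in>UNIV-{i}. (z$j)\<^sup>2) \<le> c * z$i} \<in> sets borel"
    by measurable
  have "(\<integral>\<^sup>+z. indicator {z. (\<Sum>j\<in>UNIV-{i}. (z$j)\<^sup>2) \<le> c * z$i} z * ennreal ((1 + a * z$i) powr (-\<beta>)) \<partial>lborel)
    = (\<integral>\<^sup>+s. (\<integral>\<^sup>+w. indicator ({w. sqrt (\<Sum>j\<in>UNIV-{i}. (w j)\<^sup>2) \<le> sqrt (c * s)} \<inter> space ?M) w * ennreal ((1 + a * s) powr (-\<beta>)) \<partial>?M) \<partial>lborel)"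
    by (subst nn_integral_vec_split(2)[where i = i])
      (auto intro!: nn_integral_cong simp: indicator_def)
  also have "\<dots> = (\<integral>\<^sup>+s. emeasure ?M ({w. sqrt (\<Sum>j\<in>UNIV-{i}. (w j)\<^sup>2) \<le> sqrt (c * s)} \<inter> space ?M) * ennreal ((1 + a * s) powr (-\<beta>)) \<partial>lborel)"
  proof (intro nn_integral_cong)
    fix s :: real
    have [measurable]: "{w. sqrt (\<Sum>j\<in>UNIV-{i}. (w j)\<^sup>2) \<le> sqrt (c * s)} \<inter> space ?M \<in> sets ?M" by measurable
    show "(\<integral>\<^sup>+w. indicator ({w. sqrt (\<Sum>j\<in>UNIV-{i}. (w j)\<^sup>2) \<le> sqrt (c * s)} \<inter> space ?M) w * ennreal ((1 + a * s) powr (-\<beta>)) \<partial>?M)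
      = emeasure ?M ({w. sqrt (\<Sum>j\<in>UNIV-{i}. (w j)\<^sup>2) \<le> sqrt (c * s)} \<inter> space ?M) * ennreal ((1 + a * s) powr (-\<beta>))"
      by (subst nn_integral_multc) auto
  qed
  also have "\<dots> = (\<integral>\<^sup>+s. ennreal (v * c powr (p - 1)) * (indicator {0..} s * ennreal (s powr (p - 1) * (1 + a * s) powr (-\<beta>))) \<partial>lborel)"
  \<comment> \<open>At s = 0 the natural power and \<open>powr\<close> may differ, since
    \<open>0 powr 0 = 0\<close>; this slice is null.\<close>
  proof (intro nn_integral_cong_AE, use AE_lborel_singleton[of "0::real"] in eventually_elim)
    fix s :: real assume "s \<noteq> 0"
    show "emeasure ?M ({w. sqrt (\<Sum>j\<in>UNIV-{i}. (w j)\<^sup>2) \<le> sqrt (c * s)} \<inter> space ?M) * ennreal ((1 + a * s) powr (-\<beta>))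
      = ennreal (v * c powr (p - 1)) * (indicator {0..} s * ennreal (s powr (p - 1) * (1 + a * s) powr (-\<beta>)))"
    proof (cases "s > 0")
      case True
      then have cs: "c * s > 0" using c by simp
      have "sqrt (c * s) ^ (n - 1) = sqrt (c * s) powr real (n - 1)"
        using cs by (subst powr_realpow) auto
      also have "\<dots> = ((c * s) powr (1/2)) powr (real n - 1)"
        using cs n1 by (simp add: powr_half_sqrt of_nat_diff)
      also have "\<dots> = (c * s) powr (p - 1)"
        unfolding powr_powr by (simp add: p_def field_simps)
      finally have "sqrt (c * s) ^ (n - 1) = (c * s) powr (p - 1)" .
      then have "emeasure ?M ({w. sqrt (\<Sum>j\<in>UNIV-{i}. (w j)\<^sup>2) \<le> sqrt (c * s)} \<inter> space ?M) = ennreal (v * (c powr (p - 1) * s powr (p - 1)))"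
        using emeasure_cball_aux[of "UNIV - {i}" "sqrt (c * s)"] cs c True n1
        by (simp add: cardA v_def of_nat_diff powr_mult)
      then show ?thesis using True v by (simp add: mult_ac flip: ennreal_mult)
    next
      case False
      then have "c * s < 0" using c \<open>s \<noteq> 0\<close> by (simp add: mult_less_0_iff)
      then have "\<not> sqrt (\<Sum>j\<in>UNIV-{i}. (w j)\<^sup>2) \<le> sqrt (c * s)" for w
        by (smt (verit) real_sqrt_ge_0_iff sum_nonneg zero_le_power2 real_sqrt_lt_0_iff)
      then show ?thesis using False \<open>s \<noteq> 0\<close> by simp
    qed
  qed
  also have "\<dots> = ennreal (v * c powr (p - 1)) * ennreal (a powr (-p) * Beta p (\<beta> - p))"
    using nn_integral_beta_prime[OF p a, of \<beta>] \<beta> unfolding p_def[symmetric] by (subst nn_integral_cmult) auto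
  also have "\<dots> = ennreal (v * c powr (p - 1) * a powr (-p) * Beta p (\<beta> - p))"
    using v by (simp add: mult.assoc ennreal_mult')
  also have "p - 1 = (real n - 1) / 2" by (simp add: p_def field_simps)
  finally show ?thesis unfolding v_def p_def .
qed

text \<open>Gram-Schmidt for the form \<open>A\<close>, avoiding a square root of the matrix \<open>A\<close>.\<close>

lemma ex_orthonormal_family_wrt_form:
  fixes A :: "real^'n^'n" and u :: "real^'n"
  assumes sym: "\<And>v w. v \<bullet> (A *v w) = (A *v v) \<bullet> w"
    and pos: "\<And>v. v \<noteq> 0 \<Longrightarrow> v \<bullet> (A *v v) > 0"
    and u: "u \<bullet> (A *v u) = 1" and "i \<in> S" and "finite S"
  shows "\<exists>b :: 'n \<Rightarrow> real^'n. b i = u \<and> (\<forall>j\<in>S. \<forall>k\<in>S. b j \<bullet> (A *v b k) = of_bool (j = k))"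
proof -
  have "\<exists>b :: 'n \<Rightarrow> real^'n. b i = u \<and> (\<forall>j\<in>insert i S. \<forall>k\<in>insert i S. b j \<bullet> (A *v b k) = of_bool (j = k))"
    using \<open>finite S\<close>
  proof (induction S)
    case empty
    show ?case by (rule exI[of _ "\<lambda>_. u"]) (simp add: u)
  next
    case (insert j S)
    then obtain b :: "'n \<Rightarrow> real^'n" where b: "b i = u"
      "\<And>j k. j \<in> insert i S \<Longrightarrow> k \<in> insert i S \<Longrightarrow> b j \<bullet> (A *v b k) = of_bool (j = k)"
      by blast
    show ?case
    proof (cases "j = i")
      case True
      then show ?thesis using insert.IH by simp
    next
      case False
      with insert have ni: "j \<notin> insert i S" by simp
      \<comment> \<open>Fewer than n vectors have been built, so some nonzero x is
        Euclidean-orthogonal to all their images under A, which is orthogonality to the vectors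
        themselves for the form.\<close>
      let ?V = "(\<lambda>k. A *v b k) ` insert i S"
      have "dim ?V \<le> card ?V" using insert by (intro dim_le_card) (auto intro: span_base)
      also have "\<dots> \<le> card (insert i S)" using insert by (intro card_image_le) auto
      also have "\<dots> < CARD('n)"
        using ni by (intro psubset_card_mono) auto
      finally have "dim ?V < DIM(real^'n)" by simp
      then obtain x where x: "x \<noteq> 0" "\<And>y. y \<in> span ?V \<Longrightarrow> orthogonal x y"
        using orthogonal_to_subspace_exists by blast
      have xo: "x \<bullet> (A *v b k) = 0" if "k \<in> insert i S" for k
        using x(2)[of "A *v b k"] that by (auto simp: orthogonal_def intro: span_base)
      then have xo': "b k \<bullet> (A *v x) = 0" if "k \<in> insert i S" for k
        using that sym by (metis inner_commute)
      define c where "c = x \<bullet> (A *v x)"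
      have c: "c > 0" unfolding c_def using pos x by blast
      let ?b = "b(j := (1 / sqrt c) *\<^sub>R x)"
      have "?b k \<bullet> (A *v ?b l) = of_bool (k = l)" if "k \<in> insert i (insert j S)" "l \<in> insert i (insert j S)" for k l
        using that ni b xo xo' c
        by (auto simp: matrix_vector_mult_scaleR c_def[symmetric])
      moreover have "?b i = u" using b False by simp
      ultimately show ?thesis by blast
    qed
  qed
  then show ?thesis using \<open>i \<in> S\<close> by (simp add: insert_absorb)
qed

text \<open>Provides coordinates in which the form becomes the standard one and the axis
  \<open>i\<close> is a prescribed unit vector, later the inner normal. The determinant identity
  converts the Jacobian of B into curvature.\<close>

lemma matrix_orthonormal_wrt_form:
  fixes A :: "real^'n^'n" and u :: "real^'n"
  assumes sym: "\<And>v w. v \<bullet> (A *v w) = (A *v v) \<bullet> w"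
    and pos: "\<And>v. v \<noteq> 0 \<Longrightarrow> v \<bullet> (A *v v) > 0"
    and u: "u \<bullet> (A *v u) = 1"
  obtains B :: "real^'n^'n" where "B *v axis i 1 = u"
    "\<And>v w. (B *v v) \<bullet> (A *v (B *v w)) = v \<bullet> w" "det A * (det B)\<^sup>2 = 1"
proof -
  obtain b :: "'n \<Rightarrow> real^'n" where b: "b i = u" "\<And>j k. b j \<bullet> (A *v b k) = of_bool (j = k)"
    using ex_orthonormal_family_wrt_form[OF sym pos u, of i UNIV] by auto
  define B :: "real^'n^'n" where "B = (\<chi> r c. b c $ r)"
  have B: "B *v v = (\<Sum>k\<in>UNIV. v $ k *\<^sub>R b k)" for v
    by (simp add: B_def matrix_vector_mult_def vec_eq_iff mult.commute)
  have Bi: "B *v axis i 1 = u"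
    by (simp add: B axis_def b if_distrib[of "\<lambda>c. c *\<^sub>R _"] cong: if_cong)
  have form: "(B *v v) \<bullet> (A *v (B *v w)) = v \<bullet> w" for v w
  proof -
    have AB: "A *v (B *v w) = (\<Sum>k\<in>UNIV. w $ k *\<^sub>R (A *v b k))"
      unfolding B by (simp add: matrix_vector_mult_scaleR linear_sum[OF matrix_vector_mul_linear])
    have "(B *v v) \<bullet> (A *v (B *v w)) = (\<Sum>j\<in>UNIV. \<Sum>k\<in>UNIV. w $ k * (v $ j * (b j \<bullet> (A *v b k))))"
      unfolding AB unfolding B inner_sum_left inner_sum_right
      by (subst sum.swap) (simp add: mult_ac)
    also have "\<dots> = (\<Sum>j\<in>UNIV. \<Sum>k\<in>UNIV. if j = k then w $ k * v $ j else 0)"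
      by (intro sum.cong) (auto simp: b)
    also have "\<dots> = v \<bullet> w" by (simp add: inner_vec_def mult.commute)
    finally show ?thesis .
  qed
  have "transpose B ** A ** B = mat 1"
  proof -
    have "v \<bullet> ((transpose B ** A ** B) *v w) = v \<bullet> w" for v w
      by (simp add: form flip: matrix_vector_mul_assoc) (metis dot_lmul_matrix form transpose_transpose vector_transpose_matrix)
    then have "(transpose B ** A ** B) *v w = w" for w
      by (metis vector_eq_rdot inner_commute)
    then show ?thesis by (simp add: matrix_eq)
  qed
  then have "det (transpose B ** A ** B) = 1" by simp
  then have "det A * (det B)\<^sup>2 = 1" by (simp add: det_mul det_transpose power2_eq_square mult_ac)
  with that Bi form show ?thesis by blast
qed

section \<open>Second order calculus and the Weingarten map\<close>

lemma grad_inner: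
  assumes "(f has_derivative f') (at y)"
  shows "grad f y \<bullet> v = f' v"
proof -
  have "linear f'" using assms by (rule has_derivative_linear)
  have "v = (\<Sum>i\<in>UNIV. v $ i *\<^sub>R axis i 1)"
    using basis_expansion[of v] by (simp add: scalar_mult_eq_scaleR)
  then have "f' v = f' (\<Sum>i\<in>UNIV. v $ i *\<^sub>R axis i 1)" by simp
  also have "\<dots> = (\<Sum>i\<in>UNIV. v $ i * f' (axis i 1))"
    using \<open>linear f'\<close> by (simp add: linear_sum linear_scale)
  finally have "f' v = (\<Sum>i\<in>UNIV. v $ i * f' (axis i 1))" .
  then show ?thesis
    by (simp add: grad_def frechet_derivative_at[OF assms, symmetric] inner_vec_def mult.commute)
qed

lemma grad_eqI:
  assumes "(f has_derivative (\<lambda>v. g \<bullet> v)) (at y)"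
  shows "grad f y = g"
  using grad_inner[OF assms] by (metis inner_commute vector_eq_rdot)

text \<open>Trades derivatives with values in the dual space for a vector field and its derivative,
  the form in which mean value arguments and the Weingarten map use them.\<close>

lemma C2_on_gradE:
  fixes f :: "'n::finite vec \<Rightarrow> real"
  assumes "C2_on U f" "open U"
  obtains H :: "'n vec \<Rightarrow> 'n vec \<Rightarrow>\<^sub>L 'n vec"
  where "\<And>y. y \<in> U \<Longrightarrow> (f has_derivative (\<lambda>v. grad f y \<bullet> v)) (at y)"
    "\<And>y. y \<in> U \<Longrightarrow> (grad f has_derivative blinfun_apply (H y)) (at y)"
    "continuous_on U H"
proof -
  obtain D1 :: "'n vec \<Rightarrow> ('n vec \<Rightarrow>\<^sub>L real)" and D2 :: "'n vec \<Rightarrow> ('n vec \<Rightarrow>\<^sub>L ('n vec \<Rightarrow>\<^sub>L real))"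
    where D1: "\<And>y. y \<in> U \<Longrightarrow> (f has_derivative blinfun_apply (D1 y)) (at y)"
      and D2: "\<And>y. y \<in> U \<Longrightarrow> (D1 has_derivative blinfun_apply (D2 y)) (at y)"
      and cont: "continuous_on U D2"
    using assms unfolding C2_on_def by blast
  \<comment> \<open>R is the Riesz isomorphism in coordinates; being bounded linear it commutes with
    differentiation.\<close>
  define R :: "('n vec \<Rightarrow>\<^sub>L real) \<Rightarrow> 'n vec"
    where "R = (\<lambda>\<phi>. \<Sum>i\<in>UNIV. blinfun_apply \<phi> (axis i 1) *\<^sub>R axis i 1)"
  have R: "bounded_linear R"
    unfolding R_def
    by (intro bounded_linear_sum bounded_linear_compose[OF bounded_linear_scaleR_left blinfun.bounded_linear_left])
  have R_nth: "R \<phi> = (\<chi> i. blinfun_apply \<phi> (axis i 1))" for \<phi>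
    by (simp add: R_def vec_eq_iff axis_def if_distrib cong: if_cong)
  have gR: "grad f y = R (D1 y)" if "y \<in> U" for y
    using frechet_derivative_at[OF D1[OF that]] by (simp add: grad_def R_nth)
  define H where "H = (\<lambda>y. Blinfun R o\<^sub>L D2 y)"
  show ?thesis
  proof
    fix y assume y: "y \<in> U"
    show "(f has_derivative (\<lambda>v. grad f y \<bullet> v)) (at y)"
      using D1[OF y] grad_inner[OF D1[OF y]] by simp
    have "((\<lambda>y. R (D1 y)) has_derivative (\<lambda>v. R (D2 y v))) (at y)"
      by (rule bounded_linear.has_derivative[OF R D2[OF y]])
    then have "(grad f has_derivative (\<lambda>v. R (D2 y v))) (at y)"
      by (rule has_derivative_transform_within_open[OF _ \<open>open U\<close> y]) (simp add: gR)
    then show "(grad f has_derivative blinfun_apply (H y)) (at y)"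
      by (simp add: H_def bounded_linear_Blinfun_apply[OF R] blinfun_compose.rep_eq o_def)
  next
    show "continuous_on U H"
      unfolding H_def by (intro continuous_intros cont)
  qed
qed

lemma C2_onI_grad:
  fixes f :: "'n::finite vec \<Rightarrow> real"
  assumes f: "\<And>y. y \<in> U \<Longrightarrow> (f has_derivative (\<lambda>v. G y \<bullet> v)) (at y)"
    and G: "\<And>y. y \<in> U \<Longrightarrow> (G has_derivative blinfun_apply (H y)) (at y)"
    and cont: "continuous_on U H"
  shows "C2_on U f"
proof -
  define J :: "'n vec \<Rightarrow>\<^sub>L ('n vec \<Rightarrow>\<^sub>L real)" where "J = Blinfun blinfun_inner_right"
  have bl: "bounded_linear (blinfun_inner_right :: 'n vec \<Rightarrow> _)"
    by (rule bounded_linear_blinfun_inner_right)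
  have J: "blinfun_apply J = blinfun_inner_right"
    unfolding J_def by (rule bounded_linear_Blinfun_apply[OF bl])
  have "(f has_derivative blinfun_apply (blinfun_inner_right (G y))) (at y)" if "y \<in> U" for y
    using f[OF that] by (simp add: blinfun_inner_right.rep_eq)
  moreover have "((\<lambda>y. blinfun_inner_right (G y)) has_derivative blinfun_apply (J o\<^sub>L H y)) (at y)" if "y \<in> U" for y
    using bounded_linear.has_derivative[OF bl G[OF that]] by (simp add: blinfun_compose.rep_eq o_def J)
  moreover have "continuous_on U (\<lambda>y. J o\<^sub>L H y)"
    by (intro continuous_intros cont)
  ultimately show ?thesis unfolding C2_on_def
    by (intro exI[of _ "\<lambda>y. blinfun_inner_right (G y)"] exI[of _ "\<lambda>y. J o\<^sub>L H y"]) auto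
qed

lemma C3_on_imp_C2_on:
  assumes "C3_on U f"
  shows "C2_on U f"
proof -
  obtain D1 D2 D3 where D: "\<forall>y\<in>U. (f has_derivative blinfun_apply (D1 y)) (at y)"
     "\<forall>y\<in>U. (D1 has_derivative blinfun_apply (D2 y)) (at y)"
     "\<forall>y\<in>U. (D2 has_derivative blinfun_apply (D3 y)) (at y)"
    using assms unfolding C3_on_def by blast
  have "continuous_on U D2"
    using D(3) by (auto simp: continuous_on_eq_continuous_within intro: continuous_at_imp_continuous_at_within has_derivative_continuous)
  with D show ?thesis unfolding C2_on_def by blast
qed


section \<open>Second-order expansions and symmetry of the Hessian\<close>

lemma DERIV_on_line:
  fixes f :: "'a::real_inner \<Rightarrow> real"
  assumes "(f has_derivative (\<lambda>h. g \<bullet> h)) (at (p + t *\<^sub>R v))"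
  shows "((\<lambda>t. f (p + t *\<^sub>R v)) has_real_derivative g \<bullet> v) (at t)"
proof -
  have "((\<lambda>t. p + t *\<^sub>R v) has_derivative (\<lambda>h. h *\<^sub>R v)) (at t)"
    by (auto intro!: derivative_eq_intros)
  from has_derivative_compose[OF this assms]
  show ?thesis by (simp add: has_field_derivative_def mult.commute[of _ "g \<bullet> v"])
qed

text \<open>Differentiability of the gradient at the single point \<open>x\<close> suffices: the
  mean value theorem along the segment reduces the second-order remainder to the first-order
  remainder of \<open>G\<close>.\<close>

lemma taylor2_gradient:
  fixes f :: "'a::euclidean_space \<Rightarrow> real"
  assumes "open U" "x \<in> U"
    and f: "\<And>y. y \<in> U \<Longrightarrow> (f has_derivative (\<lambda>v. G y \<bullet> v)) (at y)"
    and G: "(G has_derivative G') (at x)" and "e > 0"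
  obtains d where "d > 0"
    "\<And>v. norm v < d \<Longrightarrow> \<bar>f (x + v) - f x - G x \<bullet> v - (G' v \<bullet> v) / 2\<bar> \<le> e * (norm v)\<^sup>2"
proof -
  obtain d1 where d1: "d1 > 0" "ball x d1 \<subseteq> U"
    using assms(1,2) openE by blast
  obtain d2 where d2: "d2 > 0" "\<And>y. norm (y - x) < d2 \<Longrightarrow> norm (G y - G x - G' (y - x)) \<le> e * norm (y - x)"
    using G \<open>e > 0\<close> unfolding has_derivative_at_alt by blast
  interpret G': bounded_linear G' using G by (rule has_derivative_bounded_linear)
  show ?thesis
  proof (rule that[of "min d1 d2"])
    show "min d1 d2 > 0" using d1 d2 by simp
    fix v :: 'a assume v: "norm v < min d1 d2"
    \<comment> \<open>The quadratic model is subtracted, so the derivative of \<phi> at t is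
      \<open>G (x + t *\<^sub>R v) - G x - G' (t *\<^sub>R v)\<close> paired with v.\<close>
    define \<phi> where "\<phi> = (\<lambda>t. f (x + t *\<^sub>R v) - t * (G x \<bullet> v) - t\<^sup>2 / 2 * (G' v \<bullet> v))"
    have "\<exists>\<xi>. 0 < \<xi> \<and> \<xi> < 1 \<and> \<phi> 1 - \<phi> 0 = (1 - 0) * (G (x + \<xi> *\<^sub>R v) \<bullet> v - G x \<bullet> v - \<xi> * (G' v \<bullet> v))"
    proof (rule MVT2)
      fix t :: real assume t: "0 \<le> t" "t \<le> 1"
      have "norm (t *\<^sub>R v) < d1" using v t by (smt (verit) mult_left_le_one_le norm_ge_zero norm_scaleR abs_of_nonneg)
      then have "x + t *\<^sub>R v \<in> U" using d1(2) by (auto simp: dist_norm subset_iff)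
      from DERIV_on_line[OF f[OF this]]
      show "(\<phi> has_real_derivative G (x + t *\<^sub>R v) \<bullet> v - G x \<bullet> v - t * (G' v \<bullet> v)) (at t)"
        unfolding \<phi>_def by (auto intro!: derivative_eq_intros)
    qed simp
    then obtain \<xi> where \<xi>: "0 < \<xi>" "\<xi> < 1" "\<phi> 1 - \<phi> 0 = G (x + \<xi> *\<^sub>R v) \<bullet> v - G x \<bullet> v - \<xi> * (G' v \<bullet> v)" by auto
    have n: "norm (\<xi> *\<^sub>R v) \<le> norm v" using \<xi> by (simp add: mult_left_le_one_le)
    have "\<bar>\<phi> 1 - \<phi> 0\<bar> = \<bar>(G (x + \<xi> *\<^sub>R v) - G x - G' (\<xi> *\<^sub>R v)) \<bullet> v\<bar>"
      unfolding \<xi>(3) by (simp add: inner_diff_left G'.scaleR)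
    also have "\<dots> \<le> norm (G (x + \<xi> *\<^sub>R v) - G x - G' (\<xi> *\<^sub>R v)) * norm v"
      by (rule Cauchy_Schwarz_ineq2)
    also have "\<dots> \<le> (e * norm (\<xi> *\<^sub>R v)) * norm v"
      using d2(2)[of "x + \<xi> *\<^sub>R v"] v n by (intro mult_right_mono) auto
    also have "\<dots> \<le> (e * norm v) * norm v"
      using n \<open>e > 0\<close> by (intro mult_right_mono mult_left_mono) auto
    finally show "\<bar>f (x + v) - f x - G x \<bullet> v - (G' v \<bullet> v) / 2\<bar> \<le> e * (norm v)\<^sup>2"
      by (simp add: \<phi>_def power2_eq_square algebra_simps)
  qed
qed

text \<open>The second difference is symmetric in v and w, while the mean value theorem applied in
  direction v expresses it through \<open>G' w \<bullet> v\<close>. Exchanging the roles of v and w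
  proves symmetry of the derivative of a gradient.\<close>

lemma second_difference_approx:
  fixes f :: "'a::euclidean_space \<Rightarrow> real"
  assumes "open U" "x \<in> U"
    and f: "\<And>y. y \<in> U \<Longrightarrow> (f has_derivative (\<lambda>v. G y \<bullet> v)) (at y)"
    and G: "(G has_derivative G') (at x)" and "e > 0"
  shows "eventually (\<lambda>t. \<bar>(f (x + t *\<^sub>R v + t *\<^sub>R w) - f (x + t *\<^sub>R v) - f (x + t *\<^sub>R w) + f x) / t\<^sup>2 - G' w \<bullet> v\<bar>
     \<le> e * ((2 * norm v + norm w) * norm v)) (at_right 0)"
proof -
  obtain d1 where d1: "d1 > 0" "ball x d1 \<subseteq> U"
    using assms(1,2) openE by blast
  obtain d2 where d2: "d2 > 0" "\<And>y. norm (y - x) < d2 \<Longrightarrow> norm (G y - G x - G' (y - x)) \<le> e * norm (y - x)"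
    using G \<open>e > 0\<close> unfolding has_derivative_at_alt by blast
  interpret G': bounded_linear G' using G by (rule has_derivative_bounded_linear)
  define d where "d = min d1 d2 / (norm v + norm w + 1)"
  have n1: "norm v + norm w + 1 > 0" by (smt (verit) norm_ge_zero)
  then have "d > 0" unfolding d_def using d1 d2 by simp
  moreover have "\<bar>(f (x + t *\<^sub>R v + t *\<^sub>R w) - f (x + t *\<^sub>R v) - f (x + t *\<^sub>R w) + f x) / t\<^sup>2 - G' w \<bullet> v\<bar>
     \<le> e * ((2 * norm v + norm w) * norm v)" if t: "0 < t" "t < d" for t
  proof -
    have small: "norm (s *\<^sub>R (t *\<^sub>R v) + r *\<^sub>R (t *\<^sub>R w)) < min d1 d2" if "0 \<le> s" "s \<le> 1" "0 \<le> r" "r \<le> 1" for s r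
    proof -
      have "norm (s *\<^sub>R (t *\<^sub>R v) + r *\<^sub>R (t *\<^sub>R w)) \<le> s * (t * norm v) + r * (t * norm w)"
        using that t by (intro order_trans[OF norm_triangle_ineq]) simp
      also have "\<dots> \<le> t * norm v + t * norm w"
        using that t by (intro add_mono mult_left_le_one_le) auto
      also have "\<dots> < t * (norm v + norm w + 1)" using t by (simp add: algebra_simps)
      also have "\<dots> < d * (norm v + norm w + 1)" using t n1 by (intro mult_strict_right_mono)
      also have "\<dots> = min d1 d2" unfolding d_def using n1 by simp
      finally show ?thesis .
    qed
    define g where "g = (\<lambda>s. f ((x + t *\<^sub>R w) + s *\<^sub>R (t *\<^sub>R v)) - f (x + s *\<^sub>R (t *\<^sub>R v)))"
    have "\<exists>\<xi>. 0 < \<xi> \<and> \<xi> < 1 \<and> g 1 - g 0 = (1 - 0) * (G ((x + t *\<^sub>R w) + \<xi> *\<^sub>R (t *\<^sub>R v)) \<bullet> (t *\<^sub>R v) - G (x + \<xi> *\<^sub>R (t *\<^sub>R v)) \<bullet> (t *\<^sub>R v))"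
    proof (rule MVT2)
      fix s :: real assume s: "0 \<le> s" "s \<le> 1"
      have 1: "(x + t *\<^sub>R w) + s *\<^sub>R (t *\<^sub>R v) \<in> U" "x + s *\<^sub>R (t *\<^sub>R v) \<in> U"
        using small[OF s, of 1] small[OF s, of 0] d1(2)
        by (auto simp: dist_norm subset_iff algebra_simps norm_minus_commute)
      show "(g has_real_derivative G ((x + t *\<^sub>R w) + s *\<^sub>R (t *\<^sub>R v)) \<bullet> (t *\<^sub>R v) - G (x + s *\<^sub>R (t *\<^sub>R v)) \<bullet> (t *\<^sub>R v)) (at s)"
        unfolding g_def by (intro DERIV_diff DERIV_on_line f 1)
    qed simp
    then obtain \<xi> where \<xi>: "0 < \<xi>" "\<xi> < 1"
      "g 1 - g 0 = G ((x + t *\<^sub>R w) + \<xi> *\<^sub>R (t *\<^sub>R v)) \<bullet> (t *\<^sub>R v) - G (x + \<xi> *\<^sub>R (t *\<^sub>R v)) \<bullet> (t *\<^sub>R v)" by auto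
    \<comment> \<open>a and b are the displacements at which the mean value theorem evaluates the
      gradient. They differ by \<open>t *\<^sub>R w\<close>, so their linear parts leave
      \<open>t *\<^sub>R G' w\<close>, up to the two remainders.\<close>
    define a where "a = \<xi> *\<^sub>R (t *\<^sub>R v) + t *\<^sub>R w"
    define b where "b = \<xi> *\<^sub>R (t *\<^sub>R v)"
    define ra where "ra = G (x + a) - G x - G' a"
    define rb where "rb = G (x + b) - G x - G' b"
    have na: "norm a < min d1 d2" and nb: "norm b < min d1 d2"
      using small[of \<xi> 1] small[of \<xi> 0] \<xi> by (auto simp: a_def b_def)
    have ra: "norm ra \<le> e * norm a" and rb: "norm rb \<le> e * norm b"
      using d2(2)[of "x + a"] d2(2)[of "x + b"] na nb by (auto simp: ra_def rb_def)
    have na2: "norm a \<le> t * (norm v + norm w)"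
    proof -
      have "norm a \<le> \<xi> * (t * norm v) + t * norm w"
        unfolding a_def using \<xi> t by (intro order_trans[OF norm_triangle_ineq]) simp
      also have "\<dots> \<le> t * norm v + t * norm w" using \<xi> t by (intro add_mono mult_left_le_one_le) auto
      finally show ?thesis by (simp add: algebra_simps)
    qed
    have nb2: "norm b \<le> t * norm v"
      unfolding b_def using \<xi> t by (simp add: mult_left_le_one_le)
    have "g 1 - g 0 = t * ((G (x + a) - G (x + b)) \<bullet> v)"
      unfolding \<xi>(3) a_def b_def by (simp add: inner_diff_left algebra_simps)
    also have "G (x + a) - G (x + b) = t *\<^sub>R G' w + ra - rb"
    proof -
      have "G' a - G' b = t *\<^sub>R G' w"
        unfolding G'.diff[symmetric] a_def b_def by (simp add: G'.scaleR)
      then show ?thesis unfolding ra_def rb_def by (simp add: algebra_simps)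
    qed
    finally have g: "g 1 - g 0 = t * (t * (G' w \<bullet> v) + (ra - rb) \<bullet> v)"
      by (simp add: inner_add_left inner_diff_left)
    have "(g 1 - g 0) / t\<^sup>2 - G' w \<bullet> v = ((ra - rb) \<bullet> v) / t"
      unfolding g using t by (simp add: field_simps power2_eq_square)
    also have "\<bar>\<dots>\<bar> \<le> norm (ra - rb) * norm v / t"
      using t Cauchy_Schwarz_ineq2[of "ra - rb" v] by (simp add: divide_right_mono)
    also have "\<dots> \<le> (e * (t * (2 * norm v + norm w))) * norm v / t"
    proof (intro divide_right_mono mult_right_mono)
      have "norm (ra - rb) \<le> e * norm a + e * norm b"
        using norm_triangle_ineq4[of ra rb] ra rb by linarith
      also have "\<dots> \<le> e * (t * (norm v + norm w)) + e * (t * norm v)"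
        using na2 nb2 \<open>e > 0\<close> by (intro add_mono mult_left_mono) auto
      finally show "norm (ra - rb) \<le> e * (t * (2 * norm v + norm w))" by (simp add: algebra_simps)
    qed (use t in auto)
    finally have "\<bar>(g 1 - g 0) / t\<^sup>2 - G' w \<bullet> v\<bar> \<le> e * ((2 * norm v + norm w) * norm v)"
      using t by (simp add: mult_ac)
    then show ?thesis unfolding g_def by (simp add: algebra_simps)
  qed
  ultimately show ?thesis unfolding eventually_at_right_field by blast
qed

lemma gradient_derivative_symmetric:
  fixes f :: "'a::euclidean_space \<Rightarrow> real"
  assumes "open U" "x \<in> U"
    and f: "\<And>y. y \<in> U \<Longrightarrow> (f has_derivative (\<lambda>v. G y \<bullet> v)) (at y)"
    and G: "(G has_derivative G') (at x)"
  shows "G' w \<bullet> v = G' v \<bullet> w"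
proof -
  define C where "C = (2 * norm v + norm w) * norm v + (2 * norm w + norm v) * norm w"
  have C: "C \<ge> 0" unfolding C_def by simp
  have "\<bar>G' w \<bullet> v - G' v \<bullet> w\<bar> \<le> e" if "e > 0" for e
  proof -
    define e' where "e' = e / (C + 1)"
    have e': "e' > 0" using that C by (simp add: e'_def)
    have "eventually (\<lambda>t. \<bar>(f (x + t *\<^sub>R v + t *\<^sub>R w) - f (x + t *\<^sub>R v) - f (x + t *\<^sub>R w) + f x) / t\<^sup>2 - G' w \<bullet> v\<bar>
     \<le> e' * ((2 * norm v + norm w) * norm v)) (at_right 0)" for v w
      by (rule second_difference_approx[where U = U]) (use assms e' in auto)
    from this[of v w] this[of w v]
    have "eventually (\<lambda>t::real. \<bar>G' w \<bullet> v - G' v \<bullet> w\<bar> \<le> e' * C) (at_right 0)"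
    proof eventually_elim
      case (elim t)
      have "x + t *\<^sub>R w + t *\<^sub>R v = x + t *\<^sub>R v + t *\<^sub>R w" by simp
      with elim show ?case unfolding C_def by (simp add: algebra_simps)
    qed
    then have "\<bar>G' w \<bullet> v - G' v \<bullet> w\<bar> \<le> e' * C"
      by (simp add: eventually_const_iff trivial_limit_at_right_real)
    also have "\<dots> \<le> e" unfolding e'_def using C that by (simp add: field_simps)
    finally show ?thesis .
  qed
  then have "\<bar>G' w \<bullet> v - G' v \<bullet> w\<bar> \<le> 0" by (rule field_le_epsilon) simp
  then show ?thesis by simp
qed

text \<open>Continuity of the Hessian makes the gradient Lipschitz near \<open>x0\<close>. One r and
  one M serve all nearby base points, which is what permits a compactness argument for the ball
  radius.\<close>

lemma local_quadratic_upper_bound: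
  fixes f :: "'a::euclidean_space \<Rightarrow> real"
  assumes "open U" "x0 \<in> U"
    and f: "\<And>y. y \<in> U \<Longrightarrow> (f has_derivative (\<lambda>v. G y \<bullet> v)) (at y)"
    and G: "\<And>y. y \<in> U \<Longrightarrow> (G has_derivative blinfun_apply (H y)) (at y)"
    and H: "continuous_on U H"
  obtains r M where "r > 0" "M > 0" "ball x0 (2 * r) \<subseteq> U"
    "\<And>x v. x \<in> ball x0 r \<Longrightarrow> norm v < r \<Longrightarrow> f (x + v) \<le> f x + G x \<bullet> v + M * (norm v)\<^sup>2"
proof -
  obtain d1 where d1: "d1 > 0" "ball x0 d1 \<subseteq> U"
    using assms(1,2) openE by blast
  have "isCont H x0" using H assms(1,2) by (simp add: continuous_on_eq_continuous_at)
  then obtain d2 where d2: "d2 > 0" "\<And>y. dist y x0 < d2 \<Longrightarrow> dist (H y) (H x0) < 1"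
    unfolding continuous_at_eps_delta by (metis dist_norm zero_less_one)
  define M where "M = norm (H x0) + 1"
  define d where "d = min d1 d2"
  have d: "d > 0" "ball x0 d \<subseteq> U" using d1 d2 by (auto simp: d_def)
  have HM: "norm (H y) \<le> M" if "y \<in> ball x0 d" for y
    using d2(2)[of y] that norm_triangle_ineq2[of "H y" "H x0"]
    by (auto simp: M_def d_def dist_norm norm_minus_commute)
  have M: "M > 0" unfolding M_def by (simp add: add_nonneg_pos)
  have lip: "norm (G y - G x) \<le> M * norm (y - x)" if "x \<in> ball x0 d" "y \<in> ball x0 d" for x y
  proof (rule differentiable_bound[of "ball x0 d" G "\<lambda>y. blinfun_apply (H y)"])
    show "(G has_derivative blinfun_apply (H z)) (at z within ball x0 d)" if "z \<in> ball x0 d" for z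
      using G d(2) that by (blast intro: has_derivative_at_withinI)
    show "onorm (blinfun_apply (H z)) \<le> M" if "z \<in> ball x0 d" for z
      using HM[OF that] by (simp add: norm_blinfun.rep_eq)
  qed (use that in auto)
  show ?thesis
  proof (rule that[of "d/2" M])
    show "ball x0 (2 * (d/2)) \<subseteq> U" using d by simp
    fix x v :: 'a assume x: "x \<in> ball x0 (d/2)" and v: "norm v < d/2"
    have inb: "x + s *\<^sub>R v \<in> ball x0 d" if "0 \<le> s" "s \<le> 1" for s
    proof -
      have "norm (s *\<^sub>R v) \<le> norm v" using that by (simp add: mult_left_le_one_le)
      then have "dist x0 (x + s *\<^sub>R v) < d"
        using x v norm_triangle_ineq4[of "x0 - x" "s *\<^sub>R v"] by (simp add: dist_norm diff_diff_eq)
      then show ?thesis by simp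
    qed
    have "\<exists>\<xi>. 0 < \<xi> \<and> \<xi> < 1 \<and> f (x + 1 *\<^sub>R v) - f (x + 0 *\<^sub>R v) = (1 - 0) * (G (x + \<xi> *\<^sub>R v) \<bullet> v)"
      by (rule MVT2[of 0 1 "\<lambda>t. f (x + t *\<^sub>R v)"]) (use d(2) inb in \<open>auto intro!: DERIV_on_line f\<close>)
    then obtain \<xi> where \<xi>: "0 < \<xi>" "\<xi> < 1" "f (x + v) - f x = G (x + \<xi> *\<^sub>R v) \<bullet> v" by auto
    have "(G (x + \<xi> *\<^sub>R v) - G x) \<bullet> v \<le> norm (G (x + \<xi> *\<^sub>R v) - G x) * norm v"
      by (rule norm_cauchy_schwarz)
    also have "\<dots> \<le> (M * norm (\<xi> *\<^sub>R v)) * norm v"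
      using lip[OF inb[of 0] inb[of \<xi>]] \<xi> by (intro mult_right_mono) auto
    also have "\<dots> \<le> (M * norm v) * norm v"
      using \<xi> M by (intro mult_right_mono mult_left_mono) (auto simp: mult_left_le_one_le)
    finally show "f (x + v) \<le> f x + G x \<bullet> v + M * (norm v)\<^sup>2"
      using \<xi>(3) by (simp add: inner_diff_left power2_eq_square)
  qed (use d M in auto)
qed

section \<open>The Weingarten map of a defining function\<close>

definition weingarten :: "('n::finite vec \<Rightarrow> real) \<Rightarrow> 'n vec \<Rightarrow> real^'n^'n" where
  "weingarten \<rho> x =
     (let N = (\<lambda>y. (1 / norm (grad \<rho> y)) *\<^sub>R grad \<rho> y); dN = frechet_derivative N (at x)
      in matrix (\<lambda>v. dN (v - (N x \<bullet> v) *\<^sub>R N x) + (N x \<bullet> v) *\<^sub>R N x))"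

text \<open>Differentiating the normalised gradient kills the normal component of \<open>G'\<close>,
  which accounts for the outer projection; the inner one comes from restricting to the tangent
  space. Having P on both sides makes the matrix symmetric once \<open>G'\<close> is.\<close>

lemma weingarten_mult:
  fixes \<rho> :: "'n::finite vec \<Rightarrow> real"
  assumes G: "(grad \<rho> has_derivative G') (at x)" and g0: "grad \<rho> x \<noteq> 0"
  defines "u \<equiv> (1 / norm (grad \<rho> x)) *\<^sub>R grad \<rho> x"
  defines "P \<equiv> \<lambda>v. v - (u \<bullet> v) *\<^sub>R u"
  shows "weingarten \<rho> x *v w = (1 / norm (grad \<rho> x)) *\<^sub>R P (G' (P w)) + (u \<bullet> w) *\<^sub>R u"
proof -
  define N where "N = (\<lambda>y. (1 / norm (grad \<rho> y)) *\<^sub>R grad \<rho> y)"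
  define g where "g = norm (grad \<rho> x)"
  have g: "g > 0" using g0 by (simp add: g_def)
  have Gx: "grad \<rho> x = g *\<^sub>R u" using g by (simp add: u_def g_def)
  have sg: "sgn (grad \<rho> x) = u" using g by (simp add: sgn_div_norm u_def g_def divide_inverse)
  have uu: "u \<bullet> u = 1" using g0 by (simp add: u_def dot_square_norm power2_eq_square)
  interpret G': bounded_linear G' using G by (rule has_derivative_bounded_linear)
  have nd: "((\<lambda>y. norm (grad \<rho> y)) has_derivative (\<lambda>v. G' v \<bullet> u)) (at x)"
    using has_derivative_compose[OF G has_derivative_norm[OF g0]] by (simp add: sg o_def)
  have "((\<lambda>y. inverse (norm (grad \<rho> y))) has_derivative (\<lambda>v. - (inverse g * (G' v \<bullet> u) * inverse g))) (at x)"
    unfolding g_def by (rule Deriv.has_derivative_inverse[OF _ nd]) (use g0 in simp)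
  from has_derivative_scaleR[OF this G]
  have "(N has_derivative (\<lambda>v. inverse (norm (grad \<rho> x)) *\<^sub>R G' v + (- (inverse g * (G' v \<bullet> u) * inverse g)) *\<^sub>R grad \<rho> x)) (at x)"
    unfolding N_def by (simp add: inverse_eq_divide)
  also have "(\<lambda>v. inverse (norm (grad \<rho> x)) *\<^sub>R G' v + (- (inverse g * (G' v \<bullet> u) * inverse g)) *\<^sub>R grad \<rho> x)
     = (\<lambda>v. (1/g) *\<^sub>R P (G' v))"
    unfolding g_def[symmetric] unfolding Gx P_def using g
    by (auto simp: fun_eq_iff inverse_eq_divide inner_commute scaleR_diff_right)
  finally have dN: "(N has_derivative (\<lambda>v. (1/g) *\<^sub>R P (G' v))) (at x)" .
  have "linear (\<lambda>v. (1/g) *\<^sub>R P (G' (P v)) + (u \<bullet> v) *\<^sub>R u)"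
    unfolding P_def by (rule linearI) (auto simp: G'.add G'.diff G'.scaleR algebra_simps inner_simps)
  moreover have "weingarten \<rho> x = matrix (\<lambda>v. (1/g) *\<^sub>R P (G' (P v)) + (u \<bullet> v) *\<^sub>R u)"
  proof -
    have "N x = u" by (simp add: N_def u_def)
    then show ?thesis
      unfolding weingarten_def Let_def N_def[symmetric] frechet_derivative_at[OF dN, symmetric]
      by (simp add: P_def)
  qed
  ultimately show ?thesis by (simp add: matrix_works g_def)
qed

text \<open>The only place where the choice operator inside \<open>gauss_curvature\<close> is
  opened. Nothing but the two defining properties is known of the chosen function.\<close>

lemma gauss_curvature_weingarten:
  fixes K :: "'n::finite vec set"
  assumes "\<exists>U \<rho>. local_defining_fun K x U \<rho> \<and> C2_on U \<rho>"
  obtains U \<rho> where "local_defining_fun K x U \<rho>" "C2_on U \<rho>" "gauss_curvature K x = det (weingarten \<rho> x)"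
proof -
  define \<rho> where "\<rho> = (SOME \<rho>. \<exists>U. local_defining_fun K x U \<rho> \<and> C2_on U \<rho>)"
  have "\<exists>\<rho> U. local_defining_fun K x U \<rho> \<and> C2_on U \<rho>" using assms by blast
  from someI_ex[OF this] have "\<exists>U. local_defining_fun K x U \<rho> \<and> C2_on U \<rho>"
    unfolding \<rho>_def .
  moreover have "gauss_curvature K x = det (weingarten \<rho> x)"
    unfolding gauss_curvature_def weingarten_def Let_def \<rho>_def ..
  ultimately show ?thesis using that by blast
qed

section \<open>Polar bodies and rolling balls\<close>

lemma support_fun_attained:
  assumes "compact L" "L \<noteq> {}"
  obtains y where "y \<in> L" "u \<bullet> y = support_fun L u"
proof -
  have c: "compact ((\<lambda>x. u \<bullet> x) ` L)"
    by (intro compact_continuous_image continuous_intros assms)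
  have "support_fun L u \<in> (\<lambda>x. u \<bullet> x) ` L"
    unfolding support_fun_def using c assms(2)
    by (intro closed_contains_Sup) (auto intro: compact_imp_closed bounded_imp_bdd_above compact_imp_bounded)
  with that show ?thesis by auto
qed

lemma support_fun_upper:
  assumes "compact L" "y \<in> L"
  shows "u \<bullet> y \<le> support_fun L u"
proof -
  have c: "compact ((\<lambda>x. u \<bullet> x) ` L)"
    by (intro compact_continuous_image continuous_intros assms)
  show ?thesis
    unfolding support_fun_def using assms
    by (intro cSup_upper bounded_imp_bdd_above compact_imp_bounded c) auto
qed

lemma support_fun_eqI:
  assumes "compact L" "y \<in> L" "\<And>z. z \<in> L \<Longrightarrow> u \<bullet> z \<le> u \<bullet> y"
  shows "support_fun L u = u \<bullet> y"
  using assms by (metis empty_iff order_antisym support_fun_attained support_fun_upper)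

lemma support_fun_le_iff:
  assumes "compact L" "L \<noteq> {}"
  shows "support_fun L u \<le> c \<longleftrightarrow> (\<forall>y\<in>L. u \<bullet> y \<le> c)"
  using assms by (metis order_trans support_fun_attained support_fun_upper)

lemma support_fun_scaleR:
  assumes "compact L" "L \<noteq> {}" "c \<ge> 0"
  shows "support_fun L (c *\<^sub>R u) = c * support_fun L u"
proof -
  obtain y where y: "y \<in> L" "u \<bullet> y = support_fun L u"
    using support_fun_attained assms by blast
  have "support_fun L (c *\<^sub>R u) = (c *\<^sub>R u) \<bullet> y"
    using y support_fun_upper[OF assms(1)] assms
    by (intro support_fun_eqI) (auto simp: mult_left_mono)
  then show ?thesis using y by simp
qed

lemma continuous_on_support_fun:
  fixes L :: "'n::finite vec set"
  assumes "compact L" "L \<noteq> {}"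
  shows "continuous_on S (support_fun L)"
proof -
  obtain R where R: "\<And>y. y \<in> L \<Longrightarrow> norm y \<le> R" "R > 0"
    using assms(1) by (meson bounded_pos compact_imp_bounded)
  have le: "support_fun L u - support_fun L v \<le> R * norm (u - v)" for u v
  proof -
    obtain y where y: "y \<in> L" "u \<bullet> y = support_fun L u" using support_fun_attained assms by blast
    have "support_fun L u - support_fun L v \<le> u \<bullet> y - v \<bullet> y"
      using y support_fun_upper[OF assms(1) y(1)] by simp
    also have "\<dots> = (u - v) \<bullet> y" by (simp add: inner_diff_left)
    also have "\<dots> \<le> norm (u - v) * norm y" by (rule norm_cauchy_schwarz)
    also have "\<dots> \<le> R * norm (u - v)" using R(1)[OF y(1)] by (metis mult.commute mult_left_mono norm_ge_zero)
    finally show ?thesis .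
  qed
  have "R-lipschitz_on S (support_fun L)"
  proof (rule lipschitz_onI)
    fix u v show "dist (support_fun L u) (support_fun L v) \<le> R * dist u v"
      using le[of u v] le[of v u] by (simp add: dist_norm norm_minus_commute abs_le_iff)
  qed (use R in simp)
  then show ?thesis by (rule lipschitz_on_continuous_on)
qed

text \<open>All three properties pass to the polar body, so each lemma proved here can also be
  interpreted for \<open>polar K\<close>.\<close>

locale centred_body =
  fixes K :: "'n::finite vec set"
  assumes compact: "compact K" and convex: "convex K" and interior0: "0 \<in> interior K"
begin

lemma zero_mem: "0 \<in> K" using interior0 interior_subset by blast

lemma nonempty: "K \<noteq> {}" using zero_mem by blast

lemma polar_eq: "polar K = {y. support_fun K y \<le> 1}"
  unfolding polar_def support_fun_le_iff[OF compact nonempty] by (auto simp: inner_commute)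

text \<open>Radii invert: a ball of radius e inside K bounds the polar body by 1/e, and a bound R on
  K puts the ball of radius 1/R inside the polar body.\<close>

lemma centred_body_polar: "centred_body (polar K)"
proof
  obtain e where e: "e > 0" "cball 0 e \<subseteq> K"
    using interior0 mem_interior_cball by blast
  have "norm y \<le> 1 / e" if "y \<in> polar K" for y
  proof (cases "y = 0")
    case False
    have "(e / norm y) *\<^sub>R y \<in> K" using e False by (auto simp: subset_iff)
    then have "y \<bullet> ((e / norm y) *\<^sub>R y) \<le> 1" using that by (auto simp: polar_def)
    then show ?thesis using False e by (simp add: dot_square_norm power2_eq_square field_simps)
  qed (use e in simp)
  then have "bounded (polar K)" by (auto simp: bounded_iff)
  moreover have "closed (polar K)"
    unfolding polar_eq by (intro closed_Collect_le continuous_on_support_fun compact nonempty continuous_on_const)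
  ultimately show "compact (polar K)" by (simp add: compact_eq_bounded_closed)
  have "polar K = (\<Inter>z\<in>K. {y. z \<bullet> y \<le> 1})" by (auto simp: polar_def inner_commute)
  then show "convex (polar K)" by (simp add: convex_INT convex_halfspace_le)
  obtain R where R: "\<And>z. z \<in> K \<Longrightarrow> norm z \<le> R" "R > 0"
    using compact by (meson bounded_pos compact_imp_bounded)
  have "ball 0 (1 / R) \<subseteq> polar K"
  proof
    fix y :: "'n vec" assume "y \<in> ball 0 (1/R)"
    then have y: "norm y \<le> 1 / R" by simp
    have "y \<bullet> z \<le> 1" if "z \<in> K" for z
    proof -
      have "y \<bullet> z \<le> norm y * norm z" by (rule norm_cauchy_schwarz)
      also have "\<dots> \<le> 1 / R * R" using y R(1)[OF that] R(2) by (intro mult_mono) auto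
      finally show ?thesis using R by simp
    qed
    then show "y \<in> polar K" by (simp add: polar_def)
  qed
  then show "0 \<in> interior (polar K)" using R(2) by (meson centre_in_ball interior_maximal open_ball subsetD divide_pos_pos zero_less_one)
qed

lemma polar_polar: "polar (polar K) = K"
proof
  show "K \<subseteq> polar (polar K)" by (auto simp: polar_def inner_commute)
  show "polar (polar K) \<subseteq> K"
  proof (rule ccontr)
    assume "\<not> polar (polar K) \<subseteq> K"
    then obtain x where x: "x \<in> polar (polar K)" "x \<notin> K" by blast
    obtain a b where ab: "a \<bullet> x < b" "\<And>z. z \<in> K \<Longrightarrow> a \<bullet> z > b"
      using separating_hyperplane_closed_point[OF convex compact_imp_closed[OF compact] x(2)] by blast
    have b: "b < 0" using ab(2)[OF zero_mem] by simp
    \<comment> \<open>b is negative because 0 lies in K, so dividing by it reverses both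
      inequalities: the scaled normal belongs to the polar body but has inner product above 1 with
      x.\<close>
    have "(1 / b) *\<^sub>R a \<in> polar K"
      unfolding polar_def using ab(2) b by (auto simp: divide_le_eq_1 less_imp_le)
    moreover have "x \<bullet> w \<le> 1" if "w \<in> polar K" for w
      using x(1) that by (simp add: polar_def[of "polar K"])
    ultimately have "x \<bullet> ((1 / b) *\<^sub>R a) \<le> 1" by blast
    moreover have "x \<bullet> ((1 / b) *\<^sub>R a) > 1"
      using ab(1) b by (simp add: less_divide_eq inner_commute)
    ultimately show False by simp
  qed
qed

text \<open>The support function of the polar body is the gauge of K.\<close>

lemma mem_iff: "x \<in> K \<longleftrightarrow> support_fun (polar K) x \<le> 1"
  using centred_body.polar_eq[OF centred_body_polar] polar_polar by auto

lemma support_fun_pos: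
  assumes "u \<noteq> 0" shows "support_fun K u > 0"
proof -
  obtain e where e: "e > 0" "cball 0 e \<subseteq> K"
    using interior0 mem_interior_cball by blast
  have "(e / norm u) *\<^sub>R u \<in> K" using e assms by (auto simp: subset_iff)
  then have "u \<bullet> ((e / norm u) *\<^sub>R u) \<le> support_fun K u" using support_fun_upper compact by blast
  moreover have "u \<bullet> ((e / norm u) *\<^sub>R u) > 0" using assms e by (simp add: zero_less_divide_iff)
  ultimately show ?thesis by linarith
qed

lemma frontier_eq: "frontier K = {x. support_fun (polar K) x = 1}"
proof -
  interpret L: centred_body "polar K" by (rule centred_body_polar)
  let ?h = "support_fun (polar K)"
  have cont: "continuous_on UNIV ?h" by (intro continuous_on_support_fun L.compact L.nonempty)
  have "interior K = {x. ?h x < 1}"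
  proof
    have "open {x. ?h x < 1}" by (intro open_Collect_less cont continuous_on_const)
    then show "{x. ?h x < 1} \<subseteq> interior K" by (intro interior_maximal) (auto simp: mem_iff)
    show "interior K \<subseteq> {x. ?h x < 1}"
    proof
      fix x assume x: "x \<in> interior K"
      show "x \<in> {x. ?h x < 1}"
      proof (cases "x = 0")
        case True
        then show ?thesis using support_fun_scaleR[OF L.compact L.nonempty, of 0 0] by simp
      next
        case False
        obtain e where e: "e > 0" "cball x e \<subseteq> K" using x mem_interior_cball by blast
        \<comment> \<open>An interior point can be pushed outward along its ray by e and stay in K;
          homogeneity of the gauge then makes its value strictly less than 1.\<close>
        have "(1 + e / norm x) *\<^sub>R x \<in> K"
          using e False by (auto simp: subset_iff dist_norm algebra_simps)
        then have "(1 + e / norm x) * ?h x \<le> 1"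
          using support_fun_scaleR[OF L.compact L.nonempty, of "1 + e / norm x" x] e by (simp add: mem_iff)
        moreover have "?h x > 0" using L.support_fun_pos False by blast
        moreover have "e / norm x > 0" using e False by simp
        ultimately have "?h x + (e / norm x) * ?h x \<le> 1" and "(e / norm x) * ?h x > 0"
          by (simp add: distrib_right, intro mult_pos_pos)
        then show ?thesis by simp
      qed
    qed
  qed
  moreover have "closure K = {x. ?h x \<le> 1}"
    by (rule trans[OF closure_closed[OF compact_imp_closed[OF compact]]]) (use mem_iff in blast)
  ultimately have "frontier K = {x. ?h x \<le> 1} - {x. ?h x < 1}" unfolding frontier_def by (rule arg_cong2[of _ _ _ _ "(-)", rotated])
  also have "\<dots> = {x. ?h x = 1}" by auto
  finally show ?thesis .
qed

lemma inner_polar_le: "x \<in> K \<Longrightarrow> y \<in> polar K \<Longrightarrow> x \<bullet> y \<le> 1"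
  by (auto simp: polar_def inner_commute)

lemma contact_frontier:
  assumes "x \<in> K" "y \<in> polar K" "x \<bullet> y = 1"
  shows "x \<in> frontier K" "y \<in> frontier (polar K)"
proof -
  interpret L: centred_body "polar K" by (rule centred_body_polar)
  show "x \<in> frontier K"
    unfolding frontier_eq using assms mem_iff support_fun_upper[OF L.compact assms(2), of x] by auto
  show "y \<in> frontier (polar K)"
    unfolding L.frontier_eq polar_polar using assms support_fun_upper[OF compact assms(1), of y] L.mem_iff[of y]
    by (auto simp: polar_polar inner_commute)
qed

text \<open>A negative value would persist in a neighbourhood by continuity, and that neighbourhood
  would lie in K.\<close>

lemma defining_fun_frontier:
  assumes "local_defining_fun K x U \<rho>" "x \<in> frontier K" and c: "isCont \<rho> x"
  shows "\<rho> x = 0"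
proof (rule ccontr)
  assume "\<rho> x \<noteq> 0"
  have U: "open U" "x \<in> U" "K \<inter> U = {y\<in>U. \<rho> y \<le> 0}"
    using assms(1) by (auto simp: local_defining_fun_def)
  have "x \<in> K" using assms(2) compact_imp_closed[OF compact] frontier_subset_closed by blast
  then have "x \<in> K \<inter> U" using U(2) by blast
  then have "\<rho> x < 0" using \<open>\<rho> x \<noteq> 0\<close> unfolding U(3) by simp
  have "eventually (\<lambda>y. \<rho> y < 0) (nhds x)"
    using order_tendstoD(2)[OF c[unfolded isCont_def tendsto_at_iff_tendsto_nhds] \<open>\<rho> x < 0\<close>] .
  moreover have "eventually (\<lambda>y. y \<in> U) (nhds x)" using U by (simp add: eventually_nhds_in_open)
  ultimately have "eventually (\<lambda>y. y \<in> K) (nhds x)"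
    by eventually_elim (use U(3) in force)
  then have "x \<in> interior K" by (simp add: eventually_nhds interior_def) blast
  then show False using assms(2) by (simp add: frontier_def)
qed

text \<open>y is tested against the point of the ball that lies farthest in the direction of
  y.\<close>

lemma inner_ball_polar:
  assumes "norm N = 1" "s > 0" "cball (x - s *\<^sub>R N) s \<subseteq> K" "y \<in> polar K"
  shows "s * (norm y - y \<bullet> N) \<le> 1 - x \<bullet> y"
proof (cases "y = 0")
  case False
  have "x - s *\<^sub>R N + (s / norm y) *\<^sub>R y \<in> K"
    using assms False by (auto simp: subset_iff dist_norm)
  then have "y \<bullet> (x - s *\<^sub>R N + (s / norm y) *\<^sub>R y) \<le> 1"
    using assms(4) by (auto simp: polar_def)
  then show ?thesis using False
    by (simp add: inner_simps dot_square_norm power2_eq_square inner_commute algebra_simps)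
qed simp

text \<open>For a dual point the ball estimate becomes the equality case of Cauchy-Schwarz. This
  identifies normals without differentiating: any inscribed ball touching at x determines the
  direction of y.\<close>

lemma inner_ball_normal:
  assumes "norm N = 1" "s > 0" "cball (x - s *\<^sub>R N) s \<subseteq> K" "y \<in> polar K" "x \<bullet> y = 1"
  shows "y = norm y *\<^sub>R N"
proof -
  have "s * (norm y - y \<bullet> N) \<le> 0" using inner_ball_polar[OF assms(1-4)] assms(5) by simp
  then have "norm y \<le> y \<bullet> N" using assms(2) by (simp add: mult_le_0_iff)
  then have "y \<bullet> N = norm y * norm N" using norm_cauchy_schwarz[of y N] assms(1) by simp
  then show ?thesis using norm_cauchy_schwarz_eq[of y N] assms(1) by simp
qed

text \<open>A point of the ball is x + v with v = s (e - N) and \<open>norm e \<le> 1\<close>. The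
  linear term of \<rho> is -g s (1 - N.e), where g is the norm of the gradient at x, while the norm
  of v squared is at most 2 s^2 (1 - N.e). Both carry the same factor, so a small s lets the linear
  term absorb the quadratic one over the whole ball.\<close>

lemma local_inner_ball:
  assumes "local_defining_fun K x0 U \<rho>" "C2_on U \<rho>"
  obtains r s0 where "r > 0" "s0 > 0"
    "\<And>x s. x \<in> K \<inter> ball x0 r \<Longrightarrow> 0 < s \<Longrightarrow> s \<le> s0 \<Longrightarrow> cball (x - s *\<^sub>R sgn (grad \<rho> x)) s \<subseteq> K \<and> grad \<rho> x \<noteq> 0"
proof -
  have U: "open U" "x0 \<in> U" "K \<inter> U = {y\<in>U. \<rho> y \<le> 0}" "\<And>y. y \<in> U \<Longrightarrow> grad \<rho> y \<noteq> 0"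
    using assms(1) by (auto simp: local_defining_fun_def)
  obtain H where H: "\<And>y. y \<in> U \<Longrightarrow> (\<rho> has_derivative (\<lambda>v. grad \<rho> y \<bullet> v)) (at y)"
    "\<And>y. y \<in> U \<Longrightarrow> (grad \<rho> has_derivative blinfun_apply (H y)) (at y)"
    "continuous_on U H"
    using C2_on_gradE[OF assms(2) U(1)] by metis
  obtain r M where r: "r > 0" "M > 0" "ball x0 (2 * r) \<subseteq> U"
    "\<And>x v. x \<in> ball x0 r \<Longrightarrow> norm v < r \<Longrightarrow> \<rho> (x + v) \<le> \<rho> x + grad \<rho> x \<bullet> v + M * (norm v)\<^sup>2"
    using local_quadratic_upper_bound[OF U(1,2) H] by blast
  define m where "m = norm (grad \<rho> x0) / 2"
  have m: "m > 0" using U by (simp add: m_def)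
  have "isCont (grad \<rho>) x0" using H(2)[OF U(2)] by (rule has_derivative_continuous)
  then obtain d where d: "d > 0" "\<And>x. dist x x0 < d \<Longrightarrow> dist (grad \<rho> x) (grad \<rho> x0) < m"
    using m unfolding continuous_at_eps_delta dist_norm by metis
  have gm: "norm (grad \<rho> x) \<ge> m" if "dist x x0 < d" for x
    using d(2)[OF that] norm_triangle_ineq2[of "grad \<rho> x0" "grad \<rho> x"]
    by (simp add: m_def dist_norm norm_minus_commute)
  \<comment> \<open>The first bound gives 2 M s at most m, hence at most the gradient norm; the
    second keeps v, of norm at most 2 s, inside the region of the quadratic estimate.\<close>
  define s0 where "s0 = min (m / (2 * M)) (r / 4)"
  show ?thesis
  proof (rule that[of "min r d" s0])
    show "min r d > 0" "s0 > 0" using r d m by (auto simp: s0_def)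
    fix x s assume x: "x \<in> K \<inter> ball x0 (min r d)" and s: "0 < s" "s \<le> s0"
    have xU: "x \<in> U" using x r(1,3) by (auto simp: subset_iff)
    have \<rho>x: "\<rho> x \<le> 0" using U(3) x xU by blast
    define g where "g = norm (grad \<rho> x)"
    have g: "g \<ge> m" "g > 0" using gm[of x] x m by (auto simp: g_def dist_commute)
    define N where "N = sgn (grad \<rho> x)"
    have N: "norm N = 1" using U(4)[OF xU] by (simp add: N_def norm_sgn)
    have gN: "grad \<rho> x = g *\<^sub>R N" using g by (simp add: N_def g_def sgn_div_norm)
    have sM: "2 * M * s \<le> m" "4 * s \<le> r" using s r by (auto simp: s0_def field_simps)
    have "cball (x - s *\<^sub>R N) s \<subseteq> K"
    proof
      fix z assume z: "z \<in> cball (x - s *\<^sub>R N) s"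
      define e where "e = (1 / s) *\<^sub>R (z - (x - s *\<^sub>R N))"
      have e: "norm e \<le> 1" using z s by (simp add: e_def dist_norm norm_minus_commute divide_le_eq_1)
      define v where "v = s *\<^sub>R (e - N)"
      have zv: "z = x + v" using s by (simp add: v_def e_def algebra_simps)
      have nv: "norm v \<le> 2 * s"
        using s N e norm_triangle_ineq4[of e N] by (simp add: v_def)
      then have vr: "norm v < r" using sM(2) s by linarith
      have "(norm (e - N))\<^sup>2 = (norm e)\<^sup>2 - 2 * (N \<bullet> e) + 1"
        using N by (simp add: power2_norm_eq_inner inner_diff_left inner_diff_right inner_commute norm_eq_1)
      also have "\<dots> \<le> 2 * (1 - N \<bullet> e)" using e power_le_one[of "norm e" 2] by simp
      finally have n2: "(norm (e - N))\<^sup>2 \<le> 2 * (1 - N \<bullet> e)" .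
      have Ne: "N \<bullet> e \<le> 1" using norm_cauchy_schwarz[of N e] N e by simp
      have "\<rho> z \<le> \<rho> x + grad \<rho> x \<bullet> v + M * (norm v)\<^sup>2"
        unfolding zv using r(4)[of x v] x vr by simp
      also have "grad \<rho> x \<bullet> v = - (g * s * (1 - N \<bullet> e))"
        using N by (simp add: gN v_def inner_diff_right norm_eq_1 algebra_simps)
      also have "M * (norm v)\<^sup>2 \<le> (2 * M * s) * s * (1 - N \<bullet> e)"
      proof -
        have "M * (norm v)\<^sup>2 = M * s\<^sup>2 * (norm (e - N))\<^sup>2" using s by (simp add: v_def power_mult_distrib)
        also have "\<dots> \<le> M * s\<^sup>2 * (2 * (1 - N \<bullet> e))" using n2 r by (intro mult_left_mono) auto
        finally show ?thesis by (simp add: power2_eq_square mult_ac)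
      qed
      also have "(2 * M * s) * s * (1 - N \<bullet> e) \<le> g * s * (1 - N \<bullet> e)"
        using sM g s Ne by (intro mult_right_mono) auto
      finally have "\<rho> z \<le> 0" using \<rho>x by simp
      moreover have "z \<in> U"
      proof -
        have "dist x0 z < 2 * r" using x vr norm_triangle_ineq4[of "x0 - x" v] by (simp add: zv dist_norm diff_diff_eq)
        then show ?thesis using r(3) by (auto simp: subset_iff)
      qed
      ultimately show "z \<in> K" using U(3) by blast
    qed
    then show "cball (x - s *\<^sub>R sgn (grad \<rho> x)) s \<subseteq> K \<and> grad \<rho> x \<noteq> 0"
      using U(4)[OF xU] by (simp add: N_def)
  qed
qed

end

section \<open>Uniform inscribed balls and quadratic contact of the polar body\<close>

locale C2_body = centred_body K for K :: "'n::finite vec set" +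
  assumes C2: "\<And>x. x \<in> frontier K \<Longrightarrow> \<exists>U \<rho>. local_defining_fun K x U \<rho> \<and> C2_on U \<rho>"
begin

lemma uniform_inner_ball:
  obtains s where "s > 0" "\<And>x. x \<in> frontier K \<Longrightarrow> \<exists>N. norm N = 1 \<and> cball (x - s *\<^sub>R N) s \<subseteq> K"
proof -
  have "\<exists>r s0. r > 0 \<and> s0 > 0 \<and> (\<forall>x\<in>K \<inter> ball x0 r. \<forall>s. 0 < s \<and> s \<le> s0 \<longrightarrow> (\<exists>N. norm N = 1 \<and> cball (x - s *\<^sub>R N) s \<subseteq> K))"
    if x0: "x0 \<in> frontier K" for x0
  proof -
    obtain U \<rho> where "local_defining_fun K x0 U \<rho>" "C2_on U \<rho>" using C2[OF x0] by blast
    from local_inner_ball[OF this] obtain r s0 where "r > 0" "s0 > 0"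
      and *: "\<And>x s. x \<in> K \<inter> ball x0 r \<Longrightarrow> 0 < s \<Longrightarrow> s \<le> s0 \<Longrightarrow> cball (x - s *\<^sub>R sgn (grad \<rho> x)) s \<subseteq> K \<and> grad \<rho> x \<noteq> 0"
      by blast
    moreover have "\<exists>N. norm N = 1 \<and> cball (x - s *\<^sub>R N) s \<subseteq> K" if "x \<in> K \<inter> ball x0 r" "0 < s \<and> s \<le> s0" for x s
      using *[of x s] that by (intro exI[of _ "sgn (grad \<rho> x)"]) (auto simp: norm_sgn)
    ultimately show ?thesis by blast
  qed
  then obtain r s0 where rs: "\<And>x0. x0 \<in> frontier K \<Longrightarrow> r x0 > 0 \<and> s0 x0 > 0 \<and>
      (\<forall>x\<in>K \<inter> ball x0 (r x0). \<forall>s. 0 < s \<and> s \<le> s0 x0 \<longrightarrow> (\<exists>N. norm N = 1 \<and> cball (x - s *\<^sub>R N) s \<subseteq> K))"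
    by metis
  have "compact (frontier K)" using compact by (rule compact_frontier)
  moreover have "frontier K \<subseteq> (\<Union>x0\<in>frontier K. ball x0 (r x0))" using rs by force
  ultimately obtain D where D: "D \<subseteq> frontier K" "finite D" "frontier K \<subseteq> (\<Union>x0\<in>D. ball x0 (r x0))"
    using compactE_image[of "frontier K" "frontier K" "\<lambda>x0. ball x0 (r x0)"] by (metis open_ball)
  \<comment> \<open>The extra element 1 keeps the set nonempty for \<open>Min\<close>.\<close>
  define s where "s = Min (insert 1 (s0 ` D))"
  have s: "s > 0" unfolding s_def using D rs by (subst Min_gr_iff) auto
  show ?thesis
  proof (rule that[OF s])
    fix x assume x: "x \<in> frontier K"
    then obtain x0 where x0: "x0 \<in> D" "x \<in> ball x0 (r x0)" using D by blast
    have "s \<le> s0 x0" unfolding s_def using D x0 by (intro Min_le) auto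
    moreover have "x \<in> K" using x compact_imp_closed[OF compact] frontier_subset_closed by blast
    ultimately show "\<exists>N. norm N = 1 \<and> cball (x - s *\<^sub>R N) s \<subseteq> K" using rs[of x0] D x0 s by blast
  qed
qed

text \<open>Dual form of the interior rolling ball: the polar body lies inside a ball touching it at the
  dual point \<open>y0\<close> of \<open>x\<close>, of radius independent of \<open>x\<close>.\<close>

lemma polar_quadratic_estimate:
  obtains C where "C > 0"
    "\<And>x y0 y. x \<in> K \<Longrightarrow> y0 \<in> polar K \<Longrightarrow> y \<in> polar K \<Longrightarrow> x \<bullet> y0 = 1 \<Longrightarrow> (norm (y - y0))\<^sup>2 \<le> C * (1 - x \<bullet> y)"
proof -
  interpret L: centred_body "polar K" by (rule centred_body_polar)
  obtain s where s: "s > 0" "\<And>x. x \<in> frontier K \<Longrightarrow> \<exists>N. norm N = 1 \<and> cball (x - s *\<^sub>R N) s \<subseteq> K"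
    using uniform_inner_ball by blast
  obtain R where R: "\<And>x. x \<in> K \<Longrightarrow> norm x \<le> R" "R > 0"
    using compact by (meson bounded_pos compact_imp_bounded)
  obtain R' where R': "\<And>x. x \<in> polar K \<Longrightarrow> norm x \<le> R'" "R' > 0"
    using L.compact by (meson bounded_pos compact_imp_bounded)
  \<comment> \<open>The first summand collects the terms in \<delta>^2, lowered to \<delta> by the
    bound 1 + R R' on \<delta>; the second collects the terms in the tangential part q, whose square
    is at most (2 R' / s) \<delta>.\<close>
  define C where "C = 2 * R'\<^sup>2 * (1 + R * R') + (2 * R'\<^sup>2 * R\<^sup>2 + 1) * (2 * R' / s)"
  show ?thesis
  proof (rule that[of C])
    show "C > 0" unfolding C_def using R R' s by (intro add_pos_pos mult_pos_pos) auto
    fix x y0 y assume xy: "x \<in> K" "y0 \<in> polar K" "y \<in> polar K" "x \<bullet> y0 = 1"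
    obtain N where N: "norm N = 1" "cball (x - s *\<^sub>R N) s \<subseteq> K" using s(2) contact_frontier xy by blast
    have NN: "N \<bullet> N = 1" using N by (simp add: norm_eq_1)
    have y0N: "y0 = norm y0 *\<^sub>R N" using inner_ball_normal N s xy by blast
    have xN: "norm y0 * (x \<bullet> N) = 1" using xy(4) y0N by (metis inner_scaleR_right)
    have "norm y0 > 0" using xy(4) by auto
    define \<delta> where "\<delta> = 1 - x \<bullet> y"
    have \<delta>0: "\<delta> \<ge> 0" using inner_polar_le xy by (simp add: \<delta>_def)
    have "- (x \<bullet> y) \<le> norm x * norm y" using Cauchy_Schwarz_ineq2[of x y] by linarith
    also have "\<dots> \<le> R * R'" using R R' xy by (intro mult_mono) auto
    finally have \<delta>1: "\<delta> \<le> 1 + R * R'" by (simp add: \<delta>_def)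
    \<comment> \<open>q is tangential and a is the normal offset from \<open>y0\<close>. The
      inscribed ball controls q, and a is then recovered from x.(y - y0) = -\<delta>.\<close>
    define q where "q = y - (y \<bullet> N) *\<^sub>R N"
    define a where "a = y \<bullet> N - norm y0"
    have qN: "q \<bullet> N = 0" by (simp add: q_def inner_diff_left NN)
    have yy: "y - y0 = a *\<^sub>R N + q" using y0N by (simp add: a_def q_def algebra_simps)
    \<comment> \<open>Factored as a difference of squares because the ball estimate bounds precisely
      the factor \<open>norm y - y \<bullet> N\<close> by \<delta> / s.\<close>
    have q2: "(norm q)\<^sup>2 = (norm y - y \<bullet> N) * (norm y + y \<bullet> N)"
      by (simp add: q_def power2_norm_eq_inner inner_diff_left inner_diff_right NN inner_commute algebra_simps
          flip: power2_eq_square)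
    have "y \<bullet> N \<le> norm y" using norm_cauchy_schwarz[of y N] N by simp
    have "(norm q)\<^sup>2 \<le> (\<delta> / s) * (2 * R')"
      unfolding q2
    proof (rule mult_mono)
      show "norm y - y \<bullet> N \<le> \<delta> / s"
        using inner_ball_polar[OF N(1) s(1) N(2) xy(3)] s(1) by (simp add: \<delta>_def field_simps)
      show "norm y + y \<bullet> N \<le> 2 * R'" using \<open>y \<bullet> N \<le> norm y\<close> R'(1)[OF xy(3)] by simp
      show "0 \<le> norm y + y \<bullet> N" using Cauchy_Schwarz_ineq2[of y N] N by simp
    qed (use \<delta>0 s in auto)
    then have q3: "(norm q)\<^sup>2 \<le> (2 * R' / s) * \<delta>" by (simp add: mult_ac)
    have "a * (x \<bullet> N) + x \<bullet> q = - \<delta>"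
    proof -
      have "x \<bullet> (y - y0) = a * (x \<bullet> N) + x \<bullet> q" unfolding yy by (simp add: inner_add_right)
      then show ?thesis using xy(4) by (simp add: \<delta>_def inner_diff_right)
    qed
    then have "a = norm y0 * (- \<delta> - x \<bullet> q)"
      using xN by (metis (no_types, opaque_lifting) add_diff_cancel_right' mult.assoc mult.commute mult.right_neutral)
    then have "\<bar>a\<bar> \<le> R' * (\<delta> + R * norm q)"
    proof -
      assume "a = norm y0 * (- \<delta> - x \<bullet> q)"
      then have "\<bar>a\<bar> = norm y0 * \<bar>- \<delta> - x \<bullet> q\<bar>" by (simp add: abs_mult)
      also have "\<dots> \<le> R' * (\<delta> + R * norm q)"
      proof (rule mult_mono)
        have "\<bar>x \<bullet> q\<bar> \<le> R * norm q"
          using Cauchy_Schwarz_ineq2[of x q] mult_right_mono[OF R(1)[OF xy(1)], of "norm q"] by simp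
        then show "\<bar>- \<delta> - x \<bullet> q\<bar> \<le> \<delta> + R * norm q" using \<delta>0 by linarith
      qed (use R' xy in auto)
      finally show ?thesis .
    qed
    then have "a\<^sup>2 \<le> (R' * (\<delta> + R * norm q))\<^sup>2" by (metis abs_ge_zero power2_abs power_mono)
    also have "\<dots> \<le> R'\<^sup>2 * (2 * \<delta>\<^sup>2 + 2 * (R * norm q)\<^sup>2)"
    proof -
      have "(\<delta> + R * norm q)\<^sup>2 \<le> 2 * \<delta>\<^sup>2 + 2 * (R * norm q)\<^sup>2"
        using sum_squares_ge_zero[of "\<delta> - R * norm q" 0] by (simp add: power2_eq_square algebra_simps)
      then show ?thesis by (simp add: power_mult_distrib mult_left_mono)
    qed
    finally have "a\<^sup>2 + (norm q)\<^sup>2 \<le> 2 * R'\<^sup>2 * \<delta>\<^sup>2 + (2 * R'\<^sup>2 * R\<^sup>2 + 1) * (norm q)\<^sup>2"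
      by (simp add: power_mult_distrib algebra_simps)
    also have "\<dots> \<le> 2 * R'\<^sup>2 * ((1 + R * R') * \<delta>) + (2 * R'\<^sup>2 * R\<^sup>2 + 1) * ((2 * R' / s) * \<delta>)"
    proof -
      have "\<delta>\<^sup>2 \<le> (1 + R * R') * \<delta>" using \<delta>0 \<delta>1 by (simp add: power2_eq_square mult_right_mono)
      with q3 show ?thesis by (intro add_mono mult_left_mono) auto
    qed
    also have "\<dots> = C * \<delta>" by (simp add: C_def algebra_simps)
    also have "a\<^sup>2 + (norm q)\<^sup>2 = (norm (y - y0))\<^sup>2"
      unfolding yy power2_norm_eq_inner using qN NN by (simp add: inner_simps inner_commute power2_eq_square)
    finally show "(norm (y - y0))\<^sup>2 \<le> C * (1 - x \<bullet> y)" by (simp add: \<delta>_def)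
  qed
qed

text \<open>Smoothness of K appears as strict convexity of the polar body: the quadratic estimate
  has right-hand side 0 at a second contact point.\<close>

lemma dual_point_unique:
  assumes "x \<in> K" "y \<in> polar K" "y' \<in> polar K" "x \<bullet> y = 1" "x \<bullet> y' = 1"
  shows "y = y'"
proof -
  obtain C where "C > 0" "\<And>x y0 y. x \<in> K \<Longrightarrow> y0 \<in> polar K \<Longrightarrow> y \<in> polar K \<Longrightarrow> x \<bullet> y0 = 1 \<Longrightarrow> (norm (y - y0))\<^sup>2 \<le> C * (1 - x \<bullet> y)"
    using polar_quadratic_estimate by blast
  from this(2)[of x y' y] assms show ?thesis by simp
qed

end

section \<open>Smoothness of the polar body\<close>

text \<open>Continuity of operator inversion, stated for solutions of \<open>A q (z q) = w\<close>
  with fixed w. It yields continuity of the derivative of the local inverse, which is given only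
  pointwise as a set-theoretic inverse.\<close>

lemma inverse_family_tendsto:
  fixes A :: "'a::metric_space \<Rightarrow> 'b::euclidean_space \<Rightarrow>\<^sub>L 'b" and z :: "'a \<Rightarrow> 'b"
  assumes A: "(A \<longlongrightarrow> A q0) (at q0 within S)"
    and z: "\<And>q. q \<in> S \<Longrightarrow> A q (z q) = w" and "q0 \<in> S"
    and inj: "inj (blinfun_apply (A q0))"
  shows "(z \<longlongrightarrow> z q0) (at q0 within S)"
proof -
  obtain B where B: "B > 0" "\<And>x. B * norm x \<le> norm (A q0 x)"
    using linear_inj_bounded_below_pos[OF bounded_linear.linear[OF blinfun.bounded_linear_right] inj]
    by metis
  have bound: "norm (z q - z q0) \<le> (2 / B) * norm (A q - A q0) * norm (z q0)"
    if q: "q \<in> S" "norm (A q - A q0) \<le> B / 2" for q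
  proof -
    let ?\<epsilon> = "norm (A q - A q0)"
    \<comment> \<open>The perturbation is moved to the right-hand side. The lower bound B of the
      injective limit operator then absorbs the part of \<open>z q\<close> that is not yet under
      control.\<close>
    have "A q0 (z q - z q0) = A q0 (z q) - A q (z q)"
      using z[OF q(1)] z[OF \<open>q0 \<in> S\<close>] by (simp add: blinfun.bilinear_simps)
    also have "\<dots> = - ((A q - A q0) (z q))" by (simp add: blinfun.bilinear_simps)
    finally have "B * norm (z q - z q0) \<le> norm ((A q - A q0) (z q))"
      using B(2)[of "z q - z q0"] by simp
    also have "\<dots> \<le> ?\<epsilon> * norm (z q)" by (rule norm_blinfun)
    also have "\<dots> \<le> ?\<epsilon> * (norm (z q - z q0) + norm (z q0))"
      using norm_triangle_ineq[of "z q - z q0" "z q0"] by (intro mult_left_mono) auto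
    also have "\<dots> \<le> B / 2 * norm (z q - z q0) + ?\<epsilon> * norm (z q0)"
      unfolding distrib_left using q(2) by (intro add_right_mono mult_right_mono) auto
    finally have "B / 2 * norm (z q - z q0) \<le> ?\<epsilon> * norm (z q0)" by simp
    then show ?thesis using B(1) by (simp add: field_simps)
  qed
  have d0: "((\<lambda>q. norm (A q - A q0)) \<longlongrightarrow> 0) (at q0 within S)"
    using A by (simp add: LIM_zero_iff tendsto_norm_zero_iff)
  have "eventually (\<lambda>q. norm (A q - A q0) < B / 2) (at q0 within S)"
    using order_tendstoD(2)[OF d0, of "B / 2"] B(1) by simp
  moreover have "eventually (\<lambda>q. q \<in> S) (at q0 within S)"
    unfolding eventually_at_topological by auto
  ultimately have ev: "eventually (\<lambda>q. norm (z q - z q0) \<le> (2 / B) * norm (A q - A q0) * norm (z q0)) (at q0 within S)"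
    by eventually_elim (use bound in auto)
  have "((\<lambda>q. (2 / B) * norm (A q - A q0) * norm (z q0)) \<longlongrightarrow> (2 / B) * 0 * norm (z q0)) (at q0 within S)"
    by (intro tendsto_intros d0)
  then have "((\<lambda>q. norm (z q - z q0)) \<longlongrightarrow> 0) (at q0 within S)"
    by (intro tendsto_sandwich[OF _ ev tendsto_const]) auto
  then show ?thesis by (simp add: LIM_zero_iff tendsto_norm_zero_iff)
qed

text \<open>Since \<open>X y\<close> and \<open>X y'\<close> are maximisers for their own
  directions, the linearisation error lies between 0 and (X y' - X y).(y' - y). Continuity of X at y
  alone makes this o(|y' - y|).\<close>

lemma support_fun_has_derivative:
  fixes K :: "'n::finite vec set"
  assumes K: "compact K" and "open W" "y \<in> W"
    and X: "\<And>y. y \<in> W \<Longrightarrow> X y \<in> K \<and> support_fun K y = y \<bullet> X y" and cont: "isCont X y"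
  shows "(support_fun K has_derivative (\<lambda>v. X y \<bullet> v)) (at y)"
  unfolding has_derivative_at_alt
proof (intro conjI allI impI)
  show "bounded_linear (\<lambda>v. X y \<bullet> v)" by (rule bounded_linear_inner_right)
  fix e :: real assume e: "e > 0"
  obtain d1 where d1: "d1 > 0" "ball y d1 \<subseteq> W" using assms(2,3) openE by blast
  obtain d2 where d2: "d2 > 0" "\<And>y'. norm (y' - y) < d2 \<Longrightarrow> norm (X y' - X y) < e"
    using cont e unfolding continuous_at_eps_delta by (metis dist_norm)
  show "\<exists>d>0. \<forall>y'. norm (y' - y) < d \<longrightarrow> norm (support_fun K y' - support_fun K y - X y \<bullet> (y' - y)) \<le> e * norm (y' - y)"
  proof (intro exI[of _ "min d1 d2"] conjI allI impI)
    fix y' assume y': "norm (y' - y) < min d1 d2"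
    then have "y' \<in> W" using d1 by (auto simp: subset_iff dist_norm norm_minus_commute)
    have 1: "support_fun K y' - support_fun K y - X y \<bullet> (y' - y) \<ge> 0"
      using X[OF \<open>y \<in> W\<close>] support_fun_upper[OF K, of "X y" y'] by (simp add: inner_diff_right inner_commute)
    have "support_fun K y' - support_fun K y - X y \<bullet> (y' - y) \<le> (X y' - X y) \<bullet> (y' - y)"
      using X[OF \<open>y' \<in> W\<close>] support_fun_upper[OF K, of "X y'" y] by (simp add: inner_diff_right inner_diff_left inner_commute)
    also have "\<dots> \<le> norm (X y' - X y) * norm (y' - y)" by (rule norm_cauchy_schwarz)
    also have "\<dots> \<le> e * norm (y' - y)" using d2(2)[of y'] y' by (intro mult_right_mono) auto
    finally show "norm (support_fun K y' - support_fun K y - X y \<bullet> (y' - y)) \<le> e * norm (y' - y)" using 1 by simp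
  qed (use d1 d2 in simp)
qed

text \<open>Otherwise \<rho> would become positive at the start of the segment from x to z, although
  convexity keeps that segment in K.\<close>

lemma (in centred_body) outer_normal_of_defining_fun:
  assumes "local_defining_fun K x0 U \<rho>" "x \<in> U" "\<rho> x = 0" "z \<in> K"
    and d: "(\<rho> has_derivative (\<lambda>v. grad \<rho> x \<bullet> v)) (at x)"
  shows "grad \<rho> x \<bullet> (z - x) \<le> 0"
proof (rule ccontr)
  assume "\<not> ?thesis"
  then have pos: "grad \<rho> x \<bullet> (z - x) > 0" by simp
  have U: "open U" "K \<inter> U = {y\<in>U. \<rho> y \<le> 0}" using assms(1) by (auto simp: local_defining_fun_def)
  have "x \<in> K \<inter> U" unfolding U(2) using assms(2,3) by simp
  then have xK: "x \<in> K" by simp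
  have "((\<lambda>t. \<rho> (x + t *\<^sub>R (z - x))) has_real_derivative grad \<rho> x \<bullet> (z - x)) (at 0)"
    by (rule DERIV_on_line) (use d in simp)
  from DERIV_pos_inc_right[OF this pos] obtain d1 where d1: "d1 > 0" "\<And>h. 0 < h \<Longrightarrow> h < d1 \<Longrightarrow> \<rho> x < \<rho> (x + h *\<^sub>R (z - x))"
    by auto
  have "continuous (at 0) (\<lambda>t. x + t *\<^sub>R (z - x))" by (intro continuous_intros)
  then have "eventually (\<lambda>t. x + t *\<^sub>R (z - x) \<in> U) (at 0)"
    using U(1) assms(2) unfolding continuous_at by (auto dest: topological_tendstoD)
  then obtain d2 where d2: "d2 > 0" "\<And>t::real. t \<noteq> 0 \<Longrightarrow> \<bar>t\<bar> < d2 \<Longrightarrow> x + t *\<^sub>R (z - x) \<in> U"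
    unfolding eventually_at by (auto simp: dist_norm)
  define t where "t = min (1/2) (min d1 d2 / 2)"
  have t: "0 < t" "t < 1" "t < d1" "t < d2" using d1 d2 by (auto simp: t_def)
  have "x + t *\<^sub>R (z - x) \<in> K"
    using convexD_alt[OF convex xK assms(4), of t] t by (simp add: algebra_simps)
  moreover have "x + t *\<^sub>R (z - x) \<in> U" using d2(2)[of t] t by simp
  ultimately have "\<rho> (x + t *\<^sub>R (z - x)) \<le> 0" using U by blast
  then show False using d1(2)[of t] t assms(3) by simp
qed

context centred_body
begin

text \<open>Nonvanishing curvature is the condition under which the contact point depends
  differentiably on the normal. The defining function produced is
  \<open>support_fun K y - 1\<close>, whose gradient is that contact point.\<close>

lemma ex_C2_defining_fun_polar:
  assumes y0: "y0 \<in> frontier (polar K)"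
    and C2: "\<And>x. x \<in> frontier K \<Longrightarrow> \<exists>U \<rho>. local_defining_fun K x U \<rho> \<and> C2_on U \<rho>"
    and curv: "\<And>x. x \<in> frontier K \<Longrightarrow> gauss_curvature K x \<noteq> 0"
  shows "\<exists>W f. local_defining_fun (polar K) y0 W f \<and> C2_on W f"
proof -
  interpret L: centred_body "polar K" by (rule centred_body_polar)
  have hy0: "support_fun K y0 = 1" using y0 unfolding L.frontier_eq polar_polar by simp
  have y0L: "y0 \<in> polar K" using hy0 polar_eq by simp
  obtain x0 where x0: "x0 \<in> K" "y0 \<bullet> x0 = 1" using support_fun_attained[OF compact nonempty] hy0 by metis
  have x0f: "x0 \<in> frontier K" using contact_frontier[OF x0(1) y0L] x0(2) by (simp add: inner_commute)
  obtain U \<rho> where \<rho>: "local_defining_fun K x0 U \<rho>" "C2_on U \<rho>" "det (weingarten \<rho> x0) \<noteq> 0"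
    using gauss_curvature_weingarten[OF C2[OF x0f]] curv[OF x0f] by metis
  have U: "open U" "x0 \<in> U" "K \<inter> U = {y\<in>U. \<rho> y \<le> 0}" "\<And>y. y \<in> U \<Longrightarrow> grad \<rho> y \<noteq> 0"
    using \<rho>(1) by (auto simp: local_defining_fun_def)
  obtain H where H: "\<And>y. y \<in> U \<Longrightarrow> (\<rho> has_derivative (\<lambda>v. grad \<rho> y \<bullet> v)) (at y)"
    "\<And>y. y \<in> U \<Longrightarrow> (grad \<rho> has_derivative blinfun_apply (H y)) (at y)"
    "continuous_on U H"
    using C2_on_gradE[OF \<rho>(2) U(1)] by metis
  have contG: "continuous_on U (grad \<rho>)"
    using H(2) by (auto simp: continuous_on_eq_continuous_at[OF U(1)] intro: has_derivative_continuous)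
  have \<rho>x0: "\<rho> x0 = 0"
    by (rule defining_fun_frontier[OF \<rho>(1) x0f has_derivative_continuous[OF H(1)[OF U(2)]]])
  obtain r s0 where "r > 0" "s0 > 0"
    "\<And>x s. x \<in> K \<inter> ball x0 r \<Longrightarrow> 0 < s \<Longrightarrow> s \<le> s0 \<Longrightarrow> cball (x - s *\<^sub>R sgn (grad \<rho> x)) s \<subseteq> K \<and> grad \<rho> x \<noteq> 0"
    using local_inner_ball[OF \<rho>(1,2)] by blast
  then have "cball (x0 - s0 *\<^sub>R sgn (grad \<rho> x0)) s0 \<subseteq> K" "norm (sgn (grad \<rho> x0)) = 1"
    using x0(1) U(4)[OF U(2)] by (auto simp: norm_sgn)
  from inner_ball_normal[OF this(2) \<open>s0 > 0\<close> this(1) y0L] x0(2)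
  have y0N: "y0 = norm y0 *\<^sub>R sgn (grad \<rho> x0)" by (simp add: inner_commute)
  define l0 where "l0 = norm y0 / norm (grad \<rho> x0)"
  have "y0 \<noteq> 0" using x0(2) by auto
  then have l0: "l0 > 0" using U by (simp add: l0_def)
  have y0G: "l0 *\<^sub>R grad \<rho> x0 = y0"
    by (subst y0N) (simp add: l0_def sgn_div_norm divide_inverse)

  \<comment> \<open>Inverting the Lagrange system \<open>y = l * grad \<rho> x\<close>, \<open>\<rho> x = 0\<close> shows that the maximiser \<open>x\<close> of \<open>y\<close> on \<open>K\<close>,
    which is the gradient of the support function at \<open>y\<close>, depends differentiably on \<open>y\<close>.\<close>
  define F where "F = (\<lambda>p::'n vec \<times> real. (snd p *\<^sub>R grad \<rho> (fst p), \<rho> (fst p)))"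
  define F'' where "F'' = (\<lambda>(p::'n vec \<times> real) (q::'n vec \<times> real).
      (snd p *\<^sub>R H (fst p) (fst q) + snd q *\<^sub>R grad \<rho> (fst p), grad \<rho> (fst p) \<bullet> fst q))"
  have lin: "linear (F'' p)" for p
    unfolding F''_def by (rule linearI) (auto simp: blinfun.bilinear_simps algebra_simps inner_simps)
  then have bl: "bounded_linear (F'' p)" for p by (simp add: linear_conv_bounded_linear)
  define F' where "F' = (\<lambda>p. Blinfun (F'' p))"
  have F': "blinfun_apply (F' p) = F'' p" for p
    unfolding F'_def by (rule bounded_linear_Blinfun_apply[OF bl])
  let ?U = "U \<times> (UNIV :: real set)"
  have oU: "open ?U" using U by (intro open_Times) auto
  have derF: "(F has_derivative blinfun_apply (F' p)) (at p)" if "p \<in> ?U" for p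
  proof -
    have p: "fst p \<in> U" using that by auto
    have f: "(fst has_derivative fst) (at p)" "(snd has_derivative snd) (at p)"
      by (auto intro!: derivative_eq_intros)
    have 1: "((\<lambda>p. grad \<rho> (fst p)) has_derivative (\<lambda>q. H (fst p) (fst q))) (at p)"
      using has_derivative_compose[OF f(1) H(2)[OF p]] .
    have 2: "((\<lambda>p. \<rho> (fst p)) has_derivative (\<lambda>q. grad \<rho> (fst p) \<bullet> fst q)) (at p)"
      using has_derivative_compose[OF f(1) H(1)[OF p]] .
    show ?thesis
      unfolding F_def F' F''_def by (intro has_derivative_Pair has_derivative_scaleR f 1 2)
  qed
  have contF': "continuous_on ?U F'"
  proof (rule continuous_on_blinfun_componentwise)
    fix q :: "'n vec \<times> real"
    have c: "continuous_on ?U (\<lambda>p. H (fst p))" "continuous_on ?U (\<lambda>p. grad \<rho> (fst p))"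
      by (auto intro!: continuous_on_compose2[OF H(3)] continuous_on_compose2[OF contG] continuous_intros)
    show "continuous_on ?U (\<lambda>p. F' p q)"
      unfolding F' F''_def by (intro continuous_intros c)
  qed
  define p0 where "p0 = (x0, l0)"
  have p0U: "p0 \<in> ?U" using U by (simp add: p0_def)
  \<comment> \<open>A kernel vector (v, \<mu>) has v tangent and H v normal, so the Weingarten map
    annihilates v. Its nonzero determinant gives v = 0, and then \<mu> = 0 because the gradient does
    not vanish.\<close>
  have inj0: "inj (F'' p0)"
    unfolding linear_injective_0[OF lin]
  proof (intro allI impI)
    fix q assume q: "F'' p0 q = 0"
    obtain v \<mu> where qv: "q = (v, \<mu>)" by (cases q)
    have q1: "l0 *\<^sub>R H x0 v + \<mu> *\<^sub>R grad \<rho> x0 = 0" and q2: "grad \<rho> x0 \<bullet> v = 0"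
      using q by (auto simp: F''_def qv p0_def zero_prod_def)
    have G0: "grad \<rho> x0 \<noteq> 0" using U by blast
    define u where "u = (1 / norm (grad \<rho> x0)) *\<^sub>R grad \<rho> x0"
    have Gu: "grad \<rho> x0 = norm (grad \<rho> x0) *\<^sub>R u" using G0 by (simp add: u_def)
    have "l0 *\<^sub>R H x0 v = (- \<mu>) *\<^sub>R grad \<rho> x0" using q1 by (simp add: eq_neg_iff_add_eq_0)
    then have "(1/l0) *\<^sub>R (l0 *\<^sub>R H x0 v) = (1/l0) *\<^sub>R ((- \<mu>) *\<^sub>R (norm (grad \<rho> x0) *\<^sub>R u))"
      using Gu by simp
    then have Hv: "H x0 v = (- \<mu> / l0 * norm (grad \<rho> x0)) *\<^sub>R u" using l0 by simp
    have uv: "u \<bullet> v = 0" using q2 by (simp add: u_def)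
    have uu: "u \<bullet> u = 1" using G0 by (simp add: u_def dot_square_norm power2_eq_square)
    have "weingarten \<rho> x0 *v v = 0"
      unfolding weingarten_mult[OF H(2)[OF U(2)] G0] u_def[symmetric] using uv uu by (simp add: Hv)
    then have "v = 0"
      using \<rho>(3) by (metis invertible_det_nz matrix_left_invertible_ker invertible_def)
    moreover have "\<mu> = 0" using q1 G0 \<open>v = 0\<close> by (simp add: blinfun.bilinear_simps)
    ultimately show "q = 0" by (simp add: qv zero_prod_def)
  qed
  obtain g0 where g0: "linear g0" "g0 \<circ> F'' p0 = id"
    using linear_injective_left_inverse[OF lin inj0] by blast
  have Linv: "Blinfun g0 o\<^sub>L F' p0 = id_blinfun"
  proof (rule blinfun_eqI)
    fix q
    have "bounded_linear g0" using g0(1) by (simp add: linear_conv_bounded_linear)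
    then show "(Blinfun g0 o\<^sub>L F' p0) q = id_blinfun q"
      using pointfree_idE[OF g0(2), of q] by (simp add: bounded_linear_Blinfun_apply F')
  qed
  obtain U' V g g' where inv: "open U'" "U' \<subseteq> ?U" "p0 \<in> U'" "open V" "F p0 \<in> V" "homeomorphism U' V F g"
    and g': "\<And>q. q \<in> V \<Longrightarrow> (g has_derivative g' q) (at q)"
      "\<And>q. q \<in> V \<Longrightarrow> g' q = Hilbert_Choice.inv (blinfun_apply (F' (g q)))"
      "\<And>q. q \<in> V \<Longrightarrow> bij (blinfun_apply (F' (g q)))"
    by (rule inverse_function_theorem[OF oU derF contF' p0U Linv]) (assumption, rule that, assumption+)
  have gV: "g q \<in> U'" "F (g q) = q" if "q \<in> V" for q
    using inv(6) that by (auto simp: homeomorphism_def)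
  have gF: "g (F p) = p" if "p \<in> U'" for p
    using inv(6) that by (auto simp: homeomorphism_def)
  have contg: "continuous_on V g" using inv(6) by (simp add: homeomorphism_def)
  have Fp0: "F p0 = (y0, 0)" by (simp add: F_def p0_def y0G \<rho>x0)
  let ?j = "\<lambda>y::'n vec. (y, 0::real)"
  have contj: "continuous_on S ?j" for S by (intro continuous_intros)
  define W0 where "W0 = ?j -` V"
  have oW0: "open W0" unfolding W0_def using inv(4) contj by (intro open_vimage)
  \<comment> \<open>Positivity of the multiplier keeps y pointing along the outward gradient, so the
    critical point is a maximiser on the convex body and not a minimiser.\<close>
  define W where "W = W0 \<inter> (\<lambda>y. snd (g (?j y))) -` {0<..}"
  have contgj: "continuous_on W0 (\<lambda>y. g (?j y))"
    by (intro continuous_on_compose2[OF contg contj]) (auto simp: W0_def)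
  have oW: "open W"
    unfolding W_def by (intro continuous_open_preimage continuous_on_snd contgj oW0) simp
  have WV: "?j y \<in> V" if "y \<in> W" for y using that by (auto simp: W_def W0_def)
  have y0W: "y0 \<in> W"
    using inv(5) gF[OF inv(3)] l0 unfolding Fp0 by (simp add: W_def W0_def p0_def)
  define X where "X = (\<lambda>y. fst (g (?j y)))"
  have XK: "X y \<in> K \<and> support_fun K y = y \<bullet> X y \<and> y \<noteq> 0" if y: "y \<in> W" for y
  proof -
    define l where "l = snd (g (?j y))"
    have l: "l > 0" using y by (simp add: W_def l_def)
    have XU: "X y \<in> U" using gV(1)[OF WV[OF y]] inv(2) by (auto simp: X_def)
    have "F (g (?j y)) = ?j y" using gV(2)[OF WV[OF y]] .
    then have e: "l *\<^sub>R grad \<rho> (X y) = y" "\<rho> (X y) = 0" by (auto simp: F_def l_def X_def)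
    have "X y \<in> K \<inter> U" unfolding U(3) using XU e(2) by simp
    then have XK: "X y \<in> K" by simp
    have "y \<bullet> z \<le> y \<bullet> X y" if "z \<in> K" for z
    proof -
      have "grad \<rho> (X y) \<bullet> (z - X y) \<le> 0"
        by (rule outer_normal_of_defining_fun[OF \<rho>(1) XU e(2) that H(1)[OF XU]])
      then have "l * (grad \<rho> (X y) \<bullet> (z - X y)) \<le> 0" using l by (simp add: mult_le_0_iff)
      also have "l * (grad \<rho> (X y) \<bullet> (z - X y)) = y \<bullet> (z - X y)" by (metis e(1) inner_scaleR_left)
      finally show ?thesis by (simp add: inner_diff_right)
    qed
    then show ?thesis using XK support_fun_eqI[OF compact XK] e(1) l U(4)[OF XU] by (metis less_irrefl scale_eq_0_iff)
  qed
  define Hx where "Hx = (\<lambda>y v. fst (g' (?j y) (v, 0)))"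
  have derX: "(X has_derivative Hx y) (at y)" if "y \<in> W" for y
  proof -
    have "(?j has_derivative ?j) (at y)" by (auto intro!: derivative_eq_intros)
    from has_derivative_fst[OF has_derivative_compose[OF this g'(1)[OF WV[OF that]]]]
    show ?thesis by (simp add: X_def Hx_def)
  qed
  define HX where "HX = (\<lambda>y. Blinfun (Hx y))"
  have HX: "blinfun_apply (HX y) = Hx y" if "y \<in> W" for y
    unfolding HX_def by (rule bounded_linear_Blinfun_apply[OF has_derivative_bounded_linear[OF derX[OF that]]])
  have contHX: "continuous_on W HX"
  proof (rule continuous_on_blinfun_componentwise)
    fix w :: "'n vec"
    have "continuous_on W (\<lambda>y. g' (?j y) (w, 0))"
      unfolding continuous_on_def
    proof
      fix y assume y: "y \<in> W"
      have A: "continuous_on W (\<lambda>y. F' (g (?j y)))"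
      proof (rule continuous_on_compose2[OF contF' continuous_on_subset[OF contgj]])
        show "(\<lambda>y. g (?j y)) ` W \<subseteq> ?U" using gV(1)[OF WV] inv(2) by blast
      qed (auto simp: W_def)
      show "((\<lambda>y. g' (?j y) (w, 0)) \<longlongrightarrow> g' (?j y) (w, 0)) (at y within W)"
      proof (rule inverse_family_tendsto[where A = "\<lambda>y. F' (g (?j y))" and w = "(w, 0)"])
        show "((\<lambda>y. F' (g (?j y))) \<longlongrightarrow> F' (g (?j y))) (at y within W)"
          using A y by (auto simp: continuous_on_def)
        show "F' (g (?j z)) (g' (?j z) (w, 0)) = (w, 0)" if "z \<in> W" for z
          unfolding g'(2)[OF WV[OF that]] by (rule surj_f_inv_f[OF bij_is_surj[OF g'(3)[OF WV[OF that]]]])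
        show "inj (blinfun_apply (F' (g (?j y))))" using g'(3)[OF WV[OF y]] by (rule bij_is_inj)
      qed (rule y)
    qed
    then have "continuous_on W (\<lambda>y. Hx y w)" unfolding Hx_def by (intro continuous_on_fst)
    then show "continuous_on W (\<lambda>y. HX y w)" by (rule continuous_on_eq) (simp add: HX)
  qed
  have derh: "((\<lambda>y. support_fun K y - 1) has_derivative (\<lambda>v. X y \<bullet> v)) (at y)" if "y \<in> W" for y
  proof -
    have "isCont X y" using derX[OF that] by (rule has_derivative_continuous)
    from support_fun_has_derivative[OF compact oW that _ this] XK
    have "(support_fun K has_derivative (\<lambda>v. X y \<bullet> v)) (at y)" by blast
    from has_derivative_diff[OF this has_derivative_const[of 1]] show ?thesis by simp
  qed
  have "C2_on W (\<lambda>y. support_fun K y - 1)"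
    by (rule C2_onI_grad[where G = X and H = HX]) (use derh derX HX contHX in auto)
  moreover have "local_defining_fun (polar K) y0 W (\<lambda>y. support_fun K y - 1)"
    unfolding local_defining_fun_def
  proof (intro conjI ballI)
    fix y assume y: "y \<in> W"
    show "(\<lambda>y. support_fun K y - 1) differentiable at y"
      using derh[OF y] unfolding differentiable_def by blast
    have "support_fun K y > 0" using XK[OF y] support_fun_pos by blast
    then show "grad (\<lambda>y. support_fun K y - 1) y \<noteq> 0"
      unfolding grad_eqI[OF derh[OF y]] using XK[OF y] by auto
  qed (use oW y0W polar_eq in auto)
  ultimately show ?thesis by blast
qed

end

section \<open>Asymptotics of the polar integral\<close>

text \<open>The integral of \<open>S_beta\<close> taken against \<open>lborel\<close> instead of
  \<open>lebesgue\<close>, so that measurability in x follows from Borel measurability of the joint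
  integrand.\<close>

definition polar_integral :: "real \<Rightarrow> 'n::finite vec set \<Rightarrow> 'n vec \<Rightarrow> ennreal" where
  "polar_integral \<beta> K x = (\<integral>\<^sup>+y. indicator (polar K) y * ennreal ((1 - x \<bullet> y) powr (-\<beta>)) \<partial>lborel)"

lemma nn_integral_translate:
  fixes f :: "'a::euclidean_space \<Rightarrow> ennreal"
  assumes [measurable]: "f \<in> borel_measurable borel"
  shows "(\<integral>\<^sup>+y. f (c + y) \<partial>lborel) = (\<integral>\<^sup>+y. f y \<partial>lborel)"
proof -
  have "(\<integral>\<^sup>+y. f y \<partial>distr lborel borel ((+) c)) = (\<integral>\<^sup>+y. f (c + y) \<partial>lborel)"
    by (subst nn_integral_distr) auto
  then show ?thesis by (simp add: lborel_distr_plus)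
qed

definition parabolic_scale :: "'n::finite \<Rightarrow> real \<Rightarrow> 'n vec \<Rightarrow> 'n vec" where
  "parabolic_scale i \<epsilon> z = (\<chi> j. (if j = i then \<epsilon> else sqrt \<epsilon>) * z $ j)"

lemma nn_integral_parabolic_scale:
  fixes f :: "'n::finite vec \<Rightarrow> ennreal" and B :: "real^'n^'n"
  assumes [measurable]: "f \<in> borel_measurable borel" and "det B \<noteq> 0" and \<epsilon>: "\<epsilon> > 0"
  shows "(\<integral>\<^sup>+y. f y \<partial>lborel) = ennreal (\<bar>det B\<bar> * \<epsilon> powr ((real CARD('n) + 1) / 2)) *
     (\<integral>\<^sup>+z. f (c + B *v parabolic_scale i \<epsilon> z) \<partial>lborel)"
proof -
  let ?n = "CARD('n)"
  have n1: "?n \<ge> 1" using finite_UNIV_card_ge_0[where 'a='n] by (simp add: Suc_leI)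
  have m [measurable]: "(\<lambda>z. f (c + B *v z)) \<in> borel_measurable borel" by simp
  have "(\<Prod>j\<in>UNIV. \<bar>if j = i then \<epsilon> else sqrt \<epsilon>\<bar>) = \<epsilon> * (\<Prod>j\<in>UNIV-{i}. sqrt \<epsilon>)"
    using \<epsilon> by (subst prod.remove[of _ i]) (auto intro!: prod.cong)
  also have "\<dots> = \<epsilon> * sqrt \<epsilon> ^ (?n - 1)" by (simp add: card_Diff_singleton)
  also have "sqrt \<epsilon> ^ (?n - 1) = (\<epsilon> powr (1/2)) powr (real ?n - 1)"
    using \<epsilon> n1 powr_realpow[of "sqrt \<epsilon>" "?n - 1"] by (simp add: powr_half_sqrt of_nat_diff)
  also have "\<epsilon> * \<dots> = \<epsilon> powr 1 * \<epsilon> powr ((real ?n - 1) / 2)" using \<epsilon> by (simp add: powr_powr)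
  also have "\<dots> = \<epsilon> powr ((real ?n + 1) / 2)" unfolding powr_add[symmetric] by (simp add: field_simps)
  finally have p: "(\<Prod>j\<in>UNIV. \<bar>if j = i then \<epsilon> else sqrt \<epsilon>\<bar>) = \<epsilon> powr ((real ?n + 1) / 2)" .
  have "(\<integral>\<^sup>+y. f y \<partial>lborel) = (\<integral>\<^sup>+y. f (c + y) \<partial>lborel)"
    by (rule nn_integral_translate[symmetric]) simp
  also have "\<dots> = ennreal \<bar>det B\<bar> * (\<integral>\<^sup>+z. f (c + B *v z) \<partial>lborel)"
    by (rule nn_integral_matrix[symmetric, OF _ assms(2)]) simp
  also have "(\<integral>\<^sup>+z. f (c + B *v z) \<partial>lborel) = ennreal (\<epsilon> powr ((real ?n + 1) / 2)) *
      (\<integral>\<^sup>+z. f (c + B *v parabolic_scale i \<epsilon> z) \<partial>lborel)"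
    unfolding parabolic_scale_def p[symmetric] using \<epsilon>
    by (intro nn_integral_diagonal[symmetric, OF m]) auto
  finally show ?thesis by (simp add: ennreal_mult mult.assoc)
qed

text \<open>On this surface the first-order expansion does not decide membership in the rescaled
  body. It is null because each line in direction \<open>i\<close> meets it in a single
  point.\<close>

lemma paraboloid_boundary_null:
  fixes i :: "'n::finite"
  assumes "c \<noteq> 0"
  shows "AE z::real^'n in lborel. (\<Sum>j\<in>UNIV-{i}. (z$j)\<^sup>2) \<noteq> c * z$i"
proof -
  let ?S = "{z::real^'n. (\<Sum>j\<in>UNIV-{i}. (z$j)\<^sup>2) = c * z$i}"
  have [measurable]: "?S \<in> sets borel" by measurable
  have "emeasure lborel ?S = (\<integral>\<^sup>+z. indicator ?S z \<partial>lborel)" by simp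
  also have "\<dots> = (\<integral>\<^sup>+w. (\<integral>\<^sup>+s. indicator ?S (\<chi> j. if j = i then s else w j) \<partial>lborel) \<partial>Pi\<^sub>M (UNIV - {i}) (\<lambda>_. lborel))"
    by (rule nn_integral_vec_split) simp
  also have "\<dots> = (\<integral>\<^sup>+w. (\<integral>\<^sup>+s. indicator {(\<Sum>j\<in>UNIV-{i}. (w j)\<^sup>2) / c} s \<partial>lborel) \<partial>Pi\<^sub>M (UNIV - {i}) (\<lambda>_. lborel))"
    using assms by (intro nn_integral_cong) (auto simp: indicator_def field_simps)
  also have "\<dots> = 0" by simp
  finally have "?S \<in> null_sets lborel" by auto
  from AE_not_in[OF this] show ?thesis by eventually_elim simp
qed

text \<open>The tangential step is of order sqrt eps and enters quadratically, the normal step is of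
  order eps and enters linearly, so both contribute at order eps.\<close>

lemma parabolic_limit:
  fixes \<rho> :: "'n::finite vec \<Rightarrow> real"
  assumes U: "open U" "y0 \<in> U"
    and d1: "\<And>y. y \<in> U \<Longrightarrow> (\<rho> has_derivative (\<lambda>v. grad \<rho> y \<bullet> v)) (at y)"
    and d2: "(grad \<rho> has_derivative H) (at y0)"
    and G: "grad \<rho> y0 = g *\<^sub>R u" and \<rho>0: "\<rho> y0 = 0"
    and u: "u \<bullet> u = 1" and pu: "u \<bullet> p = 0"
  shows "((\<lambda>\<epsilon>. \<rho> (y0 + (sqrt \<epsilon> *\<^sub>R p - (\<epsilon> * \<sigma>) *\<^sub>R u)) / \<epsilon>) \<longlongrightarrow> (H p \<bullet> p) / 2 - g * \<sigma>) (at_right 0)"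
proof -
  interpret H: bounded_linear H using d2 by (rule has_derivative_bounded_linear)
  \<comment> \<open>The displacement equals sqrt eps times q, and q tends to p. The Taylor error is
    therefore at most a small multiple of eps times the bounded square of the norm of q.\<close>
  define q where "q = (\<lambda>\<epsilon>. p - (sqrt \<epsilon> * \<sigma>) *\<^sub>R u)"
  have sq: "((\<lambda>\<epsilon>::real. sqrt \<epsilon>) \<longlongrightarrow> 0) (at_right 0)"
    using tendsto_real_sqrt[OF tendsto_ident_at[of 0 "{0<..}"]] by simp
  have "(q \<longlongrightarrow> p - (0 * \<sigma>) *\<^sub>R u) (at_right 0)"
    unfolding q_def by (intro tendsto_intros sq)
  then have q: "(q \<longlongrightarrow> p) (at_right 0)" by simp
  have vq: "sqrt \<epsilon> *\<^sub>R p - (\<epsilon> * \<sigma>) *\<^sub>R u = sqrt \<epsilon> *\<^sub>R q \<epsilon>" if "\<epsilon> > 0" for \<epsilon>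
    using that by (simp add: q_def scaleR_diff_right flip: mult.assoc)
  have "((\<lambda>\<epsilon>. (H (q \<epsilon>) \<bullet> q \<epsilon>) / 2 - g * \<sigma>) \<longlongrightarrow> (H p \<bullet> p) / 2 - g * \<sigma>) (at_right 0)"
    by (intro tendsto_intros H.tendsto q) simp
  moreover have "((\<lambda>\<epsilon>. \<rho> (y0 + (sqrt \<epsilon> *\<^sub>R p - (\<epsilon> * \<sigma>) *\<^sub>R u)) / \<epsilon> - ((H (q \<epsilon>) \<bullet> q \<epsilon>) / 2 - g * \<sigma>)) \<longlongrightarrow> 0) (at_right 0)"
  proof (rule tendstoI)
    fix e :: real assume e: "e > 0"
    define Q where "Q = norm p + 1"
    have Q: "Q > 0" by (simp add: Q_def add_nonneg_pos)
    define e' where "e' = e / (2 * Q\<^sup>2)"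
    have e': "e' > 0" using e Q by (simp add: e'_def)
    obtain d where d: "d > 0"
      "\<And>v. norm v < d \<Longrightarrow> \<bar>\<rho> (y0 + v) - \<rho> y0 - grad \<rho> y0 \<bullet> v - (H v \<bullet> v) / 2\<bar> \<le> e' * (norm v)\<^sup>2"
      using taylor2_gradient[OF U d1 d2 e'] by blast
    have "((\<lambda>\<epsilon>. norm (q \<epsilon>)) \<longlongrightarrow> norm p) (at_right 0)" by (intro tendsto_norm q)
    then have ev1: "eventually (\<lambda>\<epsilon>. norm (q \<epsilon>) < Q) (at_right 0)"
      by (rule order_tendstoD) (simp add: Q_def)
    have "((\<lambda>\<epsilon>. norm (sqrt \<epsilon> *\<^sub>R q \<epsilon>)) \<longlongrightarrow> norm (0 *\<^sub>R p)) (at_right 0)" by (intro tendsto_norm tendsto_scaleR sq q)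
    then have ev2: "eventually (\<lambda>\<epsilon>. norm (sqrt \<epsilon> *\<^sub>R q \<epsilon>) < d) (at_right 0)"
      by (rule order_tendstoD) (use d in simp)
    show "eventually (\<lambda>\<epsilon>. dist (\<rho> (y0 + (sqrt \<epsilon> *\<^sub>R p - (\<epsilon> * \<sigma>) *\<^sub>R u)) / \<epsilon> - ((H (q \<epsilon>) \<bullet> q \<epsilon>) / 2 - g * \<sigma>)) 0 < e) (at_right 0)"
      using ev1 ev2 eventually_at_right_less[of 0]
    proof eventually_elim
      case (elim \<epsilon>)
      have \<epsilon>: "\<epsilon> > 0" using elim by simp
      let ?v = "sqrt \<epsilon> *\<^sub>R q \<epsilon>"
      have Gv: "grad \<rho> y0 \<bullet> ?v = - (\<epsilon> * (g * \<sigma>))"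
        unfolding vq[OF \<epsilon>, symmetric] G by (simp add: inner_diff_right pu u)
      have Hv: "H ?v \<bullet> ?v = \<epsilon> * (H (q \<epsilon>) \<bullet> q \<epsilon>)" using \<epsilon> by (simp add: H.scaleR flip: mult.assoc)
      have nv: "(norm ?v)\<^sup>2 = \<epsilon> * (norm (q \<epsilon>))\<^sup>2" using \<epsilon> by (simp add: power_mult_distrib)
      have "\<bar>\<rho> (y0 + ?v) / \<epsilon> - ((H (q \<epsilon>) \<bullet> q \<epsilon>) / 2 - g * \<sigma>)\<bar> = \<bar>\<rho> (y0 + ?v) - \<rho> y0 - grad \<rho> y0 \<bullet> ?v - (H ?v \<bullet> ?v) / 2\<bar> / \<epsilon>"
        unfolding Gv Hv \<rho>0 using \<epsilon> by (simp add: field_simps flip: abs_divide) (simp add: abs_divide)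
      also have "\<dots> \<le> e' * (norm ?v)\<^sup>2 / \<epsilon>" using d(2)[of ?v] elim \<epsilon> by (intro divide_right_mono) auto
      also have "\<dots> = e' * (norm (q \<epsilon>))\<^sup>2" unfolding nv using \<epsilon> by simp
      also have "\<dots> \<le> e' * Q\<^sup>2" using elim e' by (intro mult_left_mono power_mono) auto
      also have "\<dots> < e" using e Q by (simp add: e'_def)
      finally show ?case unfolding vq[OF \<epsilon>] by simp
    qed
  qed
  ultimately show ?thesis by (rule Lim_transform)
qed

context centred_body
begin

lemma polar_borel [measurable]: "polar K \<in> sets borel"
  using centred_body.compact[OF centred_body_polar] by (rule borel_compact)

text \<open>B only has to measure depth below the supporting hyperplane through its coordinate
  \<open>i\<close>. This leaves two uses: an orthogonal B for the uniform bound and a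
  curvature-adapted B for the limit.\<close>

lemma polar_integral_rescaled:
  fixes B :: "real^'n^'n" and i :: 'n and \<beta> :: real
  assumes xy: "x0 \<in> K" "y0 \<in> polar K" "x0 \<bullet> y0 = 1"
    and B: "det B \<noteq> 0" "\<And>z. x0 \<bullet> (B *v z) = - (a * z $ i)" and a: "a > 0" and \<epsilon>: "0 < \<epsilon>" "\<epsilon> < 1"
  shows "ennreal (\<epsilon> powr (\<beta> - (real CARD('n) + 1) / 2)) * polar_integral \<beta> K ((1 - \<epsilon>) *\<^sub>R x0) = ennreal \<bar>det B\<bar> *
    (\<integral>\<^sup>+z. indicator (polar K) (y0 + B *v parabolic_scale i \<epsilon> z) * ennreal ((1 + (1 - \<epsilon>) * a * z $ i) powr (-\<beta>)) \<partial>lborel)"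
proof -
  let ?p = "(real CARD('n) + 1) / 2"
  let ?E = "\<lambda>z. indicator (polar K) (y0 + B *v parabolic_scale i \<epsilon> z) * ennreal ((1 + (1 - \<epsilon>) * a * z $ i) powr (-\<beta>))"
  have [measurable]: "(\<lambda>z. parabolic_scale i \<epsilon> z) \<in> borel_measurable borel"
    unfolding parabolic_scale_def by (intro borel_measurable_continuous_onI continuous_intros)
  have pt: "indicator (polar K) y * ennreal ((1 - ((1 - \<epsilon>) *\<^sub>R x0) \<bullet> y) powr (-\<beta>)) = ennreal (\<epsilon> powr (-\<beta>)) * ?E z"
    if y: "y = y0 + B *v parabolic_scale i \<epsilon> z" for y z
  proof (cases "y \<in> polar K")
    case True
    have xy': "x0 \<bullet> y = 1 - a * (\<epsilon> * z $ i)"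
      unfolding y inner_add_right B(2) xy(3) by (simp add: parabolic_scale_def)
    \<comment> \<open>The factor 1 + (1 - eps) a z_i must be nonnegative before the power of the
      product can be split; points of the polar body guarantee this, all others have indicator
      0.\<close>
    then have "a * (\<epsilon> * z $ i) \<ge> 0" using inner_polar_le[OF xy(1) True] by simp
    then have z: "z $ i \<ge> 0" using a \<epsilon> by (simp add: zero_le_mult_iff)
    have "1 - ((1 - \<epsilon>) *\<^sub>R x0) \<bullet> y = \<epsilon> * (1 + (1 - \<epsilon>) * a * z $ i)"
      unfolding inner_scaleR_left xy' by (simp add: algebra_simps)
    moreover have "1 + (1 - \<epsilon>) * a * z $ i \<ge> 0" using z a \<epsilon> by simp
    ultimately show ?thesis using True \<epsilon> y by (simp add: powr_mult ennreal_mult)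
  qed (simp add: y)
  have "polar_integral \<beta> K ((1 - \<epsilon>) *\<^sub>R x0) = ennreal (\<bar>det B\<bar> * \<epsilon> powr ?p) * (\<integral>\<^sup>+z. ennreal (\<epsilon> powr (-\<beta>)) * ?E z \<partial>lborel)"
    unfolding polar_integral_def
    by (subst nn_integral_parabolic_scale[OF _ B(1) \<epsilon>(1), of _ y0 i]) (simp, subst pt[OF refl], simp)
  also have "\<dots> = ennreal (\<bar>det B\<bar> * \<epsilon> powr ?p) * (ennreal (\<epsilon> powr (-\<beta>)) * (\<integral>\<^sup>+z. ?E z \<partial>lborel))"
    by (subst nn_integral_cmult) auto
  finally have "ennreal (\<epsilon> powr (\<beta> - ?p)) * polar_integral \<beta> K ((1 - \<epsilon>) *\<^sub>R x0)
      = ennreal (\<epsilon> powr (\<beta> - ?p) * \<bar>det B\<bar> * \<epsilon> powr ?p * \<epsilon> powr (-\<beta>)) * (\<integral>\<^sup>+z. ?E z \<partial>lborel)"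
    by (simp add: ennreal_mult mult.assoc)
  also have "\<epsilon> powr (\<beta> - ?p) * \<bar>det B\<bar> * \<epsilon> powr ?p * \<epsilon> powr (-\<beta>) = \<bar>det B\<bar>"
  proof -
    have "\<epsilon> powr (\<beta> - ?p) * \<epsilon> powr ?p * \<epsilon> powr (-\<beta>) = 1"
      using \<epsilon> unfolding powr_add[symmetric] by simp
    then show ?thesis by (simp add: mult_ac)
  qed
  finally show ?thesis .
qed

end

context centred_body
begin

lemma dual_point:
  assumes "x0 \<in> frontier K"
  obtains y0 where "x0 \<in> K" "y0 \<in> polar K" "x0 \<bullet> y0 = 1"
proof -
  interpret L: centred_body "polar K" by (rule centred_body_polar)
  have "support_fun (polar K) x0 = 1" using assms frontier_eq by simp
  then obtain y0 where "y0 \<in> polar K" "x0 \<bullet> y0 = 1"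
    using support_fun_attained[OF L.compact L.nonempty] by metis
  moreover have "x0 \<in> K" using assms compact_imp_closed[OF compact] frontier_subset_closed by blast
  ultimately show ?thesis using that by blast
qed

text \<open>The quadratic estimate bounds the squared tangential displacement by a multiple of the
  depth. In rescaled coordinates both carry one factor eps, so the domain lies in a paraboloid
  independent of eps; \<open>\<epsilon> \<le> 1/2\<close> bounds the weight uniformly as
  well.\<close>

lemma rescaled_integrand_bound:
  fixes B :: "real^'n^'n" and i :: 'n and \<beta> :: real
  assumes C: "C > 0" "\<And>y. y \<in> polar K \<Longrightarrow> (norm (y - y0))\<^sup>2 \<le> C * (1 - x0 \<bullet> y)"
    and b: "b > 0" "\<And>z. b * (norm z)\<^sup>2 \<le> (norm (B *v z))\<^sup>2"
    and xy: "x0 \<bullet> y0 = 1" and B: "\<And>z. x0 \<bullet> (B *v z) = - (a * z $ i)" and a: "a > 0"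
    and \<epsilon>: "0 < \<epsilon>" "\<epsilon> \<le> 1/2" and \<beta>: "\<beta> > 0"
  shows "indicator (polar K) (y0 + B *v parabolic_scale i \<epsilon> z) * ennreal ((1 + (1 - \<epsilon>) * a * z $ i) powr (-\<beta>))
    \<le> indicator {z. (\<Sum>j\<in>UNIV-{i}. (z$j)\<^sup>2) \<le> C * a / b * z$i} z * ennreal ((1 + a / 2 * z$i) powr (-\<beta>))"
proof (cases "y0 + B *v parabolic_scale i \<epsilon> z \<in> polar K")
  case True
  let ?S = "\<Sum>j\<in>UNIV-{i}. (z$j)\<^sup>2"
  let ?d = "parabolic_scale i \<epsilon> z"
  have "(norm ?d)\<^sup>2 = (?d $ i)\<^sup>2 + (\<Sum>j\<in>UNIV-{i}. (?d $ j)\<^sup>2)"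
    unfolding power2_norm_eq_inner inner_vec_def by (subst sum.remove[of _ i]) (auto simp: power2_eq_square)
  also have "(\<Sum>j\<in>UNIV-{i}. (?d $ j)\<^sup>2) = \<epsilon> * ?S"
    unfolding sum_distrib_left using \<epsilon> by (intro sum.cong) (auto simp: parabolic_scale_def power_mult_distrib)
  finally have "\<epsilon> * ?S \<le> (norm ?d)\<^sup>2" by simp
  then have "b * (\<epsilon> * ?S) \<le> (norm (B *v ?d))\<^sup>2"
    using b(2)[of ?d] b(1) by (meson mult_left_mono order_trans less_imp_le)
  also have "\<dots> \<le> C * (1 - x0 \<bullet> (y0 + B *v ?d))" using C(2)[OF True] by simp
  also have "1 - x0 \<bullet> (y0 + B *v ?d) = a * (\<epsilon> * z $ i)"
    unfolding inner_add_right B xy by (simp add: parabolic_scale_def)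
  finally have "\<epsilon> * (b * ?S) \<le> \<epsilon> * (C * a * z $ i)" by (simp add: mult_ac)
  then have "b * ?S \<le> C * a * z $ i" using \<epsilon> by simp
  then have S: "?S \<le> C * a / b * z $ i" using b(1) by (simp add: field_simps)
  have "0 \<le> ?S" by (rule sum_nonneg) simp
  then have "0 \<le> C * a / b * z $ i" using S by linarith
  moreover have "C * a / b > 0" using C(1) a b(1) by simp
  ultimately have z: "z $ i \<ge> 0" by (metis linorder_not_le mult_pos_neg)
  have "a / 2 * z $ i \<le> (1 - \<epsilon>) * a * z $ i"
    using mult_right_mono[of "1/2" "1 - \<epsilon>" "a * z $ i"] \<epsilon> a z by simp
  then have "(1 + (1 - \<epsilon>) * a * z $ i) powr (-\<beta>) \<le> (1 + a / 2 * z $ i) powr (-\<beta>)"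
    using a z \<beta> by (intro powr_mono2') (auto simp: add_pos_nonneg)
  then show ?thesis using S True by (simp add: ennreal_leI)
qed simp

lemma polar_integral_le:
  assumes "x0 \<in> K" "0 < \<epsilon>" "\<epsilon> \<le> 1" "\<beta> > 0"
  shows "polar_integral \<beta> K ((1 - \<epsilon>) *\<^sub>R x0) \<le> ennreal (\<epsilon> powr (-\<beta>) * measure lborel (polar K))"
proof -
  have "polar_integral \<beta> K ((1 - \<epsilon>) *\<^sub>R x0) \<le> (\<integral>\<^sup>+y. ennreal (\<epsilon> powr (-\<beta>)) * indicator (polar K) y \<partial>lborel)"
    unfolding polar_integral_def
  proof (intro nn_integral_mono)
    fix y :: "'n vec"
    show "indicator (polar K) y * ennreal ((1 - ((1 - \<epsilon>) *\<^sub>R x0) \<bullet> y) powr (-\<beta>)) \<le> ennreal (\<epsilon> powr (-\<beta>)) * indicator (polar K) y"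
    proof (cases "y \<in> polar K")
      case True
      have "(1 - \<epsilon>) * (x0 \<bullet> y) \<le> 1 - \<epsilon>"
        using mult_left_mono[OF inner_polar_le[OF assms(1) True], of "1 - \<epsilon>"] assms by simp
      then have "(1 - ((1 - \<epsilon>) *\<^sub>R x0) \<bullet> y) powr (-\<beta>) \<le> \<epsilon> powr (-\<beta>)"
        using assms by (intro powr_mono2') auto
      then show ?thesis using True by (simp add: ennreal_leI)
    qed simp
  qed
  also have "\<dots> = ennreal (\<epsilon> powr (-\<beta>)) * emeasure lborel (polar K)"
    by (subst nn_integral_cmult_indicator) auto
  also have "emeasure lborel (polar K) = ennreal (measure lborel (polar K))"
    using emeasure_compact_finite[OF centred_body.compact[OF centred_body_polar]]
    by (intro emeasure_eq_ennreal_measure) auto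
  finally show ?thesis by (simp add: ennreal_mult)
qed

end

section \<open>Uniform growth bound for the polar integral\<close>

context C2_body
begin

text \<open>An orthogonal B removes all dependence on curvature from the dominating integral, so it
  varies with \<open>x0\<close> only through the norm of \<open>x0\<close>, which is bounded below
  by the inradius about 0.\<close>

lemma polar_integral_bound:
  assumes \<beta>: "\<beta> > (real CARD('n) + 1) / 2"
  obtains M where "M > 0"
    "\<And>x0 \<epsilon>. x0 \<in> frontier K \<Longrightarrow> 0 < \<epsilon> \<Longrightarrow> \<epsilon> \<le> 1 \<Longrightarrow>
      polar_integral \<beta> K ((1 - \<epsilon>) *\<^sub>R x0) \<le> ennreal (M * \<epsilon> powr (-(\<beta> - (real CARD('n) + 1) / 2)))"
proof -
  define p where "p = (real CARD('n) + 1) / 2"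
  have n1: "CARD('n) \<ge> 1" by (simp add: Suc_le_eq card_gt_0_iff)
  have p: "p \<ge> 1" "p > 0" using n1 by (auto simp: p_def)
  have \<beta>p: "\<beta> > p" using \<beta> by (simp add: p_def)
  obtain C where C: "C > 0"
    "\<And>x y0 y. x \<in> K \<Longrightarrow> y0 \<in> polar K \<Longrightarrow> y \<in> polar K \<Longrightarrow> x \<bullet> y0 = 1 \<Longrightarrow> (norm (y - y0))\<^sup>2 \<le> C * (1 - x \<bullet> y)"
    using polar_quadratic_estimate by blast
  obtain r where r: "r > 0" "ball 0 r \<subseteq> K" using interior0 mem_interior by blast
  have "ball 0 r \<subseteq> interior K" using r(2) by (simp add: interior_maximal)
  then have rx: "norm x0 \<ge> r" if "x0 \<in> frontier K" for x0
    using that by (force simp: frontier_def subset_iff)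
  \<comment> \<open>\<open>F a\<close> is the value of the dominating paraboloid integral for a
    boundary point of norm a. The powers of a combine to 1/a, so a lower bound r for a gives the
    bound \<open>M1\<close>.\<close>
  define F where "F = (\<lambda>a::real. unit_ball_vol (real CARD('n) - 1) * (C * a) powr (p - 1) * (a / 2) powr (-p) * Beta p (\<beta> - p))"
  define M1 where "M1 = unit_ball_vol (real CARD('n) - 1) * C powr (p - 1) * 2 powr p * Beta p (\<beta> - p) / r"
  \<comment> \<open>\<open>M1\<close> covers eps up to 1/2; the second summand covers the remaining
    range through the crude bound \<open>polar_integral_le\<close>.\<close>
  define M where "M = M1 + 2 powr \<beta> * measure lborel (polar K)"
  have v: "unit_ball_vol (real CARD('n) - 1) > 0" using n1 by simp
  have Bt: "Beta p (\<beta> - p) > 0" using p \<beta>p by (simp add: Beta_def Gamma_real_pos)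
  have M1: "M1 > 0" unfolding M1_def using v Bt C r by simp
  then have M: "M > 0" unfolding M_def by (simp add: add_pos_nonneg)
  have FM: "F a \<le> M1" if "a \<ge> r" for a
  proof -
    have a: "a > 0" using that r by simp
    have "(C * a) powr (p - 1) * (a / 2) powr (-p) = C powr (p - 1) * 2 powr p * (a powr (p - 1) * a powr (-p))"
      using a C by (simp add: powr_mult powr_divide powr_minus field_simps)
    also have "a powr (p - 1) * a powr (-p) = 1 / a" using a unfolding powr_add[symmetric] by (simp add: powr_minus_divide)
    also have "1 / a \<le> 1 / r" using that r by (simp add: frac_le)
    finally have "(C * a) powr (p - 1) * (a / 2) powr (-p) \<le> C powr (p - 1) * 2 powr p * (1 / r)"
      by (simp add: mult_left_mono)
    then have "unit_ball_vol (real CARD('n) - 1) * ((C * a) powr (p - 1) * (a / 2) powr (-p)) * Beta p (\<beta> - p)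
       \<le> unit_ball_vol (real CARD('n) - 1) * (C powr (p - 1) * 2 powr p * (1 / r)) * Beta p (\<beta> - p)"
      using v Bt by (intro mult_right_mono mult_left_mono) auto
    then show ?thesis by (simp add: F_def M1_def mult_ac)
  qed
  show ?thesis
  proof (rule that[OF M])
    fix x0 \<epsilon> assume x0: "x0 \<in> frontier K" and \<epsilon>: "0 < (\<epsilon>::real)" "\<epsilon> \<le> 1"
    obtain y0 where xy: "x0 \<in> K" "y0 \<in> polar K" "x0 \<bullet> y0 = 1" using dual_point[OF x0] by blast
    have "polar_integral \<beta> K ((1 - \<epsilon>) *\<^sub>R x0) \<le> ennreal (M * \<epsilon> powr (-(\<beta> - p)))"
    proof (cases "\<epsilon> \<le> 1/2")
      case True
      define a where "a = norm x0"
      have a: "a \<ge> r" "a > 0" using rx[OF x0] r by (auto simp: a_def)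
      \<comment> \<open>Any index may serve as the normal coordinate.\<close>
      define i :: 'n where "i = undefined"
      obtain B :: "real^'n^'n" where B: "B *v axis i 1 = - sgn x0"
        "\<And>v w. (B *v v) \<bullet> (mat 1 *v (B *v w)) = v \<bullet> w" "det (mat 1 :: real^'n^'n) * (det B)\<^sup>2 = 1"
        by (rule matrix_orthonormal_wrt_form[of "mat 1" "- sgn x0" i])
          (use a in \<open>auto simp: inner_gt_zero_iff norm_sgn a_def simp flip: power2_norm_eq_inner\<close>)
      have nB: "norm (B *v z) = norm z" for z using B(2)[of z z] by (simp add: norm_eq_sqrt_inner)
      have dB: "\<bar>det B\<bar> = 1" using B(3) by (simp add: abs_square_eq_1)
      have xB: "x0 \<bullet> (B *v z) = - (a * z $ i)" for z
      proof -
        have "x0 = (- a) *\<^sub>R (B *v axis i 1)" using a by (simp add: B(1) a_def sgn_div_norm)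
        then have "x0 \<bullet> (B *v z) = (- a) * ((B *v axis i 1) \<bullet> (B *v z))" by (metis inner_scaleR_left)
        also have "(B *v axis i 1) \<bullet> (B *v z) = z $ i" using B(2)[of "axis i 1" z] by (simp add: inner_axis')
        finally show ?thesis by simp
      qed
      have "ennreal (\<epsilon> powr (\<beta> - p)) * polar_integral \<beta> K ((1 - \<epsilon>) *\<^sub>R x0)
        = (\<integral>\<^sup>+z. indicator (polar K) (y0 + B *v parabolic_scale i \<epsilon> z) * ennreal ((1 + (1 - \<epsilon>) * a * z $ i) powr (-\<beta>)) \<partial>lborel)"
        using polar_integral_rescaled[OF xy _ xB a(2) \<epsilon>(1), of \<beta>] dB True by (auto simp: p_def)
      also have "\<dots> \<le> (\<integral>\<^sup>+z. indicator {z. (\<Sum>j\<in>UNIV-{i}. (z$j)\<^sup>2) \<le> C * a / 1 * z$i} z * ennreal ((1 + a / 2 * z$i) powr (-\<beta>)) \<partial>lborel)"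
        using C xy xB a \<epsilon> True \<beta>p p by (intro nn_integral_mono rescaled_integrand_bound[of C y0 x0 1 B a i \<epsilon> \<beta>]) (auto simp: nB)
      also have "\<dots> = ennreal (F a)"
        using nn_integral_paraboloid[of "C * a" "a / 2" \<beta> i] C a \<beta> by (simp add: F_def p_def field_simps)
      also have "\<dots> \<le> ennreal M1" using FM[OF a(1)] by (rule ennreal_leI)
      finally have le: "ennreal (\<epsilon> powr (\<beta> - p)) * polar_integral \<beta> K ((1 - \<epsilon>) *\<^sub>R x0) \<le> ennreal M1" .
      have "polar_integral \<beta> K ((1 - \<epsilon>) *\<^sub>R x0) = ennreal (\<epsilon> powr (-(\<beta> - p)) * \<epsilon> powr (\<beta> - p)) * polar_integral \<beta> K ((1 - \<epsilon>) *\<^sub>R x0)"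
        using \<epsilon> unfolding powr_add[symmetric] by simp
      also have "\<dots> = ennreal (\<epsilon> powr (-(\<beta> - p))) * (ennreal (\<epsilon> powr (\<beta> - p)) * polar_integral \<beta> K ((1 - \<epsilon>) *\<^sub>R x0))"
        by (simp add: ennreal_mult mult.assoc)
      also have "\<dots> \<le> ennreal (\<epsilon> powr (-(\<beta> - p))) * ennreal M1" by (intro mult_left_mono le) simp
      also have "\<dots> = ennreal (M1 * \<epsilon> powr (-(\<beta> - p)))" using M1 by (simp add: ennreal_mult mult.commute)
      also have "\<dots> \<le> ennreal (M * \<epsilon> powr (-(\<beta> - p)))" by (intro ennreal_leI mult_right_mono) (auto simp: M_def)
      finally show ?thesis .
    next
      case False
      have "\<epsilon> powr (-\<beta>) \<le> (1/2) powr (-\<beta>)" using False \<beta>p p by (intro powr_mono2') auto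
      also have "(1/2) powr (-\<beta>) = 2 powr \<beta>" by (simp add: powr_divide powr_minus)
      finally have "\<epsilon> powr (-\<beta>) * measure lborel (polar K) \<le> 2 powr \<beta> * measure lborel (polar K)"
        by (simp add: mult_right_mono)
      also have "\<dots> \<le> M * 1" using M1 by (simp add: M_def)
      also have "\<dots> \<le> M * \<epsilon> powr (-(\<beta> - p))"
      proof (intro mult_left_mono)
        have "1 powr (-(\<beta> - p)) \<le> \<epsilon> powr (-(\<beta> - p))" using \<epsilon> \<beta>p by (intro powr_mono2') auto
        then show "1 \<le> \<epsilon> powr (-(\<beta> - p))" by simp
      qed (use M in simp)
      finally have le: "\<epsilon> powr (-\<beta>) * measure lborel (polar K) \<le> M * \<epsilon> powr (-(\<beta> - p))" .
      have "\<beta> > 0" using \<beta>p p by simp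
      from order_trans[OF polar_integral_le[OF xy(1) \<epsilon> this] ennreal_leI[OF le]] show ?thesis .
    qed
    then show "polar_integral \<beta> K ((1 - \<epsilon>) *\<^sub>R x0) \<le> ennreal (M * \<epsilon> powr (-(\<beta> - (real CARD('n) + 1) / 2)))"
      by (simp add: p_def)
  qed
qed

end

section \<open>Local shape of the polar body and the pointwise asymptotics\<close>

locale dual_C2_body = C2_body K for K :: "'n::finite vec set" +
  assumes polar_C2: "\<And>y. y \<in> frontier (polar K) \<Longrightarrow> \<exists>U \<rho>. local_defining_fun (polar K) y U \<rho> \<and> C2_on U \<rho>"
begin

text \<open>The last claim holds because \<rho> divided by eps tends, along the parabolic curve, to
  a positive multiple of the difference of the two sides; off equality its sign is eventually
  constant. This claim also gives positive definiteness, by comparison with the quadratic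
  estimate.\<close>

lemma weingarten_polar:
  assumes xy: "x0 \<in> K" "y0 \<in> polar K" "x0 \<bullet> y0 = 1"
    and \<rho>: "local_defining_fun (polar K) y0 U \<rho>" "C2_on U \<rho>"
  defines "A \<equiv> weingarten \<rho> y0" and "u \<equiv> sgn x0"
  shows "\<And>v w. v \<bullet> (A *v w) = (A *v v) \<bullet> w" "\<And>v. v \<noteq> 0 \<Longrightarrow> v \<bullet> (A *v v) > 0" "A *v u = u"
    and "\<And>p \<sigma>. u \<bullet> p = 0 \<Longrightarrow> (p \<bullet> (A *v p)) / 2 \<noteq> \<sigma> \<Longrightarrow>
      eventually (\<lambda>\<epsilon>. y0 + (sqrt \<epsilon> *\<^sub>R p - (\<epsilon> * \<sigma>) *\<^sub>R u) \<in> polar K \<longleftrightarrow> (p \<bullet> (A *v p)) / 2 \<le> \<sigma>) (at_right 0)"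
proof -
  interpret L: centred_body "polar K" by (rule centred_body_polar)
  have y0f: "y0 \<in> frontier (polar K)" using contact_frontier[OF xy] by blast
  have x0L: "x0 \<in> polar (polar K)" using xy polar_polar by simp
  have U: "open U" "y0 \<in> U" "polar K \<inter> U = {y\<in>U. \<rho> y \<le> 0}" "\<And>y. y \<in> U \<Longrightarrow> grad \<rho> y \<noteq> 0"
    using \<rho>(1) by (auto simp: local_defining_fun_def)
  obtain H where H: "\<And>y. y \<in> U \<Longrightarrow> (\<rho> has_derivative (\<lambda>v. grad \<rho> y \<bullet> v)) (at y)"
    "\<And>y. y \<in> U \<Longrightarrow> (grad \<rho> has_derivative blinfun_apply (H y)) (at y)"
    "continuous_on U H"
    using C2_on_gradE[OF \<rho>(2) U(1)] by metis
  have \<rho>0: "\<rho> y0 = 0"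
    by (rule L.defining_fun_frontier[OF \<rho>(1) y0f]) (rule has_derivative_continuous[OF H(1)[OF U(2)]])
  define g where "g = norm (grad \<rho> y0)"
  have g: "g > 0" using U(2,4) by (simp add: g_def)
  have x00: "x0 \<noteq> 0" using xy(3) by auto
  have uu: "u \<bullet> u = 1" using x00 by (simp add: u_def norm_sgn flip: power2_norm_eq_inner)
  \<comment> \<open>By the bipolar theorem x0 is a dual point of \<open>y0\<close>, so a ball
    inscribed in the polar body at \<open>y0\<close> forces x0 to be parallel to the
    gradient.\<close>
  have "u = sgn (grad \<rho> y0)"
  proof -
    obtain r s0 where "r > 0" "s0 > 0"
      "\<And>x s. x \<in> polar K \<inter> ball y0 r \<Longrightarrow> 0 < s \<Longrightarrow> s \<le> s0 \<Longrightarrow> cball (x - s *\<^sub>R sgn (grad \<rho> x)) s \<subseteq> polar K \<and> grad \<rho> x \<noteq> 0"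
      using L.local_inner_ball[OF \<rho>] by blast
    then have "cball (y0 - s0 *\<^sub>R sgn (grad \<rho> y0)) s0 \<subseteq> polar K" "norm (sgn (grad \<rho> y0)) = 1"
      using xy(2) g by (auto simp: norm_sgn g_def)
    from L.inner_ball_normal[OF this(2) \<open>s0 > 0\<close> this(1) x0L] xy(3)
    have "x0 = norm x0 *\<^sub>R sgn (grad \<rho> y0)" by (simp add: inner_commute)
    then have "u = (1 / norm x0) *\<^sub>R (norm x0 *\<^sub>R sgn (grad \<rho> y0))" unfolding u_def sgn_div_norm by (simp add: divide_inverse)
    then show ?thesis using x00 by simp
  qed
  then have ug: "(1 / norm (grad \<rho> y0)) *\<^sub>R grad \<rho> y0 = u" and Gu: "grad \<rho> y0 = g *\<^sub>R u"
    using g by (auto simp: sgn_div_norm divide_inverse g_def)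
  define P where "P = (\<lambda>v. v - (u \<bullet> v) *\<^sub>R u)"
  have A: "A *v w = (1 / g) *\<^sub>R P (H y0 (P w)) + (u \<bullet> w) *\<^sub>R u" for w
    unfolding A_def P_def using weingarten_mult[OF H(2)[OF U(2)] U(4)[OF U(2)]] by (simp add: ug g_def)
  have Psym: "v \<bullet> P w = P v \<bullet> w" for v w by (simp add: P_def inner_diff_left inner_diff_right inner_commute)
  have Hsym: "H y0 v \<bullet> w = H y0 w \<bullet> v" for v w
    by (rule gradient_derivative_symmetric[where U = U and f = \<rho> and G = "grad \<rho>" and x = y0]) (use U H in auto)
  have form: "v \<bullet> (A *v w) = (1 / g) * (H y0 (P w) \<bullet> P v) + (u \<bullet> v) * (u \<bullet> w)" for v w
    unfolding A by (simp add: inner_add_right Psym inner_commute)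
  show sym: "v \<bullet> (A *v w) = (A *v v) \<bullet> w" for v w
    by (subst (2) inner_commute) (simp add: form Hsym[of "P w"] mult.commute)
  have Pu: "P u = 0" by (simp add: P_def uu)
  show "A *v u = u" unfolding A Pu by (simp add: P_def uu)
  have tang: "p \<bullet> (A *v p) = (H y0 p \<bullet> p) / g" if "u \<bullet> p = 0" for p
    using that by (simp add: form P_def)
  show ev: "eventually (\<lambda>\<epsilon>. y0 + (sqrt \<epsilon> *\<^sub>R p - (\<epsilon> * \<sigma>) *\<^sub>R u) \<in> polar K \<longleftrightarrow> (p \<bullet> (A *v p)) / 2 \<le> \<sigma>) (at_right 0)"
    if p: "u \<bullet> p = 0" and ne: "(p \<bullet> (A *v p)) / 2 \<noteq> \<sigma>" for p \<sigma>
  proof -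
    let ?y = "\<lambda>\<epsilon>. y0 + (sqrt \<epsilon> *\<^sub>R p - (\<epsilon> * \<sigma>) *\<^sub>R u)"
    define l where "l = (H y0 p \<bullet> p) / 2 - g * \<sigma>"
    have l: "l = g * ((p \<bullet> (A *v p)) / 2 - \<sigma>)" using g by (simp add: l_def tang[OF p] field_simps)
    have lim: "((\<lambda>\<epsilon>. \<rho> (?y \<epsilon>) / \<epsilon>) \<longlongrightarrow> l) (at_right 0)"
      unfolding l_def by (rule parabolic_limit[OF U(1,2) H(1) H(2)[OF U(2)] Gu \<rho>0 uu p])
    have id: "((\<lambda>\<epsilon>::real. \<epsilon>) \<longlongrightarrow> 0) (at_right 0)" by (rule tendsto_ident_at)
    have sq: "((\<lambda>\<epsilon>::real. sqrt \<epsilon>) \<longlongrightarrow> 0) (at_right 0)"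
      using tendsto_real_sqrt[OF id] by simp
    have "(?y \<longlongrightarrow> y0 + (0 *\<^sub>R p - (0 * \<sigma>) *\<^sub>R u)) (at_right 0)"
      by (intro tendsto_intros sq id)
    then have "(?y \<longlongrightarrow> y0) (at_right 0)" by simp
    then have evU: "eventually (\<lambda>\<epsilon>. ?y \<epsilon> \<in> U) (at_right 0)" using U(1,2) by (rule topological_tendstoD)
    have mem: "?y \<epsilon> \<in> polar K \<longleftrightarrow> \<rho> (?y \<epsilon>) \<le> 0" if "?y \<epsilon> \<in> U" for \<epsilon>
      using U(3) that by blast
    show ?thesis
    proof (cases "(p \<bullet> (A *v p)) / 2 < \<sigma>")
      case True
      then have "l < 0" using g by (simp add: l mult_less_0_iff)
      from order_tendstoD(2)[OF lim this] evU eventually_at_right_less[of 0] show ?thesis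
      proof eventually_elim
        case (elim \<epsilon>)
        then have "\<rho> (?y \<epsilon>) \<le> 0" by (simp add: divide_less_0_iff)
        then show ?case using mem[of \<epsilon>] elim True by simp
      qed
    next
      case False
      then have "l > 0" using g ne by (simp add: l)
      from order_tendstoD(1)[OF lim this] evU eventually_at_right_less[of 0] show ?thesis
      proof eventually_elim
        case (elim \<epsilon>)
        then have "\<not> \<rho> (?y \<epsilon>) \<le> 0" by (simp add: zero_less_divide_iff)
        then show ?case using mem[of \<epsilon>] elim False ne by simp
      qed
    qed
  qed
  have pos_tang: "p \<bullet> (A *v p) > 0" if p: "u \<bullet> p = 0" "p \<noteq> 0" for p
  proof (rule ccontr)
    assume "\<not> p \<bullet> (A *v p) > 0"
    then have np: "p \<bullet> (A *v p) \<le> 0" by simp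
    obtain C where C: "C > 0"
      "\<And>x y0 y. x \<in> K \<Longrightarrow> y0 \<in> polar K \<Longrightarrow> y \<in> polar K \<Longrightarrow> x \<bullet> y0 = 1 \<Longrightarrow> (norm (y - y0))\<^sup>2 \<le> C * (1 - x \<bullet> y)"
      using polar_quadratic_estimate by blast
    define a where "a = norm x0"
    have a: "a > 0" using x00 by (simp add: a_def)
    have x0u: "x0 = a *\<^sub>R u" using x00 by (simp add: a_def u_def sgn_div_norm)
    \<comment> \<open>If the form were not positive on p, this curve would enter the polar body. The
      quadratic estimate allows a squared displacement of at most C a eps \<sigma>, and \<sigma> is
      chosen to make this half of eps times the square of the norm of p.\<close>
    define \<sigma> where "\<sigma> = (norm p)\<^sup>2 / (2 * C * a)"
    have \<sigma>: "\<sigma> > 0" using p C a by (simp add: \<sigma>_def)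
    have "(p \<bullet> (A *v p)) / 2 \<noteq> \<sigma>" using np \<sigma> by simp
    from ev[OF p(1) this] eventually_at_right_less[of 0]
    have "eventually (\<lambda>\<epsilon>. y0 + (sqrt \<epsilon> *\<^sub>R p - (\<epsilon> * \<sigma>) *\<^sub>R u) \<in> polar K \<and> 0 < \<epsilon>) (at_right 0)"
      by eventually_elim (use np \<sigma> in auto)
    then obtain \<epsilon> where \<epsilon>: "\<epsilon> > 0" "y0 + (sqrt \<epsilon> *\<^sub>R p - (\<epsilon> * \<sigma>) *\<^sub>R u) \<in> polar K"
      using eventually_happens'[OF trivial_limit_at_right_real] by blast
    let ?v = "sqrt \<epsilon> *\<^sub>R p - (\<epsilon> * \<sigma>) *\<^sub>R u"
    have pu: "p \<bullet> u = 0" using p(1) by (simp add: inner_commute)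
    have "(norm ?v)\<^sup>2 = \<epsilon> * (norm p)\<^sup>2 + (\<epsilon> * \<sigma>)\<^sup>2"
      unfolding power2_norm_eq_inner inner_diff_left inner_diff_right inner_scaleR_left inner_scaleR_right p(1) pu uu
      using \<epsilon>(1) by (simp add: power2_eq_square flip: mult.assoc)
    moreover have "(norm ?v)\<^sup>2 \<le> C * (1 - x0 \<bullet> (y0 + ?v))" using C(2)[OF xy(1,2) \<epsilon>(2) xy(3)] by simp
    moreover have "1 - x0 \<bullet> (y0 + ?v) = a * \<epsilon> * \<sigma>"
      unfolding inner_add_right xy(3) using p(1) uu by (simp add: x0u inner_diff_right)
    moreover have "C * (a * \<epsilon> * \<sigma>) = \<epsilon> * (norm p)\<^sup>2 / 2" using C a by (simp add: \<sigma>_def)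
    ultimately have "\<epsilon> * (norm p)\<^sup>2 + (\<epsilon> * \<sigma>)\<^sup>2 \<le> \<epsilon> * (norm p)\<^sup>2 / 2" by simp
    moreover have "\<epsilon> * (norm p)\<^sup>2 > 0" "(\<epsilon> * \<sigma>)\<^sup>2 \<ge> 0" using \<epsilon> p by auto
    ultimately show False by linarith
  qed
  show "v \<bullet> (A *v v) > 0" if "v \<noteq> 0" for v
  proof -
    have uPv: "u \<bullet> P v = 0" by (simp add: P_def inner_diff_right uu)
    have "v \<bullet> (A *v v) = P v \<bullet> (A *v P v) + (u \<bullet> v)\<^sup>2"
      unfolding form using uPv by (simp add: P_def power2_eq_square)
    moreover have "P v \<bullet> (A *v P v) \<ge> 0" "P v \<noteq> 0 \<Longrightarrow> P v \<bullet> (A *v P v) > 0"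
      using pos_tang[OF uPv] by (cases "P v = 0"; simp)+
    moreover have "u \<bullet> v \<noteq> 0" if "P v = 0" using that \<open>v \<noteq> 0\<close> by (auto simp: P_def)
    ultimately show ?thesis by (cases "P v = 0") (auto intro: add_pos_nonneg)
  qed
qed

text \<open>In coordinates orthonormal for A the limiting paraboloid is the same at every boundary
  point, so its integral depends on \<open>x0\<close> only through the norm of \<open>x0\<close>;
  the curvature enters solely through |det B|.\<close>

lemma polar_integral_asymptotics:
  assumes xy: "x0 \<in> K" "y0 \<in> polar K" "x0 \<bullet> y0 = 1" and \<beta>: "\<beta> > (real CARD('n) + 1) / 2"
  shows "gauss_curvature (polar K) y0 > 0"
    and "((\<lambda>\<epsilon>. ennreal (\<epsilon> powr (\<beta> - (real CARD('n) + 1) / 2)) * polar_integral \<beta> K ((1 - \<epsilon>) *\<^sub>R x0))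
      \<longlongrightarrow> ennreal (c_const CARD('n) \<beta> * (sqrt (1 / gauss_curvature (polar K) y0) * norm x0 powr (-((real CARD('n) + 1) / 2))))) (at_right 0)"
proof -
  interpret L: centred_body "polar K" by (rule centred_body_polar)
  define n where "n = CARD('n)"
  have n1: "n \<ge> 1" by (simp add: n_def Suc_le_eq card_gt_0_iff)
  have y0f: "y0 \<in> frontier (polar K)" using contact_frontier[OF xy] by blast
  obtain U \<rho> where \<rho>: "local_defining_fun (polar K) y0 U \<rho>" "C2_on U \<rho>"
    and \<kappa>: "gauss_curvature (polar K) y0 = det (weingarten \<rho> y0)"
    using gauss_curvature_weingarten[OF polar_C2[OF y0f]] by metis
  define A where "A = weingarten \<rho> y0"
  define u where "u = sgn x0"
  define a where "a = norm x0"
  note W = weingarten_polar[OF xy \<rho>, folded A_def u_def]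
  have x00: "x0 \<noteq> 0" using xy(3) by auto
  have a: "a > 0" using x00 by (simp add: a_def)
  have uu: "u \<bullet> u = 1" using x00 by (simp add: u_def norm_sgn flip: power2_norm_eq_inner)
  have x0u: "x0 = a *\<^sub>R u" using x00 by (simp add: a_def u_def sgn_div_norm)
  have Au: "A *v (- u) = - u" using W(3) matrix_vector_mult_scaleR[of A "-1" u] by simp
  define i :: 'n where "i = undefined"
  obtain B :: "real^'n^'n" where B: "B *v axis i 1 = - u"
    "\<And>v w. (B *v v) \<bullet> (A *v (B *v w)) = v \<bullet> w" "det A * (det B)\<^sup>2 = 1"
    by (rule matrix_orthonormal_wrt_form[OF W(1,2), of "- u" i]) (simp_all add: Au uu)
  have dB: "det B \<noteq> 0" using B(3) by auto
  have "(det B)\<^sup>2 > 0" using dB by simp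
  then have dA: "det A > 0" using B(3) by (metis zero_less_mult_pos2 zero_less_one)
  then show "gauss_curvature (polar K) y0 > 0" by (simp add: \<kappa> A_def)
  have "(det B)\<^sup>2 = 1 / det A" using B(3) dA by (simp add: field_simps)
  then have dBk: "\<bar>det B\<bar> = sqrt (1 / det A)" by (metis real_sqrt_abs)
  have uB: "u \<bullet> (B *v z) = - (z $ i)" for z
  proof -
    have "(B *v axis i 1) \<bullet> (A *v (B *v z)) = z $ i" using B(2)[of "axis i 1" z] by (simp add: inner_axis')
    moreover have "(B *v axis i 1) \<bullet> (A *v (B *v z)) = (A *v (- u)) \<bullet> (B *v z)" unfolding B(1) by (rule W(1))
    ultimately show ?thesis by (simp add: Au)
  qed
  have xB: "x0 \<bullet> (B *v z) = - (a * z $ i)" for z by (simp add: x0u uB)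
  obtain C where C: "C > 0" "\<And>y. y \<in> polar K \<Longrightarrow> (norm (y - y0))\<^sup>2 \<le> C * (1 - x0 \<bullet> y)"
    using polar_quadratic_estimate xy by metis
  \<comment> \<open>The square of |z| equals the form evaluated at \<open>B *v z\<close>, so the
    operator norm of A bounds B from below; the summand 1 keeps the denominator positive.\<close>
  define b where "b = 1 / (onorm ((*v) A) + 1)"
  have on: "onorm ((*v) A) + 1 > 0" using onorm_pos_le[of "(*v) A"] by (simp add: add_nonneg_pos)
  have b: "b > 0" "b * (norm z)\<^sup>2 \<le> (norm (B *v z))\<^sup>2" for z
  proof -
    show "b > 0" using on by (simp add: b_def)
    have "(norm z)\<^sup>2 = (B *v z) \<bullet> (A *v (B *v z))" by (simp add: B(2) power2_norm_eq_inner)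
    also have "\<dots> \<le> norm (B *v z) * norm (A *v (B *v z))" by (rule norm_cauchy_schwarz)
    also have "\<dots> \<le> norm (B *v z) * (onorm ((*v) A) * norm (B *v z))"
      by (intro mult_left_mono onorm) auto
    also have "\<dots> \<le> (onorm ((*v) A) + 1) * (norm (B *v z))\<^sup>2" by (simp add: power2_eq_square algebra_simps)
    finally show "b * (norm z)\<^sup>2 \<le> (norm (B *v z))\<^sup>2" using on by (simp add: b_def field_simps)
  qed
  define E where "E = (\<lambda>\<epsilon> z. indicator (polar K) (y0 + B *v parabolic_scale i \<epsilon> z) * ennreal ((1 + (1 - \<epsilon>) * a * z $ i) powr (-\<beta>)))"
  define S where "S = (\<lambda>z::'n vec. \<Sum>j\<in>UNIV-{i}. (z$j)\<^sup>2)"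
  define E0 where "E0 = (\<lambda>z. indicator {z. S z \<le> 2 * z$i} z * ennreal ((1 + a * z $ i) powr (-\<beta>)))"
  have mE [measurable]: "E \<epsilon> \<in> borel_measurable lborel" for \<epsilon>
  proof -
    have [measurable]: "(\<lambda>z. parabolic_scale i \<epsilon> z) \<in> borel_measurable borel"
      unfolding parabolic_scale_def by (intro borel_measurable_continuous_onI continuous_intros)
    show ?thesis unfolding E_def by measurable
  qed
  have [measurable]: "S \<in> borel_measurable borel" unfolding S_def by measurable
  have mE0 [measurable]: "E0 \<in> borel_measurable lborel" unfolding E0_def by measurable
  have pt: "((\<lambda>\<epsilon>. E \<epsilon> z) \<longlongrightarrow> E0 z) (at_right 0)" if z: "S z \<noteq> 2 * z $ i" for z
  proof -
    \<comment> \<open>z is split into a part that B maps to the tangent space and its component on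
      axis \<open>i\<close>, which B maps to the inner normal; the scaling then produces exactly the
      curve of \<open>weingarten_polar\<close>.\<close>
    define z' where "z' = (\<chi> j. if j = i then 0 else z $ j)"
    define p where "p = B *v z'"
    have "u \<bullet> p = 0" unfolding p_def uB by (simp add: z'_def)
    have "p \<bullet> (A *v p) = z' \<bullet> z'" unfolding p_def by (rule B(2))
    also have "\<dots> = S z"
      unfolding inner_vec_def S_def by (subst sum.remove[of _ i]) (auto simp: z'_def power2_eq_square)
    finally have pA: "p \<bullet> (A *v p) = S z" .
    have dec: "B *v parabolic_scale i \<epsilon> z = sqrt \<epsilon> *\<^sub>R p - (\<epsilon> * z $ i) *\<^sub>R u" for \<epsilon>
    proof -
      have "parabolic_scale i \<epsilon> z = sqrt \<epsilon> *\<^sub>R z' + (\<epsilon> * z $ i) *\<^sub>R axis i 1"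
        by (simp add: parabolic_scale_def z'_def vec_eq_iff axis_def)
      then show ?thesis by (simp add: matrix_vector_right_distrib matrix_vector_mult_scaleR B(1) p_def)
    qed
    have "eventually (\<lambda>\<epsilon>. y0 + B *v parabolic_scale i \<epsilon> z \<in> polar K \<longleftrightarrow> S z / 2 \<le> z $ i) (at_right 0)"
      using W(4)[OF \<open>u \<bullet> p = 0\<close>, of "z $ i"] z unfolding pA dec by simp
    then have ev: "eventually (\<lambda>\<epsilon>. E \<epsilon> z = indicator {z. S z \<le> 2 * z$i} z * ennreal ((1 + (1 - \<epsilon>) * a * z $ i) powr (-\<beta>))) (at_right 0)"
      by eventually_elim (simp add: E_def indicator_def)
    have "((\<lambda>\<epsilon>. indicator {z. S z \<le> 2 * z$i} z * ennreal ((1 + (1 - \<epsilon>) * a * z $ i) powr (-\<beta>))) \<longlongrightarrow> E0 z) (at_right 0)"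
    proof (cases "S z \<le> 2 * z $ i")
      case True
      have "0 \<le> S z" unfolding S_def by (rule sum_nonneg) simp
      then have "z $ i \<ge> 0" using True by simp
      then have "1 + (1 - 0) * a * z $ i \<noteq> 0" using a by (smt (verit) mult_nonneg_nonneg)
      then have "((\<lambda>\<epsilon>. (1 + (1 - \<epsilon>) * a * z $ i) powr (-\<beta>)) \<longlongrightarrow> (1 + (1 - 0) * a * z $ i) powr (-\<beta>)) (at_right 0)"
        by (intro tendsto_intros) auto
      then show ?thesis using True by (simp add: E0_def tendsto_ennrealI)
    qed (simp add: E0_def)
    then show ?thesis using ev by (simp add: tendsto_cong)
  qed
  have ae: "AE z in lborel. S z \<noteq> 2 * z $ i"
    unfolding S_def by (rule paraboloid_boundary_null) simp
  have p0: "(real n + 1) / 2 > 0" by simp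
  then have \<beta>0: "\<beta> > 0" using \<beta> by (simp add: n_def)
  have lim: "((\<lambda>\<epsilon>. \<integral>\<^sup>+z. E \<epsilon> z \<partial>lborel) \<longlongrightarrow> (\<integral>\<^sup>+z. E0 z \<partial>lborel)) (at_right 0)"
  proof (rule tendsto_at_right_sequentially[of 0 "1/2"])
    fix s :: "nat \<Rightarrow> real" assume s: "\<And>k. 0 < s k" "\<And>k. s k < 1/2" "s \<longlonglongrightarrow> 0"
    have fs: "filterlim s (at_right 0) sequentially"
      using s by (intro tendsto_imp_filterlim_at_right) auto
    show "(\<lambda>k. \<integral>\<^sup>+z. E (s k) z \<partial>lborel) \<longlonglongrightarrow> (\<integral>\<^sup>+z. E0 z \<partial>lborel)"
    proof (rule nn_integral_dominated_convergence[where w = "\<lambda>z. indicator {z. (\<Sum>j\<in>UNIV-{i}. (z$j)\<^sup>2) \<le> C * a / b * z$i} z * ennreal ((1 + a / 2 * z$i) powr (-\<beta>))"])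
      show "AE z in lborel. E (s k) z \<le> indicator {z. (\<Sum>j\<in>UNIV-{i}. (z$j)\<^sup>2) \<le> C * a / b * z$i} z * ennreal ((1 + a / 2 * z$i) powr (-\<beta>))" for k
        unfolding E_def using s(1,2)[of k] by (intro AE_I2 rescaled_integrand_bound[OF C b xy(3) xB a _ _ \<beta>0]) auto
      show "AE z in lborel. (\<lambda>k. E (s k) z) \<longlonglongrightarrow> E0 z"
        using ae by eventually_elim (rule filterlim_compose[OF pt fs])
      have "C * a / b > 0" "a / 2 > 0" using C a b by auto
      from nn_integral_paraboloid[OF this, of \<beta> i] \<beta>
      show "(\<integral>\<^sup>+z. indicator {z. (\<Sum>j\<in>UNIV-{i}. (z$j)\<^sup>2) \<le> C * a / b * z$i} z * ennreal ((1 + a / 2 * z$i) powr (-\<beta>)) \<partial>lborel) < \<infinity>"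
        by simp
    qed measurable
  qed simp
  \<comment> \<open>Opening c = 2, from S z at most 2 z_i, supplies the factor 2^((n-1)/2) of
    \<open>c_const\<close>.\<close>
  have val: "(\<integral>\<^sup>+z. E0 z \<partial>lborel) = ennreal (c_const n \<beta> * a powr (-((real n + 1) / 2)))"
    using nn_integral_paraboloid[of 2 a \<beta> i] a \<beta> unfolding E0_def S_def n_def
    by (simp add: c_const_def mult_ac)
  have "((\<lambda>\<epsilon>. ennreal \<bar>det B\<bar> * (\<integral>\<^sup>+z. E \<epsilon> z \<partial>lborel)) \<longlongrightarrow> ennreal \<bar>det B\<bar> * (\<integral>\<^sup>+z. E0 z \<partial>lborel)) (at_right 0)"
    by (intro ennreal_tendsto_cmult lim) simp
  moreover have "eventually (\<lambda>\<epsilon>. ennreal \<bar>det B\<bar> * (\<integral>\<^sup>+z. E \<epsilon> z \<partial>lborel) =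
     ennreal (\<epsilon> powr (\<beta> - (real CARD('n) + 1) / 2)) * polar_integral \<beta> K ((1 - \<epsilon>) *\<^sub>R x0)) (at_right 0)"
    using eventually_at_right_less[of 0] eventually_at_right_real[of 0 1, simplified]
    by eventually_elim (use polar_integral_rescaled[OF xy dB xB a] in \<open>auto simp: E_def\<close>)
  ultimately have "((\<lambda>\<epsilon>. ennreal (\<epsilon> powr (\<beta> - (real CARD('n) + 1) / 2)) * polar_integral \<beta> K ((1 - \<epsilon>) *\<^sub>R x0))
      \<longlongrightarrow> ennreal \<bar>det B\<bar> * (\<integral>\<^sup>+z. E0 z \<partial>lborel)) (at_right 0)"
    by (simp add: tendsto_cong)
  also have "ennreal \<bar>det B\<bar> * (\<integral>\<^sup>+z. E0 z \<partial>lborel) = ennreal (c_const n \<beta> * (sqrt (1 / det A) * a powr (-((real n + 1) / 2))))"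
    unfolding val dBk using dA by (simp add: mult_ac flip: ennreal_mult')
  finally show "((\<lambda>\<epsilon>. ennreal (\<epsilon> powr (\<beta> - (real CARD('n) + 1) / 2)) * polar_integral \<beta> K ((1 - \<epsilon>) *\<^sub>R x0))
      \<longlongrightarrow> ennreal (c_const CARD('n) \<beta> * (sqrt (1 / gauss_curvature (polar K) y0) * norm x0 powr (-((real CARD('n) + 1) / 2))))) (at_right 0)"
    by (simp add: \<kappa> A_def n_def a_def)
qed

end

section \<open>Polar coordinates and the volume of the shell\<close>

lemma nn_integral_scaleR:
  fixes f :: "'a::euclidean_space \<Rightarrow> ennreal"
  assumes [measurable]: "f \<in> borel_measurable borel" and "c > 0"
  shows "ennreal (c ^ DIM('a)) * (\<integral>\<^sup>+x. f (c *\<^sub>R x) \<partial>lborel) = (\<integral>\<^sup>+x. f x \<partial>lborel)"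
proof -
  have D: "lborel = density (distr lborel borel (\<lambda>x::'a. c *\<^sub>R x)) (\<lambda>_. ennreal (c ^ DIM('a)))"
    using lborel_affine[of c "0::'a"] assms(2) by (simp add: ennreal_power)
  show ?thesis
    by (subst (2) D) (simp add: nn_integral_density nn_integral_distr nn_integral_cmult)
qed

lemma nn_integral_inverse_power:
  assumes "n \<ge> 1" "a > 0"
  shows "(\<integral>\<^sup>+s. ennreal (1 / s ^ Suc n) * indicator {a<..} s \<partial>lborel) = ennreal (1 / (real n * a ^ n))"
proof -
  have "(\<integral>\<^sup>+s. ennreal (1 / s ^ Suc n) * indicator {a<..} s \<partial>lborel)
      = (\<integral>\<^sup>+s. ennreal (1 / s ^ Suc n) * indicator {a..} s \<partial>lborel)"
    by (intro nn_integral_cong_AE eventually_mono[OF AE_lborel_singleton[of a]]) (auto simp: indicator_def)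
  also have "\<dots> = ennreal (0 - (- 1 / (real n * a ^ n)))"
  proof (rule nn_integral_FTC_atLeast)
    fix s assume s: "a \<le> s"
    then have s0: "s > 0" using assms by simp
    show "((\<lambda>s. - 1 / (real n * s ^ n)) has_real_derivative 1 / s ^ Suc n) (at s)"
    proof (rule DERIV_cong)
      show "((\<lambda>s. - 1 / (real n * s ^ n)) has_real_derivative
          (0 * (real n * s ^ n) - (- 1) * (real n * (real n * s ^ (n - 1)))) / ((real n * s ^ n) * (real n * s ^ n))) (at s)"
        using s0 assms by (auto intro!: derivative_eq_intros)
      have "s ^ n = s * s ^ (n - 1)" using assms by (metis Suc_diff_1 less_le_trans power_Suc zero_less_one)
      then show "(0 * (real n * s ^ n) - (- 1) * (real n * (real n * s ^ (n - 1)))) / ((real n * s ^ n) * (real n * s ^ n)) = 1 / s ^ Suc n"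
        using s0 assms by (simp add: field_simps)
    qed
    show "0 \<le> 1 / s ^ Suc n" using s0 by simp
  next
    have "filterlim (\<lambda>s::real. real n * s ^ n) at_top at_top"
      using assms by (intro filterlim_tendsto_pos_mult_at_top[OF tendsto_const] filterlim_pow_at_top filterlim_ident) auto
    from tendsto_divide_0[OF tendsto_const filterlim_at_top_imp_at_infinity[OF this], of "-1"]
    show "((\<lambda>s. - 1 / (real n * s ^ n)) \<longlongrightarrow> 0) at_top" .
  qed simp
  finally show ?thesis by simp
qed

lemma borel_measurable_sgn_vector [measurable]:
  "(sgn :: 'a::euclidean_space \<Rightarrow> 'a) \<in> borel_measurable borel"
proof -
  have "(sgn :: 'a \<Rightarrow> 'a) = (\<lambda>x. inverse (norm x) *\<^sub>R x)" by (auto simp: sgn_div_norm)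
  then show ?thesis by simp
qed

text \<open>Directions are sampled as \<open>sgn x\<close> over the punctured unit ball, matching
  \<open>sphere_measure\<close>. Substituting r = |x| s and then z = s x turns the right-hand side
  into the integral of F z times that of |z|^n / s^(n+1) over s > |z|, which is 1/n.\<close>

lemma polar_coordinates:
  fixes F :: "'a::euclidean_space \<Rightarrow> ennreal"
  assumes [measurable]: "F \<in> borel_measurable borel"
  defines "n \<equiv> DIM('a)"
  shows "(\<integral>\<^sup>+x. F x \<partial>lborel) = ennreal (real n) * (\<integral>\<^sup>+x. indicator (ball 0 1 - {0}) x *
     (\<integral>\<^sup>+r. indicator {0<..} r * (F (r *\<^sub>R sgn x) * ennreal (r ^ (n - 1))) \<partial>lborel) \<partial>lborel)"
proof -
  have n1: "n \<ge> 1" by (simp add: n_def Suc_le_eq)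
  then obtain m where m: "n = Suc m" by (cases n) auto
  \<comment> \<open>G carries the integrand after the first substitution; its condition
    \<open>norm z < s\<close> encodes that x = z / s lies in the unit ball.\<close>
  define G where "G = (\<lambda>s z. indicator {z. 0 < norm z \<and> norm z < s} z * (ennreal ((norm z / s) ^ n) * F (z::'a)))"
  have [measurable]: "(\<lambda>(s, z). G s z) \<in> borel_measurable (borel \<Otimes>\<^sub>M borel)"
    unfolding G_def split_beta' by measurable
  have 1: "indicator (ball 0 1 - {0}) x * (\<integral>\<^sup>+r. indicator {0<..} r * (F (r *\<^sub>R sgn x) * ennreal (r ^ (n - 1))) \<partial>lborel)
      = (\<integral>\<^sup>+s. indicator {0<..} s * ennreal (s ^ (n - 1)) * G s (s *\<^sub>R x) \<partial>lborel)" for x :: 'a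
  proof (cases "x \<in> ball 0 1 - {0}")
    case True
    then have x: "norm x > 0" "norm x < 1" by auto
    have "(\<integral>\<^sup>+r. indicator {0<..} r * (F (r *\<^sub>R sgn x) * ennreal (r ^ (n - 1))) \<partial>lborel)
      = ennreal (norm x) * (\<integral>\<^sup>+s. indicator {0<..} (norm x * s) * (F ((norm x * s) *\<^sub>R sgn x) * ennreal ((norm x * s) ^ (n - 1))) \<partial>lborel)"
      using nn_integral_real_affine[of "\<lambda>r. indicator {0<..} r * (F (r *\<^sub>R sgn x) * ennreal (r ^ (n - 1)))" "norm x" 0] x
      by simp
    also have "\<dots> = (\<integral>\<^sup>+s. ennreal (norm x) * (indicator {0<..} (norm x * s) * (F ((norm x * s) *\<^sub>R sgn x) * ennreal ((norm x * s) ^ (n - 1)))) \<partial>lborel)"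
      by (subst nn_integral_cmult) auto
    also have "\<dots> = (\<integral>\<^sup>+s. indicator {0<..} s * ennreal (s ^ (n - 1)) * G s (s *\<^sub>R x) \<partial>lborel)"
    proof (intro nn_integral_cong)
      fix s :: real
      show "ennreal (norm x) * (indicator {0<..} (norm x * s) * (F ((norm x * s) *\<^sub>R sgn x) * ennreal ((norm x * s) ^ (n - 1))))
        = indicator {0<..} s * ennreal (s ^ (n - 1)) * G s (s *\<^sub>R x)"
      proof (cases "s > 0")
        case True
        have e1: "(norm x * s) *\<^sub>R sgn x = s *\<^sub>R x" using x by (simp add: sgn_div_norm)
        have e2: "ennreal (norm x) * ennreal ((norm x * s) ^ (n - 1)) = ennreal (s ^ (n - 1)) * ennreal ((norm (s *\<^sub>R x) / s) ^ n)"
          using x True by (simp add: m power_mult_distrib mult_ac flip: ennreal_mult)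
        have i: "indicator {0<..} (norm x * s) = (1 :: ennreal)" "indicator {0<..} s = (1 :: ennreal)"
          "G s (s *\<^sub>R x) = ennreal ((norm (s *\<^sub>R x) / s) ^ n) * F (s *\<^sub>R x)"
          using True x by (auto simp: G_def)
        have "ennreal (norm x) * (F (s *\<^sub>R x) * ennreal ((norm x * s) ^ (n - 1)))
          = (ennreal (norm x) * ennreal ((norm x * s) ^ (n - 1))) * F (s *\<^sub>R x)"
          by (simp only: mult_ac)
        then show ?thesis unfolding i e1 e2 by (simp only: mult.assoc mult_1_left)
      next
        case False
        then have "\<not> norm x * s > 0" using x by (simp add: zero_less_mult_iff)
        then show ?thesis using False by simp
      qed
    qed
    finally show ?thesis using True by simp
  next
    case False
    then have "x = 0 \<or> norm x \<ge> 1" by auto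
    then have "indicator {0<..} s * ennreal (s ^ (n - 1)) * G s (s *\<^sub>R x) = 0" for s
      by (auto simp: G_def indicator_def mult_less_cancel_left2)
    then have "(\<integral>\<^sup>+s. indicator {0<..} s * ennreal (s ^ (n - 1)) * G s (s *\<^sub>R x) \<partial>lborel) = 0"
      by (simp only: nn_integral_const mult_zero_left)
    moreover have "indicator (ball 0 1 - {0}) x = (0 :: ennreal)" using False by (rule indicator_simps)
    ultimately show ?thesis by (simp only: mult_zero_left)
  qed
  have 2: "(\<integral>\<^sup>+x. indicator {0<..} s * ennreal (s ^ (n - 1)) * G s (s *\<^sub>R x) \<partial>lborel)
      = (\<integral>\<^sup>+z. indicator {0<..} s * ennreal (1 / s) * G s z \<partial>lborel)" for s
  proof (cases "s > 0")
    case True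
    have [measurable]: "G s \<in> borel_measurable borel" unfolding G_def by measurable
    have "ennreal (1 / s) * (\<integral>\<^sup>+z. G s z \<partial>lborel) = ennreal (1 / s) * (ennreal (s ^ n) * (\<integral>\<^sup>+x. G s (s *\<^sub>R x) \<partial>lborel))"
      using nn_integral_scaleR[of "G s" s] True by (simp add: n_def)
    also have "\<dots> = ennreal (s ^ (n - 1)) * (\<integral>\<^sup>+x. G s (s *\<^sub>R x) \<partial>lborel)"
      using True by (simp add: m mult.assoc[symmetric] flip: ennreal_mult)
    finally show ?thesis using True by (simp add: nn_integral_cmult)
  qed simp
  have 3: "(\<integral>\<^sup>+s. indicator {0<..} s * ennreal (1 / s) * G s z \<partial>lborel) = F z * ennreal (1 / real n)" if "z \<noteq> 0" for z
  proof -
    have "(\<integral>\<^sup>+s. indicator {0<..} s * ennreal (1 / s) * G s z \<partial>lborel)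
      = (\<integral>\<^sup>+s. (F z * ennreal (norm z ^ n)) * (ennreal (1 / s ^ Suc n) * indicator {norm z<..} s) \<partial>lborel)"
    proof (intro nn_integral_cong)
      fix s
      show "indicator {0<..} s * ennreal (1 / s) * G s z = (F z * ennreal (norm z ^ n)) * (ennreal (1 / s ^ Suc n) * indicator {norm z<..} s)"
      proof (cases "s > norm z")
        case True
        then have s: "s > 0" by (meson norm_ge_zero order_le_less_trans)
        have "ennreal (1 / s) * ennreal ((norm z / s) ^ n) = ennreal (norm z ^ n) * ennreal (1 / s ^ Suc n)"
          using s by (simp add: power_divide flip: ennreal_mult)
        then show ?thesis using True s that by (simp add: G_def mult_ac)
      qed (simp add: G_def)
    qed
    also have "\<dots> = (F z * ennreal (norm z ^ n)) * ennreal (1 / (real n * norm z ^ n))"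
      using that n1 by (subst nn_integral_cmult) (auto simp: nn_integral_inverse_power simp del: power_Suc)
    also have "\<dots> = F z * ennreal (1 / real n)"
      using that n1 by (simp add: mult.assoc flip: ennreal_mult)
    finally show ?thesis .
  qed
  have "(\<integral>\<^sup>+x. indicator (ball 0 1 - {0}) x *
     (\<integral>\<^sup>+r. indicator {0<..} r * (F (r *\<^sub>R sgn x) * ennreal (r ^ (n - 1))) \<partial>lborel) \<partial>lborel)
     = (\<integral>\<^sup>+x. \<integral>\<^sup>+s. indicator {0<..} s * ennreal (s ^ (n - 1)) * G s (s *\<^sub>R x) \<partial>lborel \<partial>lborel)"
    unfolding 1 ..
  also have "\<dots> = (\<integral>\<^sup>+s. \<integral>\<^sup>+x. indicator {0<..} s * ennreal (s ^ (n - 1)) * G s (s *\<^sub>R x) \<partial>lborel \<partial>lborel)"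
    by (rule pair_sigma_finite.Fubini') (unfold_locales, unfold G_def, measurable)
  also have "\<dots> = (\<integral>\<^sup>+s. \<integral>\<^sup>+z. indicator {0<..} s * ennreal (1 / s) * G s z \<partial>lborel \<partial>lborel)"
    unfolding 2 ..
  also have "\<dots> = (\<integral>\<^sup>+z. \<integral>\<^sup>+s. indicator {0<..} s * ennreal (1 / s) * G s z \<partial>lborel \<partial>lborel)"
    by (rule pair_sigma_finite.Fubini') (unfold_locales, unfold G_def, measurable)
  also have "\<dots> = (\<integral>\<^sup>+z. F z * ennreal (1 / real n) \<partial>lborel)"
    by (intro nn_integral_cong_AE eventually_mono[OF AE_lborel_singleton[of 0]]) (simp add: 3)
  also have "\<dots> = (\<integral>\<^sup>+z. F z \<partial>lborel) * ennreal (1 / real n)" by (rule nn_integral_multc) simp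
  finally have eq: "(\<integral>\<^sup>+x. indicator (ball 0 1 - {0}) x *
     (\<integral>\<^sup>+r. indicator {0<..} r * (F (r *\<^sub>R sgn x) * ennreal (r ^ (n - 1))) \<partial>lborel) \<partial>lborel)
     = (\<integral>\<^sup>+z. F z \<partial>lborel) * ennreal (1 / real n)" .
  have "ennreal (real n) * ennreal (1 / real n) = 1" using n1 by (simp flip: ennreal_mult)
  then show ?thesis unfolding eq by (metis mult.commute mult.left_commute mult.right_neutral)
qed

lemma borel_measurable_polar_integral [measurable]:
  fixes K :: "'n::finite vec set"
  assumes [measurable]: "polar K \<in> sets borel"
  shows "polar_integral \<beta> K \<in> borel_measurable borel"
  unfolding polar_integral_def by measurable

text \<open>Indicator of \<open>K - S_beta \<beta> K t\<close> on the ray through the boundary point \<open>z\<close>, together with the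
  radial density \<open>r ^ (n - 1)\<close>, after the substitution \<open>r = 1 - \<delta> * \<tau>\<close>.\<close>

definition shell :: "real \<Rightarrow> 'n::finite vec set \<Rightarrow> real \<Rightarrow> real \<Rightarrow> 'n vec \<Rightarrow> real \<Rightarrow> ennreal" where
  "shell \<beta> K \<delta> t z \<tau> = indicator {\<tau>. 0 \<le> \<tau> \<and> \<delta> * \<tau> < 1} \<tau> *
     (indicator {y. ennreal t < polar_integral \<beta> K y} ((1 - \<delta> * \<tau>) *\<^sub>R z) * ennreal ((1 - \<delta> * \<tau>) ^ (CARD('n) - 1)))"

lemma borel_measurable_shell:
  fixes K :: "'n::finite vec set"
  assumes [measurable]: "polar K \<in> sets borel"
  shows "(\<lambda>(z, \<tau>). shell \<beta> K \<delta> t z \<tau>) \<in> borel_measurable (borel \<Otimes>\<^sub>M borel)"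
proof -
  have [measurable]: "{y. ennreal t < polar_integral \<beta> K y} \<in> sets borel" by measurable
  show ?thesis unfolding shell_def split_beta' by measurable
qed

text \<open>With eps = t^(-1/\<alpha>) \<tau> the bound t < M eps^(-\<alpha>) loses its t and
  becomes \<tau>^\<alpha> < M, so one interval dominates for all t.\<close>

lemma shell_le:
  fixes K :: "'n::finite vec set" and x0 :: "'n vec"
  assumes \<alpha>: "\<alpha> > 0" and M: "M > 0" and t: "t > 0"
    and J: "\<And>\<epsilon>. 0 < \<epsilon> \<Longrightarrow> \<epsilon> \<le> 1 \<Longrightarrow> polar_integral \<beta> K ((1 - \<epsilon>) *\<^sub>R x0) \<le> ennreal (M * \<epsilon> powr (-\<alpha>))"
  shows "shell \<beta> K (t powr (-1/\<alpha>)) t x0 \<tau> \<le> indicator {0..M powr (1/\<alpha>)} \<tau>"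
proof -
  define \<delta> where "\<delta> = t powr (-1/\<alpha>)"
  have \<delta>: "\<delta> > 0" using t by (simp add: \<delta>_def)
  consider "\<tau> \<le> 0" | "0 < \<tau>" "\<delta> * \<tau> < 1" "ennreal t < polar_integral \<beta> K ((1 - \<delta> * \<tau>) *\<^sub>R x0)"
    | "shell \<beta> K \<delta> t x0 \<tau> = 0"
    by (fastforce simp: shell_def indicator_def)
  then have "shell \<beta> K \<delta> t x0 \<tau> \<le> indicator {0..M powr (1/\<alpha>)} \<tau>"
  proof cases
    \<comment> \<open>Negative \<tau> are outside the shell. At \<tau> = 0, where the growth bound
      does not apply, the shell is at most 1 and 0 belongs to the interval.\<close>
    case 1
    then show ?thesis using M by (cases "\<tau> = 0") (auto simp: shell_def indicator_def)
  next
    case 2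
    define \<epsilon> where "\<epsilon> = \<delta> * \<tau>"
    have \<epsilon>: "0 < \<epsilon>" "\<epsilon> < 1" using 2 \<delta> by (auto simp: \<epsilon>_def)
    have "ennreal t < ennreal (M * \<epsilon> powr (-\<alpha>))" using 2(3) J[of \<epsilon>] \<epsilon> unfolding \<epsilon>_def[symmetric] by (meson less_imp_le less_le_trans)
    then have "t < M * \<epsilon> powr (-\<alpha>)" using t by (simp add: ennreal_less_iff)
    also have "\<epsilon> powr (-\<alpha>) = t * \<tau> powr (-\<alpha>)"
      using 2 \<delta> t \<alpha> unfolding \<epsilon>_def \<delta>_def by (simp add: powr_mult powr_powr)
    finally have "1 < M * \<tau> powr (-\<alpha>)" using t by (simp add: mult.left_commute)
    then have "\<tau> powr \<alpha> < M" using 2(1) by (simp add: powr_minus field_simps)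
    then have "(\<tau> powr \<alpha>) powr (1/\<alpha>) < M powr (1/\<alpha>)" using \<alpha> by (intro powr_less_mono2) auto
    then have "\<tau> < M powr (1/\<alpha>)" using \<alpha> 2 by (simp add: powr_powr)
    then have "indicator {0..M powr (1/\<alpha>)} \<tau> = (1::ennreal)" using 2 by simp
    moreover have "(1 - \<delta> * \<tau>) ^ (CARD('n) - 1) \<le> 1" using \<epsilon> by (intro power_le_one) (auto simp: \<epsilon>_def)
    then have "ennreal ((1 - \<delta> * \<tau>) ^ (CARD('n) - 1)) \<le> 1" using ennreal_leI by fastforce
    ultimately show ?thesis unfolding shell_def by (simp add: indicator_def)
  qed simp
  then show ?thesis by (simp add: \<delta>_def)
qed

text \<open>Multiplying t < J by eps^\<alpha> turns the shell condition into \<tau>^\<alpha> <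
  eps^\<alpha> J, whose right-hand side tends to A. The shell therefore tends to the indicator of an
  interval of length A^(1/\<alpha>).\<close>

lemma shell_integral_limit:
  fixes K :: "'n::finite vec set" and x0 :: "'n vec" and t :: "nat \<Rightarrow> real"
  assumes pK [measurable]: "polar K \<in> sets borel" and \<alpha>: "\<alpha> > 0" and M: "M > 0" and t: "\<And>k. t k > 0" "filterlim t at_top sequentially"
    and J: "\<And>\<epsilon>. 0 < \<epsilon> \<Longrightarrow> \<epsilon> \<le> 1 \<Longrightarrow> polar_integral \<beta> K ((1 - \<epsilon>) *\<^sub>R x0) \<le> ennreal (M * \<epsilon> powr (-\<alpha>))"
    and A: "A > 0" "((\<lambda>\<epsilon>. ennreal (\<epsilon> powr \<alpha>) * polar_integral \<beta> K ((1 - \<epsilon>) *\<^sub>R x0)) \<longlongrightarrow> ennreal A) (at_right 0)"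
  shows "(\<lambda>k. \<integral>\<^sup>+\<tau>. shell \<beta> K (t k powr (-1/\<alpha>)) (t k) x0 \<tau> \<partial>lborel) \<longlonglongrightarrow> ennreal (A powr (1/\<alpha>))"
proof -
  have lim: "(\<lambda>k. \<integral>\<^sup>+\<tau>. shell \<beta> K (t k powr (-1/\<alpha>)) (t k) x0 \<tau> \<partial>lborel) \<longlonglongrightarrow> (\<integral>\<^sup>+\<tau>. indicator {0..A powr (1/\<alpha>)} \<tau> \<partial>lborel)"
  proof (rule nn_integral_dominated_convergence[where w = "indicator {0..M powr (1/\<alpha>)}"])
    show "(\<lambda>\<tau>. shell \<beta> K (t k powr (-1/\<alpha>)) (t k) x0 \<tau>) \<in> borel_measurable lborel" for k
      using measurable_compose[OF measurable_Pair1' borel_measurable_shell[OF pK]] by simp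
    show "AE \<tau> in lborel. shell \<beta> K (t k powr (-1/\<alpha>)) (t k) x0 \<tau> \<le> indicator {0..M powr (1/\<alpha>)} \<tau>" for k
      by (intro AE_I2 shell_le \<alpha> M t J)
    show "(\<integral>\<^sup>+\<tau>. indicator {0..M powr (1/\<alpha>)} \<tau> \<partial>lborel) < \<infinity>" by simp
    \<comment> \<open>At the upper endpoint the limit does not decide the inequality; at 0 the point
      is \<open>x0\<close> itself, outside the range of the asymptotics.\<close>
    have "AE \<tau> in lborel. \<tau> \<noteq> 0 \<and> \<tau> \<noteq> A powr (1/\<alpha>)"
      using AE_lborel_singleton[of "0::real"] AE_lborel_singleton[of "A powr (1/\<alpha>)"] by eventually_elim simp
    then show "AE \<tau> in lborel. (\<lambda>k. shell \<beta> K (t k powr (-1/\<alpha>)) (t k) x0 \<tau>) \<longlonglongrightarrow> indicator {0..A powr (1/\<alpha>)} \<tau>"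
    proof eventually_elim
      case (elim \<tau>)
      show ?case
      proof (cases "\<tau> > 0")
        case False
        then have "\<tau> < 0" using elim by simp
        then show ?thesis by (simp add: shell_def)
      next
        case True
        define \<epsilon> where "\<epsilon> = (\<lambda>k. t k powr (-1/\<alpha>) * \<tau>)"
        have "((\<lambda>k. t k powr (-1/\<alpha>)) \<longlongrightarrow> 0) sequentially"
          by (intro tendsto_neg_powr t) (use \<alpha> in simp)
        from tendsto_mult_left_zero[OF this, of \<tau>]
        have \<epsilon>0: "\<epsilon> \<longlonglongrightarrow> 0" by (simp add: \<epsilon>_def)
        have \<epsilon>pos: "\<epsilon> k > 0" for k using t(1)[of k] True by (simp add: \<epsilon>_def)
        have "filterlim \<epsilon> (at_right 0) sequentially"
          using \<epsilon>0 \<epsilon>pos by (intro tendsto_imp_filterlim_at_right) auto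
        from filterlim_compose[OF A(2) this]
        have L: "(\<lambda>k. ennreal (\<epsilon> k powr \<alpha>) * polar_integral \<beta> K ((1 - \<epsilon> k) *\<^sub>R x0)) \<longlonglongrightarrow> ennreal A" .
        have \<epsilon>\<alpha>: "\<epsilon> k powr \<alpha> = \<tau> powr \<alpha> / t k" for k
          using t(1)[of k] True \<alpha> by (simp add: \<epsilon>_def powr_mult powr_powr powr_minus_divide powr_divide)
        have prod: "ennreal (\<epsilon> k powr \<alpha>) * ennreal (t k) = ennreal (\<tau> powr \<alpha>)" for k
          unfolding \<epsilon>\<alpha> using t(1)[of k] by (simp flip: ennreal_mult)
        have ev1: "eventually (\<lambda>k. \<epsilon> k < 1) sequentially" using order_tendstoD(2)[OF \<epsilon>0, of 1] by simp
        have AA: "(A powr (1/\<alpha>)) powr \<alpha> = A" using A(1) \<alpha> by (simp add: powr_powr)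
        show ?thesis
        proof (cases "\<tau> < A powr (1/\<alpha>)")
          case True': True
          have "\<tau> powr \<alpha> < A"
            using powr_less_mono2[OF \<alpha> _ True'] True AA by simp
          then have "ennreal (\<tau> powr \<alpha>) < ennreal A" by (simp add: ennreal_less_iff)
          from order_tendstoD(1)[OF L this] ev1
          have "eventually (\<lambda>k. shell \<beta> K (t k powr (-1/\<alpha>)) (t k) x0 \<tau> = ennreal ((1 - \<epsilon> k) ^ (CARD('n) - 1))) sequentially"
          proof eventually_elim
            case (elim k)
            have "ennreal (t k) < polar_integral \<beta> K ((1 - \<epsilon> k) *\<^sub>R x0)"
            proof (rule ccontr)
              assume "\<not> ?thesis"
              then have "ennreal (\<epsilon> k powr \<alpha>) * polar_integral \<beta> K ((1 - \<epsilon> k) *\<^sub>R x0) \<le> ennreal (\<epsilon> k powr \<alpha>) * ennreal (t k)"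
                by (intro mult_left_mono) auto
              then show False using elim(1) unfolding prod by simp
            qed
            then show ?case using elim(2) True unfolding shell_def \<epsilon>_def by simp
          qed
          moreover have "(\<lambda>k. ennreal ((1 - \<epsilon> k) ^ (CARD('n) - 1))) \<longlonglongrightarrow> ennreal ((1 - 0) ^ (CARD('n) - 1))"
            by (intro tendsto_ennrealI tendsto_intros \<epsilon>0)
          ultimately show ?thesis using True True' by (simp add: tendsto_cong)
        next
          case False
          then have *: "A powr (1/\<alpha>) < \<tau>" using elim by simp
          have "A < \<tau> powr \<alpha>"
            using powr_less_mono2[OF \<alpha> _ *] AA by simp
          then have "ennreal A < ennreal (\<tau> powr \<alpha>)" using A by (simp add: ennreal_less_iff)
          from order_tendstoD(2)[OF L this]
          have "eventually (\<lambda>k. shell \<beta> K (t k powr (-1/\<alpha>)) (t k) x0 \<tau> = 0) sequentially"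
          proof eventually_elim
            case (elim k)
            have "\<not> ennreal (t k) < polar_integral \<beta> K ((1 - \<epsilon> k) *\<^sub>R x0)"
            proof
              assume "ennreal (t k) < polar_integral \<beta> K ((1 - \<epsilon> k) *\<^sub>R x0)"
              then have "ennreal (\<epsilon> k powr \<alpha>) * ennreal (t k) \<le> ennreal (\<epsilon> k powr \<alpha>) * polar_integral \<beta> K ((1 - \<epsilon> k) *\<^sub>R x0)"
                by (intro mult_left_mono) auto
              then show False using elim(1) unfolding prod by simp
            qed
            then show ?case unfolding shell_def \<epsilon>_def by simp
          qed
          then show ?thesis using False * by (simp add: tendsto_eventually)
        qed
      qed
    qed
  qed simp_all
  then show ?thesis by (simp add: A)
qed

section \<open>Radial decomposition of the removed volume\<close>

context centred_body
begin

lemma scaleR_mem_iff: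
  assumes "x0 \<in> frontier K" "s > 0"
  shows "s *\<^sub>R x0 \<in> K \<longleftrightarrow> s \<le> 1"
proof -
  interpret L: centred_body "polar K" by (rule centred_body_polar)
  show ?thesis
    unfolding mem_iff using assms support_fun_scaleR[OF L.compact L.nonempty, of s x0] by (simp add: frontier_eq)
qed

lemma radial_point_frontier:
  assumes "u \<noteq> 0"
  shows "(1 / support_fun (polar K) u) *\<^sub>R u \<in> frontier K"
proof -
  interpret L: centred_body "polar K" by (rule centred_body_polar)
  have "support_fun (polar K) u > 0" by (rule L.support_fun_pos[OF assms])
  then show ?thesis
    unfolding frontier_eq by (simp add: support_fun_scaleR[OF L.compact L.nonempty])
qed

lemma borel_measurable_support_fun [measurable]: "support_fun (polar K) \<in> borel_measurable borel"
proof -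
  interpret L: centred_body "polar K" by (rule centred_body_polar)
  show ?thesis by (intro borel_measurable_continuous_onI continuous_on_support_fun L.compact L.nonempty)
qed

lemma S_beta_eq: "S_beta \<beta> K t = {x \<in> K. polar_integral \<beta> K x \<le> ennreal t}"
proof -
  have "(\<integral>\<^sup>+y. indicator (polar K) y * ennreal ((1 - x \<bullet> y) powr (-\<beta>)) \<partial>lebesgue) = polar_integral \<beta> K x" for x
    unfolding polar_integral_def by (intro nn_integral_completion) measurable
  then show ?thesis unfolding S_beta_def by simp
qed

text \<open>The radius is first measured in units of 1/h, its value on the boundary, and then
  written as 1 - \<delta> \<tau>. These steps contribute h^(-n) and \<delta>; the scale \<delta>
  stays free until it is tied to t.\<close>

lemma emeasure_body_minus_S_beta:
  fixes \<beta> t \<delta> :: real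
  defines "X \<equiv> \<lambda>x. (1 / support_fun (polar K) (sgn x)) *\<^sub>R sgn x"
  assumes \<delta>: "\<delta> > 0"
  shows "emeasure lborel (K - S_beta \<beta> K t) = ennreal (real CARD('n)) * (\<integral>\<^sup>+x. indicator (ball 0 1 - {0}) x *
     (ennreal (1 / support_fun (polar K) (sgn x) ^ CARD('n) * \<delta>) * (\<integral>\<^sup>+\<tau>. shell \<beta> K \<delta> t (X x) \<tau> \<partial>lborel)) \<partial>lborel)"
proof -
  interpret L: centred_body "polar K" by (rule centred_body_polar)
  let ?h = "support_fun (polar K)"
  define n where "n = CARD('n)"
  have n1: "n \<ge> 1" by (simp add: n_def Suc_le_eq card_gt_0_iff)
  then obtain m where m: "n = Suc m" by (cases n) auto
  define D where "D = K - S_beta \<beta> K t"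
  have Deq: "D = {x \<in> K. ennreal t < polar_integral \<beta> K x}" by (auto simp: D_def S_beta_eq)
  have [measurable]: "K \<in> sets borel" using compact by (rule borel_compact)
  have [measurable]: "D \<in> sets borel" unfolding Deq by measurable
  have inner: "(\<integral>\<^sup>+r. indicator {0<..} r * (indicator D (r *\<^sub>R sgn x) * ennreal (r ^ (n - 1))) \<partial>lborel)
     = ennreal (1 / ?h (sgn x) ^ n * \<delta>) * (\<integral>\<^sup>+\<tau>. shell \<beta> K \<delta> t (X x) \<tau> \<partial>lborel)" if x: "x \<noteq> 0" for x
  proof -
    have sx: "sgn x \<noteq> 0" using x by (simp add: sgn_zero_iff)
    define a where "a = 1 / ?h (sgn x)"
    have a: "a > 0" using L.support_fun_pos[OF sx] by (simp add: a_def)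
    have Xa: "X x = a *\<^sub>R sgn x" by (simp add: X_def a_def)
    have Xf: "X x \<in> frontier K" unfolding X_def by (rule radial_point_frontier[OF sx])
    have [measurable]: "(\<lambda>s. indicator D (s *\<^sub>R X x) :: ennreal) \<in> borel_measurable borel" by measurable
    have "(\<integral>\<^sup>+r. indicator {0<..} r * (indicator D (r *\<^sub>R sgn x) * ennreal (r ^ (n - 1))) \<partial>lborel)
      = ennreal a * (\<integral>\<^sup>+s. indicator {0<..} (a * s) * (indicator D ((a * s) *\<^sub>R sgn x) * ennreal ((a * s) ^ (n - 1))) \<partial>lborel)"
      using nn_integral_real_affine[of "\<lambda>r. indicator {0<..} r * (indicator D (r *\<^sub>R sgn x) * ennreal (r ^ (n - 1)))" a 0] a
      by simp
    also have "(\<integral>\<^sup>+s. indicator {0<..} (a * s) * (indicator D ((a * s) *\<^sub>R sgn x) * ennreal ((a * s) ^ (n - 1))) \<partial>lborel)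
      = (\<integral>\<^sup>+s. ennreal (a ^ (n - 1)) * (indicator {0<..} s * (indicator D (s *\<^sub>R X x) * ennreal (s ^ (n - 1)))) \<partial>lborel)"
    proof (intro nn_integral_cong)
      fix s :: real
      have i: "indicator {0<..} (a * s) = (indicator {0<..} s :: ennreal)"
        using a by (simp add: indicator_def zero_less_mult_iff)
      have e: "(a * s) *\<^sub>R sgn x = s *\<^sub>R X x" by (simp add: Xa mult.commute)
      have p: "ennreal ((a * s) ^ (n - 1)) = ennreal (a ^ (n - 1)) * ennreal (s ^ (n - 1))" if "s > 0"
        using that a by (simp add: power_mult_distrib flip: ennreal_mult)
      show "indicator {0<..} (a * s) * (indicator D ((a * s) *\<^sub>R sgn x) * ennreal ((a * s) ^ (n - 1)))
        = ennreal (a ^ (n - 1)) * (indicator {0<..} s * (indicator D (s *\<^sub>R X x) * ennreal (s ^ (n - 1))))"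
      proof (cases "s > 0")
        case True
        then show ?thesis unfolding i e p[OF True] by (simp only: mult_ac)
      qed (simp add: i)
    qed
    also have "\<dots> = ennreal (a ^ (n - 1)) * (\<integral>\<^sup>+s. indicator {0<..} s * (indicator D (s *\<^sub>R X x) * ennreal (s ^ (n - 1))) \<partial>lborel)"
      by (rule nn_integral_cmult) measurable
    also have "(\<integral>\<^sup>+s. indicator {0<..} s * (indicator D (s *\<^sub>R X x) * ennreal (s ^ (n - 1))) \<partial>lborel)
      = ennreal \<delta> * (\<integral>\<^sup>+\<tau>. indicator {0<..} (1 + (-\<delta>) * \<tau>) * (indicator D ((1 + (-\<delta>) * \<tau>) *\<^sub>R X x) * ennreal ((1 + (-\<delta>) * \<tau>) ^ (n - 1))) \<partial>lborel)"
      using nn_integral_real_affine[of "\<lambda>s. indicator {0<..} s * (indicator D (s *\<^sub>R X x) * ennreal (s ^ (n - 1)))" "-\<delta>" 1] \<delta>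
      by simp
    also have "(\<integral>\<^sup>+\<tau>. indicator {0<..} (1 + (-\<delta>) * \<tau>) * (indicator D ((1 + (-\<delta>) * \<tau>) *\<^sub>R X x) * ennreal ((1 + (-\<delta>) * \<tau>) ^ (n - 1))) \<partial>lborel)
      = (\<integral>\<^sup>+\<tau>. shell \<beta> K \<delta> t (X x) \<tau> \<partial>lborel)"
    proof (intro nn_integral_cong)
      fix \<tau> :: real
      show "indicator {0<..} (1 + (-\<delta>) * \<tau>) * (indicator D ((1 + (-\<delta>) * \<tau>) *\<^sub>R X x) * ennreal ((1 + (-\<delta>) * \<tau>) ^ (n - 1)))
        = shell \<beta> K \<delta> t (X x) \<tau>"
      proof (cases "\<delta> * \<tau> < 1")
        case True
        \<comment> \<open>Membership in K on the ray is what produces the lower bound on \<tau> in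
          \<open>shell\<close>.\<close>
        have "(1 - \<delta> * \<tau>) *\<^sub>R X x \<in> K \<longleftrightarrow> 0 \<le> \<tau>"
          using scaleR_mem_iff[OF Xf, of "1 - \<delta> * \<tau>"] True \<delta> by (simp add: zero_le_mult_iff)
        then show ?thesis using True by (simp add: shell_def Deq n_def indicator_def)
      qed (simp add: shell_def)
    qed
    finally have "(\<integral>\<^sup>+r. indicator {0<..} r * (indicator D (r *\<^sub>R sgn x) * ennreal (r ^ (n - 1))) \<partial>lborel)
      = ennreal a * (ennreal (a ^ (n - 1)) * (ennreal \<delta> * (\<integral>\<^sup>+\<tau>. shell \<beta> K \<delta> t (X x) \<tau> \<partial>lborel)))" .
    also have "\<dots> = (ennreal a * ennreal (a ^ (n - 1)) * ennreal \<delta>) * (\<integral>\<^sup>+\<tau>. shell \<beta> K \<delta> t (X x) \<tau> \<partial>lborel)"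
      by (simp only: mult.assoc)
    also have "ennreal a * ennreal (a ^ (n - 1)) * ennreal \<delta> = ennreal (1 / ?h (sgn x) ^ n * \<delta>)"
      using a \<delta> by (simp add: m a_def power_one_over flip: ennreal_mult)
    finally show ?thesis .
  qed
  have "emeasure lborel D = (\<integral>\<^sup>+x. indicator D x \<partial>lborel)" by simp
  also have "\<dots> = ennreal (real n) * (\<integral>\<^sup>+x. indicator (ball 0 1 - {0}) x *
     (\<integral>\<^sup>+r. indicator {0<..} r * (indicator D (r *\<^sub>R sgn x) * ennreal (r ^ (n - 1))) \<partial>lborel) \<partial>lborel)"
    by (subst polar_coordinates) (simp_all add: n_def)
  also have "(\<integral>\<^sup>+x. indicator (ball 0 1 - {0}) x *
     (\<integral>\<^sup>+r. indicator {0<..} r * (indicator D (r *\<^sub>R sgn x) * ennreal (r ^ (n - 1))) \<partial>lborel) \<partial>lborel)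
     = (\<integral>\<^sup>+x. indicator (ball 0 1 - {0}) x *
     (ennreal (1 / ?h (sgn x) ^ n * \<delta>) * (\<integral>\<^sup>+\<tau>. shell \<beta> K \<delta> t (X x) \<tau> \<partial>lborel)) \<partial>lborel)"
  proof (intro nn_integral_cong)
    fix x :: "'n vec"
    show "indicator (ball 0 1 - {0}) x * (\<integral>\<^sup>+r. indicator {0<..} r * (indicator D (r *\<^sub>R sgn x) * ennreal (r ^ (n - 1))) \<partial>lborel)
      = indicator (ball 0 1 - {0}) x * (ennreal (1 / ?h (sgn x) ^ n * \<delta>) * (\<integral>\<^sup>+\<tau>. shell \<beta> K \<delta> t (X x) \<tau> \<partial>lborel))"
    proof (cases "x = 0")
      case False
      show ?thesis unfolding inner[OF False] ..
    qed simp
  qed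
  finally show ?thesis by (simp add: D_def n_def)
qed

end

section \<open>Measurability of the curvature function and the volume limit\<close>

context dual_C2_body
begin

text \<open>Uniqueness of the dual point justifies the definite description. The factor c allows an
  arbitrary positive multiple of the boundary point, in particular a unit direction.\<close>

lemma curvature_fun_polar:
  assumes xy: "x0 \<in> K" "y0 \<in> polar K" "x0 \<bullet> y0 = 1" and "c > 0"
  shows "curvature_fun (polar K) (c *\<^sub>R x0) = 1 / gauss_curvature (polar K) y0"
proof -
  interpret L: centred_body "polar K" by (rule centred_body_polar)
  have h: "support_fun (polar K) (c *\<^sub>R x0) = c"
    using contact_frontier(1)[OF xy] \<open>c > 0\<close> by (simp add: support_fun_scaleR[OF L.compact L.nonempty] frontier_eq)
  have "(THE y. y \<in> frontier (polar K) \<and> (c *\<^sub>R x0) \<bullet> y = support_fun (polar K) (c *\<^sub>R x0)) = y0"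
  proof (rule the_equality)
    show "y0 \<in> frontier (polar K) \<and> (c *\<^sub>R x0) \<bullet> y0 = support_fun (polar K) (c *\<^sub>R x0)"
      using contact_frontier(2)[OF xy] by (simp add: h xy)
    fix y assume y: "y \<in> frontier (polar K) \<and> (c *\<^sub>R x0) \<bullet> y = support_fun (polar K) (c *\<^sub>R x0)"
    then have "x0 \<bullet> y = 1" using \<open>c > 0\<close> by (simp add: h)
    moreover have "y \<in> polar K" using y compact_imp_closed[OF L.compact] frontier_subset_closed by blast
    ultimately show "y = y0" using dual_point_unique xy by blast
  qed
  then show ?thesis by (simp add: curvature_fun_def)
qed

lemma curvature_fun_asymptotics:
  fixes \<beta> :: real
  defines "p \<equiv> (real CARD('n) + 1) / 2"
  assumes \<beta>: "\<beta> > p" and u: "u \<noteq> 0"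
  defines "x0 \<equiv> (1 / support_fun (polar K) u) *\<^sub>R u"
  shows "curvature_fun (polar K) u > 0"
    and "((\<lambda>\<epsilon>. ennreal (\<epsilon> powr (\<beta> - p)) * polar_integral \<beta> K ((1 - \<epsilon>) *\<^sub>R x0)) \<longlongrightarrow>
       ennreal (c_const CARD('n) \<beta> * (sqrt (curvature_fun (polar K) u) * norm x0 powr (-p)))) (at_right 0)"
proof -
  interpret L: centred_body "polar K" by (rule centred_body_polar)
  have h: "support_fun (polar K) u > 0" by (rule L.support_fun_pos[OF u])
  have "x0 \<in> frontier K" unfolding x0_def by (rule radial_point_frontier[OF u])
  then obtain y0 where xy: "x0 \<in> K" "y0 \<in> polar K" "x0 \<bullet> y0 = 1" using dual_point by blast
  have "u = support_fun (polar K) u *\<^sub>R x0" using h by (simp add: x0_def)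
  then have c: "curvature_fun (polar K) u = 1 / gauss_curvature (polar K) y0"
    using curvature_fun_polar[OF xy h] by simp
  show "curvature_fun (polar K) u > 0"
    unfolding c using polar_integral_asymptotics(1)[OF xy] \<beta> by (simp add: p_def)
  show "((\<lambda>\<epsilon>. ennreal (\<epsilon> powr (\<beta> - p)) * polar_integral \<beta> K ((1 - \<epsilon>) *\<^sub>R x0)) \<longlongrightarrow>
       ennreal (c_const CARD('n) \<beta> * (sqrt (curvature_fun (polar K) u) * norm x0 powr (-p)))) (at_right 0)"
    unfolding c p_def using polar_integral_asymptotics(2)[OF xy] \<beta> by (simp add: p_def)
qed

lemma c_const_pos:
  assumes "\<beta> > (real CARD('n) + 1) / 2"
  shows "c_const CARD('n) \<beta> > 0"
proof -
  have "CARD('n) \<ge> 1" by (simp add: Suc_le_eq card_gt_0_iff)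
  then have "unit_ball_vol (real CARD('n) - 1) > 0" by simp
  moreover have "Beta ((real CARD('n) + 1) / 2) (\<beta> - (real CARD('n) + 1) / 2) > 0"
    using assms by (simp add: Beta_def Gamma_real_pos)
  ultimately show ?thesis by (simp add: c_const_def)
qed

text \<open>The curvature function is recovered from the asymptotics of \<open>polar_integral\<close>, here with \<open>\<beta> = (n + 1) / 2 + 1\<close>,
  as a pointwise limit of measurable functions.\<close>

lemma borel_measurable_curvature_fun: "curvature_fun (polar K) \<in> borel_measurable borel"
proof -
  define \<beta> where "\<beta> = (real CARD('n) + 1) / 2 + 1"
  define p where "p = (real CARD('n) + 1) / 2"
  have \<beta>: "\<beta> > (real CARD('n) + 1) / 2" by (simp add: \<beta>_def)
  define X where "X = (\<lambda>u::'n vec. (1 / support_fun (polar K) u) *\<^sub>R u)"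
  define c where "c = c_const CARD('n) \<beta>"
  have c: "c > 0" unfolding c_def by (rule c_const_pos[OF \<beta>])
  define e where "e = (\<lambda>k::nat. 1 / real (Suc k))"
  \<comment> \<open>A liminf of measurable functions is measurable, and for nonzero u it equals the
    known limit.\<close>
  define \<Lambda> where "\<Lambda> = (\<lambda>u. liminf (\<lambda>k. ennreal (e k powr (\<beta> - p)) * polar_integral \<beta> K ((1 - e k) *\<^sub>R X u)))"
  have [measurable]: "X \<in> borel_measurable borel" unfolding X_def by measurable
  have [measurable]: "\<Lambda> \<in> borel_measurable borel" unfolding \<Lambda>_def by measurable
  have fe: "filterlim e (at_right 0) sequentially"
    unfolding e_def using LIMSEQ_inverse_real_of_nat
    by (intro tendsto_imp_filterlim_at_right) (auto simp: inverse_eq_divide)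
  have \<Lambda>: "\<Lambda> u = ennreal (c * (sqrt (curvature_fun (polar K) u) * norm (X u) powr (-p)))" if "u \<noteq> 0" for u
    unfolding \<Lambda>_def c_def X_def p_def
    by (rule lim_imp_Liminf[OF _ filterlim_compose[OF curvature_fun_asymptotics(2)[OF \<beta> that] fe]]) simp
  \<comment> \<open>The limit is solved for the curvature by dividing out the known factors and
    squaring; the origin, which carries no direction, is split off as a single point.\<close>
  have "curvature_fun (polar K) = (\<lambda>u. if u = 0 then curvature_fun (polar K) 0 else (enn2real (\<Lambda> u) / (c * norm (X u) powr (-p)))\<^sup>2)"
  proof
    fix u
    show "curvature_fun (polar K) u = (if u = 0 then curvature_fun (polar K) 0 else (enn2real (\<Lambda> u) / (c * norm (X u) powr (-p)))\<^sup>2)"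
    proof (cases "u = 0")
      case False
      interpret L: centred_body "polar K" by (rule centred_body_polar)
      have "norm (X u) > 0" using False L.support_fun_pos[OF False] by (simp add: X_def)
      then have n: "norm (X u) powr (-p) > 0" by simp
      have f: "curvature_fun (polar K) u > 0" by (rule curvature_fun_asymptotics(1)[OF \<beta> False])
      have "enn2real (\<Lambda> u) = c * (sqrt (curvature_fun (polar K) u) * norm (X u) powr (-p))"
        unfolding \<Lambda>[OF False] using c f n by simp
      then have "enn2real (\<Lambda> u) / (c * norm (X u) powr (-p)) = sqrt (curvature_fun (polar K) u)"
        using c n by simp
      then show ?thesis using f False by simp
    qed simp
  qed
  also have "\<dots> \<in> borel_measurable borel" by measurable
  finally show ?thesis .
qed

text \<open>Brings the spherical integral into the punctured-ball form of
  \<open>polar_coordinates\<close>, so both sides of the limit become integrals over the same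
  set.\<close>

lemma nn_integral_sphere_measure:
  fixes g :: "'n vec \<Rightarrow> ennreal"
  assumes [measurable]: "g \<in> borel_measurable borel"
  shows "(\<integral>\<^sup>+u. g u \<partial>sphere_measure) = ennreal (real CARD('n)) * (\<integral>\<^sup>+x. indicator (ball 0 1 - {0}) x * g (sgn x) \<partial>lborel)"
proof -
  have s: "(\<lambda>x::'n vec. x /\<^sub>R norm x) = sgn" by (simp add: fun_eq_iff sgn_div_norm)
  have gs: "(\<lambda>x. indicator (ball 0 1 - {0}) x * g (sgn x)) \<in> borel_measurable borel"
    by (intro borel_measurable_times_ennreal borel_measurable_indicator measurable_compose[OF borel_measurable_sgn_vector assms]) simp
  have m: "sgn \<in> measurable (restrict_space lebesgue (ball 0 1 - {0} :: 'n vec set)) borel"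
    by (intro measurable_restrict_space1 measurable_completion) simp
  have "(\<integral>\<^sup>+u. g u \<partial>sphere_measure) = (\<integral>\<^sup>+x. ennreal (real CARD('n)) * g (sgn x) \<partial>restrict_space lebesgue (ball 0 1 - {0} :: 'n vec set))"
    unfolding sphere_measure_def s using m
    by (subst nn_integral_density) (auto simp: nn_integral_distr)
  also have "\<dots> = (\<integral>\<^sup>+x. (ennreal (real CARD('n)) * g (sgn x)) * indicator (ball 0 1 - {0}) x \<partial>lebesgue)"
    by (subst nn_integral_restrict_space) auto
  also have "\<dots> = (\<integral>\<^sup>+x. (ennreal (real CARD('n)) * g (sgn x)) * indicator (ball 0 1 - {0}) x \<partial>lborel)"
    by (rule nn_integral_completion) measurable
  also have "\<dots> = (\<integral>\<^sup>+x. ennreal (real CARD('n)) * (indicator (ball 0 1 - {0}) x * g (sgn x)) \<partial>lborel)"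
    by (intro nn_integral_cong) (simp add: mult_ac)
  also have "\<dots> = ennreal (real CARD('n)) * (\<integral>\<^sup>+x. indicator (ball 0 1 - {0}) x * g (sgn x) \<partial>lborel)"
    by (rule nn_integral_cmult) (simp add: gs)
  finally show ?thesis .
qed

lemma ennreal_volume_difference:
  assumes "t > 0"
  shows "ennreal (vol K - vol (S_beta \<beta> K t)) = emeasure lborel (K - S_beta \<beta> K t)"
    and "vol K - vol (S_beta \<beta> K t) \<ge> 0"
proof -
  have [measurable]: "K \<in> sets borel" using compact by (rule borel_compact)
  have S [measurable]: "S_beta \<beta> K t \<in> sets borel" unfolding S_beta_eq by measurable
  have fin: "emeasure lborel K < \<infinity>" using compact by (rule emeasure_compact_finite)
  have sub: "S_beta \<beta> K t \<subseteq> K" by (auto simp: S_beta_eq)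
  have v: "vol A = measure lborel A" if "A \<in> sets borel" for A :: "'n vec set"
    unfolding vol_def using that by (simp add: measure_completion)
  have d: "vol K - vol (S_beta \<beta> K t) = measure lborel (K - S_beta \<beta> K t)"
    using fin sub by (subst (1 2) v, simp_all) (subst measure_Diff, auto)
  show "vol K - vol (S_beta \<beta> K t) \<ge> 0" unfolding d by simp
  have "emeasure lborel (K - S_beta \<beta> K t) \<le> emeasure lborel K" by (rule emeasure_mono) auto
  then have "emeasure lborel (K - S_beta \<beta> K t) < \<infinity>" using fin by (rule order_le_less_trans)
  then show "ennreal (vol K - vol (S_beta \<beta> K t)) = emeasure lborel (K - S_beta \<beta> K t)"
    unfolding d by (intro emeasure_eq_ennreal_measure[symmetric]) auto
qed

text \<open>With \<delta> = t^(-1/\<alpha>) the prefactor t^(1/\<alpha>) cancels the \<delta> of the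
  radial decomposition exactly. What remains is an integral over directions of inner integrals with
  known pointwise limits and a uniform bound.\<close>

lemma volume_asymptotics:
  fixes \<beta> :: real
  defines "n \<equiv> CARD('n)"
  assumes \<beta>: "\<beta> > (real n + 1) / 2"
  shows "((\<lambda>t. (t / c_const n \<beta>) powr (1 / (\<beta> - (real n + 1) / 2)) * (vol K - vol (S_beta \<beta> K t)))
         \<longlongrightarrow> (\<integral>u. curvature_fun (polar K) u powr (1 / (2 * \<beta> - (real n + 1)))
                  / support_fun (polar K) u powr (real n - (real n + 1) / (2 * \<beta> - (real n + 1)))
                \<partial>sphere_measure)) at_top"
proof -
  interpret L: centred_body "polar K" by (rule centred_body_polar)
  define p where "p = (real n + 1) / 2"
  define \<alpha> where "\<alpha> = \<beta> - p"
  have \<alpha>: "\<alpha> > 0" using \<beta> by (simp add: \<alpha>_def p_def)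
  have \<beta>': "\<beta> > (real CARD('n) + 1) / 2" using \<beta> by (simp add: n_def)
  define c where "c = c_const n \<beta>"
  have c: "c > 0" unfolding c_def n_def by (rule c_const_pos[OF \<beta>'])
  define h where "h = support_fun (polar K)"
  define f where "f = curvature_fun (polar K)"
  have [measurable]: "h \<in> borel_measurable borel" "f \<in> borel_measurable borel"
    unfolding h_def f_def by (auto intro: borel_measurable_support_fun borel_measurable_curvature_fun)
  define g where "g = (\<lambda>u. f u powr (1 / (2 * \<beta> - (real n + 1))) / h u powr (real n - (real n + 1) / (2 * \<beta> - (real n + 1))))"
  have [measurable]: "g \<in> borel_measurable borel" unfolding g_def by measurable
  have g0: "g u \<ge> 0" for u by (simp add: g_def)
  define X where "X = (\<lambda>x::'n vec. (1 / h (sgn x)) *\<^sub>R sgn x)"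
  have [measurable]: "X \<in> borel_measurable borel" unfolding X_def by measurable
  have hs: "h (sgn x) > 0" if "x \<noteq> 0" for x
    unfolding h_def using that by (intro L.support_fun_pos) (simp add: sgn_zero_iff)
  obtain M where M: "M > 0"
    "\<And>x0 \<epsilon>. x0 \<in> frontier K \<Longrightarrow> 0 < \<epsilon> \<Longrightarrow> \<epsilon> \<le> 1 \<Longrightarrow>
      polar_integral \<beta> K ((1 - \<epsilon>) *\<^sub>R x0) \<le> ennreal (M * \<epsilon> powr (-\<alpha>))"
    using polar_integral_bound[OF \<beta>'] unfolding \<alpha>_def p_def n_def by blast
  have Xf: "X x \<in> frontier K" if "x \<noteq> 0" for x
    unfolding X_def h_def using that by (intro radial_point_frontier) (simp add: sgn_zero_iff)
  obtain R where R: "\<And>x. x \<in> K \<Longrightarrow> norm x \<le> R" "R > 0"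
    using compact by (meson bounded_pos compact_imp_bounded)
  have h1: "1 / h (sgn x) ^ n \<le> R ^ n" if "x \<noteq> 0" for x
  proof -
    have "X x \<in> K" using Xf[OF that] compact_imp_closed[OF compact] frontier_subset_closed by blast
    then have "1 / h (sgn x) \<le> R" using R(1)[of "X x"] hs[OF that] that by (simp add: X_def norm_sgn)
    then have "(1 / h (sgn x)) ^ n \<le> R ^ n" using hs[OF that] by (intro power_mono) auto
    then show ?thesis by (simp add: power_one_over)
  qed
  define A where "A = (\<lambda>x. c * (sqrt (f (sgn x)) * norm (X x) powr (-p)))"
  have [measurable]: "A \<in> borel_measurable borel" unfolding A_def by measurable
  have fs: "f (sgn x) > 0" if "x \<noteq> 0" for x
    unfolding f_def using that by (intro curvature_fun_asymptotics(1)[OF \<beta>']) (simp add: sgn_zero_iff)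
  have A: "A x > 0" "((\<lambda>\<epsilon>. ennreal (\<epsilon> powr \<alpha>) * polar_integral \<beta> K ((1 - \<epsilon>) *\<^sub>R X x)) \<longlongrightarrow> ennreal (A x)) (at_right 0)"
    if "x \<noteq> 0" for x
  proof -
    have sx: "sgn x \<noteq> 0" using that by (simp add: sgn_zero_iff)
    have "X x \<noteq> 0" using hs[OF that] sx by (simp add: X_def)
    then show "A x > 0" unfolding A_def using c fs[OF that] by simp
    show "((\<lambda>\<epsilon>. ennreal (\<epsilon> powr \<alpha>) * polar_integral \<beta> K ((1 - \<epsilon>) *\<^sub>R X x)) \<longlongrightarrow> ennreal (A x)) (at_right 0)"
      using curvature_fun_asymptotics(2)[OF \<beta>' sx] unfolding A_def X_def \<alpha>_def p_def n_def f_def h_def c_def .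
  qed
  \<comment> \<open>All exponents of the final integrand arise here: the norm of \<open>X x\<close>
    is 1/h, and raising the limit to 1/\<alpha> turns sqrt f into f^(1/(2 \<alpha>)) and h^p into
    h^(p/\<alpha>), to be combined with h^(-n).\<close>
  have gA: "1 / h (sgn x) ^ n * A x powr (1/\<alpha>) = c powr (1/\<alpha>) * g (sgn x)" if "x \<noteq> 0" for x
  proof -
    define H where "H = h (sgn x)"
    define F where "F = f (sgn x)"
    have H: "H > 0" and F: "F > 0" using hs[OF that] fs[OF that] by (auto simp: H_def F_def)
    have nX: "norm (X x) = 1 / H" using hs[OF that] that by (simp add: X_def H_def norm_sgn)
    have "A x = c * (F powr (1/2) * H powr p)"
      unfolding A_def nX using F H by (simp add: F_def[symmetric] powr_half_sqrt powr_divide powr_minus)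
    then have a1: "A x powr (1/\<alpha>) = c powr (1/\<alpha>) * (F powr (1/(2*\<alpha>)) * H powr (p/\<alpha>))"
      using c F H by (simp add: powr_mult powr_powr)
    have a2: "1 / H ^ n = H powr (- real n)" using H by (simp add: powr_minus powr_realpow inverse_eq_divide)
    have a3: "H powr (- real n) * H powr (p/\<alpha>) = 1 / H powr (real n - p/\<alpha>)"
      using H by (simp flip: powr_add powr_minus_divide)
    have a4: "1 / (2*\<alpha>) = 1 / (2 * \<beta> - (real n + 1))" "p/\<alpha> = (real n + 1) / (2 * \<beta> - (real n + 1))"
      using \<alpha> by (simp_all add: \<alpha>_def p_def field_simps)
    have "1 / H ^ n * A x powr (1/\<alpha>) = c powr (1/\<alpha>) * (F powr (1/(2*\<alpha>)) * (H powr (- real n) * H powr (p/\<alpha>)))"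
      unfolding a1 a2 by (simp only: mult_ac)
    then show ?thesis
      unfolding a3 unfolding a4 g_def H_def[symmetric] F_def[symmetric] by simp
  qed
  have [measurable]: "ball 0 1 - {0::'n vec} \<in> sets borel" by simp
  define V where "V = (\<lambda>t. vol K - vol (S_beta \<beta> K t))"
  \<comment> \<open>R bounds 1/h because the boundary point lies in K, and M^(1/\<alpha>) bounds the
    inner integral.\<close>
  define W where "W = (\<lambda>x::'n vec. indicator (ball 0 1 - {0}) x * ennreal (R ^ n * M powr (1/\<alpha>)))"
  have Wfin: "(\<integral>\<^sup>+x. W x \<partial>(lborel :: 'n vec measure)) < \<infinity>"
  proof -
    have "(\<integral>\<^sup>+x. W x \<partial>(lborel :: 'n vec measure)) = emeasure lborel (ball 0 1 - {0} :: 'n vec set) * ennreal (R ^ n * M powr (1/\<alpha>))"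
      unfolding W_def by (subst nn_integral_multc) simp_all
    moreover have "emeasure lborel (ball 0 1 - {0} :: 'n vec set) \<le> emeasure lborel (ball 0 1 :: 'n vec set)"
      by (intro emeasure_mono) auto
    moreover have "emeasure lborel (ball 0 1 :: 'n vec set) < \<infinity>" by (intro emeasure_bounded_finite) simp
    ultimately show ?thesis by (simp add: ennreal_mult_less_top order_le_less_trans)
  qed
  define Q where "Q = (\<integral>\<^sup>+x. indicator (ball 0 1 - {0}) x * ennreal (c powr (1/\<alpha>) * g (sgn x)) \<partial>lborel)"
  have Qeq: "ennreal (real n) * Q = ennreal (c powr (1/\<alpha>)) * (\<integral>\<^sup>+u. g u \<partial>sphere_measure)"
  proof -
    have "Q = (\<integral>\<^sup>+x. ennreal (c powr (1/\<alpha>)) * (indicator (ball 0 1 - {0}) x * ennreal (g (sgn x))) \<partial>lborel)"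
      unfolding Q_def by (intro nn_integral_cong) (simp add: ennreal_mult g0 mult.left_commute)
    also have "\<dots> = ennreal (c powr (1/\<alpha>)) * (\<integral>\<^sup>+x. indicator (ball 0 1 - {0}) x * ennreal (g (sgn x)) \<partial>lborel)"
      by (rule nn_integral_cmult) simp
    finally show ?thesis by (simp add: nn_integral_sphere_measure n_def mult_ac)
  qed
  show ?thesis
    unfolding c_def[symmetric] f_def[symmetric] h_def[symmetric] g_def[symmetric] p_def[symmetric] \<alpha>_def[symmetric]
  proof (rule tendsto_at_topI_sequentially)
    fix t :: "nat \<Rightarrow> real" assume t: "filterlim t at_top sequentially"
    obtain k0 where k0: "\<And>k. k \<ge> k0 \<Longrightarrow> t k > 0"
      using filterlim_at_top_dense[THEN iffD1, OF t, rule_format, of 0] by (auto simp: eventually_sequentially)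
    \<comment> \<open>A shifted sequence, because the shell estimates require positive t for every
      index; the shift is undone by \<open>LIMSEQ_offset\<close>.\<close>
    define s where "s = (\<lambda>k. t (k + k0))"
    have s: "s k > 0" for k using k0 by (simp add: s_def)
    have st: "filterlim s at_top sequentially"
      unfolding s_def by (rule filterlim_compose[OF t filterlim_add_const_nat_at_top])
    define I where "I = (\<lambda>k x. \<integral>\<^sup>+\<tau>. shell \<beta> K (s k powr (-1/\<alpha>)) (s k) (X x) \<tau> \<partial>lborel)"
    have mI [measurable]: "I k \<in> borel_measurable lborel" for k
    proof -
      have "(\<lambda>(z, \<tau>). shell \<beta> K (s k powr (-1/\<alpha>)) (s k) z \<tau>) \<in> borel_measurable (borel \<Otimes>\<^sub>M lborel)"
        using borel_measurable_shell[OF polar_borel] by (simp cong: measurable_cong_sets)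
      from lborel.borel_measurable_nn_integral[OF this]
      have [measurable]: "(\<lambda>z. \<integral>\<^sup>+\<tau>. shell \<beta> K (s k powr (-1/\<alpha>)) (s k) z \<tau> \<partial>lborel) \<in> borel_measurable borel" by simp
      show ?thesis unfolding I_def by measurable
    qed
    have I_lim: "(\<lambda>k. I k x) \<longlonglongrightarrow> ennreal (A x powr (1/\<alpha>))" if "x \<noteq> 0" for x
      unfolding I_def
      by (rule shell_integral_limit[OF polar_borel \<alpha> M(1) s st M(2)[OF Xf[OF that]] A[OF that]])
    have I_le: "I k x \<le> ennreal (M powr (1/\<alpha>))" if "x \<noteq> 0" for k x
    proof -
      have "I k x \<le> (\<integral>\<^sup>+\<tau>. indicator {0..M powr (1/\<alpha>)} \<tau> \<partial>lborel)"
        unfolding I_def by (intro nn_integral_mono shell_le \<alpha> M(1) s M(2)[OF Xf[OF that]])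
      then show ?thesis using M by simp
    qed
    define Z where "Z = (\<lambda>k x. indicator (ball 0 1 - {0}) x * (ennreal (1 / h (sgn x) ^ n) * I k x))"
    have mZ: "Z k \<in> borel_measurable lborel" for k unfolding Z_def by measurable
    have ZW: "Z k x \<le> W x" for k x
    proof (cases "x = 0")
      case False
      have "ennreal (1 / h (sgn x) ^ n) * I k x \<le> ennreal (R ^ n) * ennreal (M powr (1/\<alpha>))"
        using h1[OF False] by (intro mult_mono I_le[OF False] ennreal_leI) auto
      also have "\<dots> = ennreal (R ^ n * M powr (1/\<alpha>))" using R by (simp add: ennreal_mult)
      finally show ?thesis unfolding Z_def W_def by (rule mult_left_mono) simp
    qed (simp add: Z_def)
    have Zlim: "(\<lambda>k. \<integral>\<^sup>+x. Z k x \<partial>lborel) \<longlonglongrightarrow> Q"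
      unfolding Q_def
    proof (rule nn_integral_dominated_convergence[where w = W])
      show "AE x in lborel. Z k x \<le> W x" for k by (simp add: ZW)
      show "AE x in lborel. (\<lambda>k. Z k x) \<longlonglongrightarrow> indicator (ball 0 1 - {0}) x * ennreal (c powr (1/\<alpha>) * g (sgn x))"
      proof (rule AE_I2)
        fix x :: "'n vec"
        show "(\<lambda>k. Z k x) \<longlonglongrightarrow> indicator (ball 0 1 - {0}) x * ennreal (c powr (1/\<alpha>) * g (sgn x))"
        proof (cases "x \<in> ball 0 1 - {0}")
          case True
          then have x: "x \<noteq> 0" by simp
          have "(\<lambda>k. ennreal (1 / h (sgn x) ^ n) * I k x) \<longlonglongrightarrow> ennreal (1 / h (sgn x) ^ n) * ennreal (A x powr (1/\<alpha>))"
            by (intro ennreal_tendsto_cmult I_lim x) simp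
          also have "ennreal (1 / h (sgn x) ^ n) * ennreal (A x powr (1/\<alpha>)) = ennreal (c powr (1/\<alpha>) * g (sgn x))"
            unfolding gA[OF x, symmetric] using hs[OF x] by (intro ennreal_mult[symmetric]) auto
          finally show ?thesis using True by (simp add: Z_def)
        next
          case False
          then have "indicator (ball 0 1 - {0}) x = (0 :: ennreal)" by (rule indicator_simps)
          then show ?thesis by (simp add: Z_def)
        qed
      qed
    qed (use Wfin mZ in \<open>simp_all add: W_def\<close>)
    have "Q \<le> (\<integral>\<^sup>+x. W x \<partial>lborel)"
      by (intro LIMSEQ_le_const2[OF Zlim] exI[of _ 0] allI impI nn_integral_mono ZW)
    \<comment> \<open>Finiteness of the limit is what allows passing from \<open>ennreal\<close>
      back to real convergence.\<close>
    then have Qfin: "Q < \<infinity>" using Wfin by (rule order_le_less_trans)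
    have VZ: "ennreal (s k powr (1/\<alpha>) * V (s k)) = ennreal (real n) * (\<integral>\<^sup>+x. Z k x \<partial>lborel)" for k
    proof -
      define \<delta> where "\<delta> = s k powr (-1/\<alpha>)"
      have \<delta>: "\<delta> > 0" using s[of k] by (simp add: \<delta>_def)
      have \<delta>s: "s k powr (1/\<alpha>) * \<delta> = 1" using s[of k] by (simp add: \<delta>_def flip: powr_add)
      have "indicator (ball 0 1 - {0}) x * (ennreal (1 / support_fun (polar K) (sgn x) ^ n * \<delta>) *
           (\<integral>\<^sup>+\<tau>. shell \<beta> K \<delta> (s k) ((1 / support_fun (polar K) (sgn x)) *\<^sub>R sgn x) \<tau> \<partial>lborel)) = ennreal \<delta> * Z k x"
        for x :: "'n vec"
      proof (cases "x = 0")
        case False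
        have "ennreal (1 / h (sgn x) ^ n * \<delta>) = ennreal (1 / h (sgn x) ^ n) * ennreal \<delta>"
          using hs[OF False] \<delta> by (intro ennreal_mult) auto
        then show ?thesis unfolding Z_def I_def X_def h_def[symmetric] \<delta>_def[symmetric] by (simp only: mult_ac)
      qed (simp add: Z_def)
      then have "emeasure lborel (K - S_beta \<beta> K (s k)) = ennreal (real n) * (\<integral>\<^sup>+x. ennreal \<delta> * Z k x \<partial>lborel)"
        unfolding emeasure_body_minus_S_beta[OF \<delta>] n_def[symmetric] by (simp only:)
      also have "\<dots> = ennreal (real n) * (ennreal \<delta> * (\<integral>\<^sup>+x. Z k x \<partial>lborel))"
        using mZ by (simp add: nn_integral_cmult)
      finally have e: "ennreal (V (s k)) = ennreal (real n) * (ennreal \<delta> * (\<integral>\<^sup>+x. Z k x \<partial>lborel))"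
        unfolding V_def ennreal_volume_difference(1)[OF s] .
      have "ennreal (s k powr (1/\<alpha>) * V (s k)) = ennreal (s k powr (1/\<alpha>)) * ennreal (V (s k))"
        using ennreal_volume_difference(2)[OF s] by (intro ennreal_mult) (auto simp: V_def)
      also have "\<dots> = (ennreal (s k powr (1/\<alpha>)) * ennreal \<delta>) * (ennreal (real n) * (\<integral>\<^sup>+x. Z k x \<partial>lborel))"
        unfolding e by (simp only: mult_ac)
      also have "ennreal (s k powr (1/\<alpha>)) * ennreal \<delta> = 1" using \<delta>s \<delta> by (simp flip: ennreal_mult)
      finally show ?thesis by simp
    qed
    have "(\<lambda>k. ennreal (s k powr (1/\<alpha>) * V (s k))) \<longlonglongrightarrow> ennreal (real n) * Q"
      unfolding VZ by (intro ennreal_tendsto_cmult Zlim) simp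
    moreover have nQ: "ennreal (real n) * Q < \<infinity>" using Qfin by (simp add: ennreal_mult_less_top)
    ultimately have "(\<lambda>k. enn2real (ennreal (s k powr (1/\<alpha>) * V (s k)))) \<longlonglongrightarrow> enn2real (ennreal (real n) * Q)"
      by (intro tendsto_enn2real) auto
    moreover have "enn2real (ennreal (s k powr (1/\<alpha>) * V (s k))) = s k powr (1/\<alpha>) * V (s k)" for k
      using ennreal_volume_difference(2)[OF s, of \<beta> k] by (simp add: V_def)
    moreover have "enn2real (ennreal (real n) * Q) = c powr (1/\<alpha>) * (\<integral>u. g u \<partial>sphere_measure)"
    proof -
      have "(\<integral>u. g u \<partial>sphere_measure) = enn2real (\<integral>\<^sup>+u. g u \<partial>sphere_measure)"
        by (rule integral_eq_nn_integral) (auto simp: g0 sphere_measure_def)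
      then show ?thesis unfolding Qeq by (simp add: enn2real_mult)
    qed
    ultimately have "(\<lambda>k. s k powr (1/\<alpha>) * V (s k)) \<longlonglongrightarrow> c powr (1/\<alpha>) * (\<integral>u. g u \<partial>sphere_measure)" by simp
    \<comment> \<open>The normalisation by c is applied only now; it cancels the factor
      c^(1/\<alpha>) that \<open>gA\<close> separated from the integrand.\<close>
    from tendsto_mult_left[OF this, of "(1 / c) powr (1/\<alpha>)"]
    have "(\<lambda>k. (1 / c) powr (1/\<alpha>) * (s k powr (1/\<alpha>) * V (s k))) \<longlonglongrightarrow> (1 / c) powr (1/\<alpha>) * (c powr (1/\<alpha>) * (\<integral>u. g u \<partial>sphere_measure))" .
    moreover have "(1 / c) powr (1/\<alpha>) * (s k powr (1/\<alpha>) * V (s k)) = (s k / c) powr (1/\<alpha>) * V (s k)" for k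
      using c s[of k] by (simp add: powr_divide)
    moreover have "(1 / c) powr (1/\<alpha>) * (c powr (1/\<alpha>) * (\<integral>u. g u \<partial>sphere_measure)) = (\<integral>u. g u \<partial>sphere_measure)"
      using c by (simp add: powr_divide)
    ultimately have "(\<lambda>k. (s k / c) powr (1/\<alpha>) * V (s k)) \<longlonglongrightarrow> (\<integral>u. g u \<partial>sphere_measure)" by simp
    then have "(\<lambda>k. (t k / c) powr (1/\<alpha>) * V (t k)) \<longlonglongrightarrow> (\<integral>u. g u \<partial>sphere_measure)"
      unfolding s_def by (rule LIMSEQ_offset)
    then show "(\<lambda>k. (t k / c) powr (1/\<alpha>) * (vol K - vol (S_beta \<beta> K (t k)))) \<longlonglongrightarrow> (\<integral>u. g u \<partial>sphere_measure)"
      unfolding V_def .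
  qed
qed

end

theorem theorem6:
  fixes K :: "('n::finite) vec set" and \<beta> :: real
  defines "n \<equiv> CARD('n)"
  assumes "n \<ge> 2"
    and "convex_body K"
    and "is_santalo_point K 0"
    and "C3_boundary K"
    and "\<forall>x\<in>frontier K. gauss_curvature K x > 0"
    and "\<beta> > (real n + 1) / 2"
  shows "((\<lambda>t. (t / c_const n \<beta>) powr (1 / (\<beta> - (real n + 1) / 2))
                * (vol K - vol (S_beta \<beta> K t)))
         \<longlongrightarrow> (\<integral>u. curvature_fun (polar K) u powr (1 / (2 * \<beta> - (real n + 1)))
                  / support_fun (polar K) u powr (real n - (real n + 1) / (2 * \<beta> - (real n + 1)))
                \<partial>sphere_measure)) at_top"
proof -
  interpret centred_body K
    using assms(3,4) by unfold_locales (auto simp: convex_body_def is_santalo_point_def)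
  have C2: "\<exists>U \<rho>. local_defining_fun K x U \<rho> \<and> C2_on U \<rho>" if "x \<in> frontier K" for x
    using assms(5) that C3_on_imp_C2_on unfolding C3_boundary_def by blast
  have "\<exists>U \<rho>. local_defining_fun (polar K) y U \<rho> \<and> C2_on U \<rho>" if "y \<in> frontier (polar K)" for y
    using ex_C2_defining_fun_polar[OF that C2] assms(6) by fastforce
  then interpret dual_C2_body K
    by unfold_locales (use C2 in auto)
  show ?thesis
    using volume_asymptotics assms(7) unfolding n_def by blast
qed

end
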